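(* Let $X$ be a proper CAT(0) space with curtain model $X_D$. The Gromov boundary $\partial X_D$ embeds homeomorphically as an $\operatorname{Isom}X$-invariant subspace of the visual boundary $\partial X$ (with the cone topology), and every point in the image of $\partial X_D$ is a visibility point of $\partial X$. The embedding is induced by the change-of-metric map $X_D\to X$. If $\partial X_D$ is nonempty and $X$ is cobounded, then (the image of) $\partial X_D$ is dense in $\partial X$.
   Context: **Curtains.** Let $(X,d)$ be a CAT(0) space. A geodesic is an isometric embedding $\alpha:I\to X$ of an interval $I\subset\mathbb R$, and $\pi_\alpha:X\to\alpha$ is closest-point projection. For $r$ with $[r-\frac12,r+\frac12]$ in the interior of $I$, the curtain dual to $\alpha$ at $r$ is $h=h_{\alpha,r}=\pi_\alpha^{-1}(\alpha[r-\frac12,r+\frac12])$. Its halfspaces are $h^-=\pi_\alpha^{-1}\alpha(I\cap(-\infty,r-\frac12))$ and $h^+=\pi_\alpha^{-1}\alpha(I\cap(r+\frac12,\infty))$. The curtain $h$ separates $A,B\subset X$ if one of them is contained in $h^-$ and the other in $h^+$. A chain is a set of pairwise disjoint curtains $\{h_i\}$, indexed by consecutive integers, such that $h_i$ separates $h_{i-1}$ from $h_{i+1}$ for all $i$; it separates $A$ from $B$ if every $h_i$ does. **$L$-separation and $d_L$.** For $L\in\mathbb N=\{0,1,2,\dots\}$, disjoint curtains $h,h'$ are $L$-separated if every chain all of whose elements meet both $h$ and $h'$ has cardinality at most $L$. An $L$-chain is a chain whose elements are pairwise $L$-separated. Set $d_L(x,x)=0$ and, for $x\neq y$, $d_L(x,y)=1+\max\{|c|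 : c \text{ is an } L\text{-chain separating } x \text{ from } y\}$. **Curtain model.** Fix numbers $\lambda_L\in(0,1)$, $L\ge1$, with $\sum\lambda_L<\sum L\lambda_L<\sum L^2\lambda_L=\Lambda<\infty$. Put $D(x,y)=\sum_{L=1}^\infty\lambda_L d_L(x,y)$. The curtain model is $X_D=(X,D)$. It is hyperbolic, $\operatorname{Isom}X$ acts on it by isometries, and CAT(0) geodesics of $X$ are, up to reparametrisation, uniform $(1,k)$-quasigeodesics of $X_D$. Hence a CAT(0) geodesic ray that is unbounded in $X_D$ represents a point of $\partial X_D$. **Boundaries.** $\partial X$ is the set of geodesic rays of $X$ up to finite Hausdorff distance, equivalently of rays from a fixed basepoint, with the cone topology. A point $\xi\in\partial X$ is a visibility point if for every $\zeta\in\partial X\smallsetminus\{\xi\}$ there is a biinfinite geodesic of $X$ with endpoints $\xi$ and $\zeta$. That the embedding is induced by the change-of-metric map means: its image is the set $\partial_DX\subset\partial X$ of points represented by CAT(0) rays that also represent points of $\partial X_D$, and the inverse $\partial_DX\to\partial X_D$ sends the class of such a ray to the point of $\partial X_D$ that it represents. $X$ is cobounded if $\operatorname{Isom}X$ acts coboundedly on $X$. *)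

theory Defs
  imports "HOL-Analysis.Analysis"
begin

section \<open>CAT(0) spaces\<close>

definition geodesic_on :: "real set \<Rightarrow> (real \<Rightarrow> 'a::metric_space) \<Rightarrow> bool" where
  "geodesic_on I \<alpha> \<longleftrightarrow> is_interval I \<and> (\<forall>s\<in>I. \<forall>t\<in>I. dist (\<alpha> s) (\<alpha> t) = \<bar>s - t\<bar>)"

definition geodesic_between :: "(real \<Rightarrow> 'a::metric_space) \<Rightarrow> 'a \<Rightarrow> 'a \<Rightarrow> bool" where
  "geodesic_between \<alpha> x y \<longleftrightarrow>
     geodesic_on {0..dist x y} \<alpha> \<and> \<alpha> 0 = x \<and> \<alpha> (dist x y) = y"

text \<open>
  The comparison condition is stated for two points on two sides of a geodesic triangle that
  issue from a common vertex \<open>x\<close>. Any two distinct sides share a vertex, so relabelling the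
  vertices gives every pair of sides; for two points on one side the condition is trivial.
  The primed points form the comparison triangle in the Euclidean plane.
\<close>
class cat0_space = metric_space +
  assumes geodesic_exists: "\<exists>\<alpha>. geodesic_between \<alpha> x y"
    and cat0_comparison:
      "\<lbrakk>geodesic_between \<alpha> x y; geodesic_between \<beta> x z;
        dist x' y' = dist x y; dist y' z' = dist y z; dist z' x' = dist z x;
        s \<in> {0..dist x y}; p' \<in> closed_segment x' y'; dist x' p' = s;
        t \<in> {0..dist x z}; q' \<in> closed_segment x' z'; dist x' q' = t\<rbrakk>
       \<Longrightarrow> dist (\<alpha> s) (\<beta> t) \<le> dist p' (q' :: real ^ 2)"

definition isometries :: "('a::metric_space \<Rightarrow> 'a) set" where
  "isometries = {g. bij g \<and> (\<forall>x y. dist (g x) (g y) = dist x y)}"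

definition acts_coboundedly :: "('a::metric_space \<Rightarrow> 'a) set \<Rightarrow> bool" where
  "acts_coboundedly G \<longleftrightarrow> (\<exists>B. bounded B \<and> (\<Union>g\<in>G. g ` B) = UNIV)"


section \<open>Curtains\<close>

definition closest_proj :: "'a::metric_space set \<Rightarrow> 'a \<Rightarrow> 'a" where
  "closest_proj S x = (THE p. p \<in> S \<and> (\<forall>q\<in>S. dist x p \<le> dist x q))"

text \<open>
  The interval \<open>I\<close> is required to be closed (it may be bounded or unbounded), since otherwise
  closest-point projection to the geodesic is not defined on the whole space.
\<close>
definition curtain_data :: "real set \<Rightarrow> (real \<Rightarrow> 'a::metric_space) \<Rightarrow> real \<Rightarrow> bool" where
  "curtain_data I \<alpha> r \<longleftrightarrow>
     geodesic_on I \<alpha> \<and> closed I \<and> {r - 1/2..r + 1/2} \<subseteq> interior I"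

definition dual_curtain :: "real set \<Rightarrow> (real \<Rightarrow> 'a::metric_space) \<Rightarrow> real \<Rightarrow> 'a set" where
  "dual_curtain I \<alpha> r = closest_proj (\<alpha> ` I) -` (\<alpha> ` {r - 1/2..r + 1/2})"

definition neg_halfspace :: "real set \<Rightarrow> (real \<Rightarrow> 'a::metric_space) \<Rightarrow> real \<Rightarrow> 'a set" where
  "neg_halfspace I \<alpha> r = closest_proj (\<alpha> ` I) -` (\<alpha> ` (I \<inter> {..<r - 1/2}))"

definition pos_halfspace :: "real set \<Rightarrow> (real \<Rightarrow> 'a::metric_space) \<Rightarrow> real \<Rightarrow> 'a set" where
  "pos_halfspace I \<alpha> r = closest_proj (\<alpha> ` I) -` (\<alpha> ` (I \<inter> {r + 1/2<..}))"

text \<open>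
  Curtains are treated as subsets of the space. In a complete CAT(0) space the two halfspaces are
  the connected components of the complement of the curtain, so the unordered pair of halfspaces,
  and hence the separation relation, depends only on that subset.
\<close>
definition is_curtain :: "'a::metric_space set \<Rightarrow> bool" where
  "is_curtain h \<longleftrightarrow> (\<exists>I \<alpha> r. curtain_data I \<alpha> r \<and> h = dual_curtain I \<alpha> r)"

definition separates :: "'a::metric_space set \<Rightarrow> 'a set \<Rightarrow> 'a set \<Rightarrow> bool" where
  "separates h A B \<longleftrightarrow>
     (\<exists>I \<alpha> r. curtain_data I \<alpha> r \<and> h = dual_curtain I \<alpha> r \<and>
        (A \<subseteq> neg_halfspace I \<alpha> r \<and> B \<subseteq> pos_halfspace I \<alpha> r \<or>
         B \<subseteq> neg_halfspace I \<alpha> r \<and> A \<subseteq> pos_halfspace I \<alpha> r))"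

text \<open>
  The index set \<open>J\<close> is any set of consecutive integers: empty, finite, or infinite in one or both
  directions. In particular the empty set is a chain.
\<close>
definition is_chain :: "'a::metric_space set set \<Rightarrow> bool" where
  "is_chain c \<longleftrightarrow>
     (\<exists>(J :: int set) h.
        (\<forall>i\<in>J. \<forall>k\<in>J. {i..k} \<subseteq> J) \<and> c = h ` J \<and>
        (\<forall>i\<in>J. is_curtain (h i)) \<and> disjoint_family_on h J \<and>
        (\<forall>i. i - 1 \<in> J \<and> i + 1 \<in> J \<longrightarrow> separates (h i) (h (i - 1)) (h (i + 1))))"

definition chain_separates :: "'a::metric_space set set \<Rightarrow> 'a set \<Rightarrow> 'a set \<Rightarrow> bool" where
  "chain_separates c A B \<longleftrightarrow> (\<forall>h\<in>c. separates h A B)"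

definition L_separated :: "nat \<Rightarrow> 'a::metric_space set \<Rightarrow> 'a set \<Rightarrow> bool" where
  "L_separated L h h' \<longleftrightarrow>
     h \<inter> h' = {} \<and>
     (\<forall>c. is_chain c \<and> (\<forall>k\<in>c. k \<inter> h \<noteq> {} \<and> k \<inter> h' \<noteq> {}) \<longrightarrow> finite c \<and> card c \<le> L)"

definition L_chain :: "nat \<Rightarrow> 'a::metric_space set set \<Rightarrow> bool" where
  "L_chain L c \<longleftrightarrow> is_chain c \<and> pairwise (L_separated L) c"


section \<open>The curtain model\<close>

text \<open>
  Curtains have thickness one, so chains separating two given points are finite and of bounded
  length; the maximum below therefore ranges over a finite set, which contains \<open>0\<close> because of the
  empty chain.
\<close>
definition d_L :: "nat \<Rightarrow> 'a::metric_space \<Rightarrow> 'a \<Rightarrow> nat" where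
  "d_L L x y =
     (if x = y then 0 else 1 + Max {card c | c. L_chain L c \<and> chain_separates c {x} {y}})"

text \<open>Weights are indexed from \<open>1\<close>; the value \<open>lam 0\<close> plays no role.\<close>
definition curtain_weights :: "(nat \<Rightarrow> real) \<Rightarrow> bool" where
  "curtain_weights lam \<longleftrightarrow>
     (\<forall>L\<ge>1. 0 < lam L \<and> lam L < 1) \<and>
     summable (\<lambda>n. real (Suc n) ^ 2 * lam (Suc n)) \<and>
     (\<Sum>n. lam (Suc n)) < (\<Sum>n. real (Suc n) * lam (Suc n)) \<and>
     (\<Sum>n. real (Suc n) * lam (Suc n)) < (\<Sum>n. real (Suc n) ^ 2 * lam (Suc n))"

definition curtain_dist :: "(nat \<Rightarrow> real) \<Rightarrow> 'a::metric_space \<Rightarrow> 'a \<Rightarrow> real" where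
  "curtain_dist lam x y = (\<Sum>n. lam (Suc n) * real (d_L (Suc n) x y))"


section \<open>The visual boundary\<close>

text \<open>
  Rays are parametrised by \<open>[0,\<infinity>)\<close>; their values at negative arguments are irrelevant, and
  two functions agreeing on \<open>[0,\<infinity>)\<close> are identified in the boundary.
\<close>
definition geodesic_ray :: "(real \<Rightarrow> 'a::metric_space) \<Rightarrow> bool" where
  "geodesic_ray \<alpha> \<longleftrightarrow> geodesic_on {0..} \<alpha>"

definition finite_hausdorff_dist :: "'a::metric_space set \<Rightarrow> 'a set \<Rightarrow> bool" where
  "finite_hausdorff_dist A B \<longleftrightarrow>
     (\<exists>C. (\<forall>a\<in>A. \<exists>b\<in>B. dist a b \<le> C) \<and> (\<forall>b\<in>B. \<exists>a\<in>A. dist a b \<le> C))"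

definition visual_boundary :: "(real \<Rightarrow> 'a::metric_space) set set" where
  "visual_boundary =
     {\<alpha>. geodesic_ray \<alpha>} //
     {(\<alpha>, \<beta>). geodesic_ray \<alpha> \<and> geodesic_ray \<beta> \<and> finite_hausdorff_dist (\<alpha> ` {0..}) (\<beta> ` {0..})}"

text \<open>
  In a complete CAT(0) space each boundary point is represented by exactly one ray from the
  basepoint \<open>b\<close> (up to values at negative arguments).
\<close>
definition cone_nbhd ::
    "'a::metric_space \<Rightarrow> (real \<Rightarrow> 'a) set \<Rightarrow> real \<Rightarrow> real \<Rightarrow> (real \<Rightarrow> 'a) set set" where
  "cone_nbhd b \<xi> R e =
     {\<zeta>\<in>visual_boundary. \<exists>\<alpha>\<in>\<xi>. \<exists>\<beta>\<in>\<zeta>. \<alpha> 0 = b \<and> \<beta> 0 = b \<and> dist (\<alpha> R) (\<beta> R) < e}"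

definition cone_topology :: "'a::metric_space \<Rightarrow> (real \<Rightarrow> 'a) set topology" where
  "cone_topology b =
     topology_generated_by {cone_nbhd b \<xi> R e | \<xi> R e. \<xi> \<in> visual_boundary \<and> 0 < R \<and> 0 < e}"

definition visibility_point :: "(real \<Rightarrow> 'a::metric_space) set \<Rightarrow> bool" where
  "visibility_point \<xi> \<longleftrightarrow>
     \<xi> \<in> visual_boundary \<and>
     (\<forall>\<zeta>\<in>visual_boundary - {\<xi>}. \<exists>\<gamma>. geodesic_on UNIV \<gamma> \<and> \<gamma> \<in> \<xi> \<and> (\<lambda>t. \<gamma> (- t)) \<in> \<zeta>)"

definition boundary_action ::
    "('a::metric_space \<Rightarrow> 'a) \<Rightarrow> (real \<Rightarrow> 'a) set \<Rightarrow> (real \<Rightarrow> 'a) set" where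
  "boundary_action g \<xi> = (\<lambda>\<alpha>. g \<circ> \<alpha>) ` \<xi>"


section \<open>The Gromov boundary\<close>

text \<open>
  The metric is an explicit argument \<open>D\<close>. As the curtain model is neither proper nor geodesic in
  general, its boundary is the sequential one: sequences converging to infinity modulo equivalence.
  When \<open>D\<close> is hyperbolic the relation below is an equivalence; the boundary and its
  topology do not depend on the basepoint \<open>b\<close>.
\<close>
definition gromov_product :: "('a \<Rightarrow> 'a \<Rightarrow> real) \<Rightarrow> 'a \<Rightarrow> 'a \<Rightarrow> 'a \<Rightarrow> real" where
  "gromov_product D b x y = (D b x + D b y - D x y) / 2"

definition converges_to_infinity :: "('a \<Rightarrow> 'a \<Rightarrow> real) \<Rightarrow> 'a \<Rightarrow> (nat \<Rightarrow> 'a) \<Rightarrow> bool" where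
  "converges_to_infinity D b x \<longleftrightarrow>
     filterlim (\<lambda>(m, n). gromov_product D b (x m) (x n)) at_top (sequentially \<times>\<^sub>F sequentially)"

definition gromov_boundary :: "('a \<Rightarrow> 'a \<Rightarrow> real) \<Rightarrow> 'a \<Rightarrow> (nat \<Rightarrow> 'a) set set" where
  "gromov_boundary D b =
     {x. converges_to_infinity D b x} //
     {(x, y). converges_to_infinity D b x \<and> converges_to_infinity D b y \<and>
        filterlim (\<lambda>n. gromov_product D b (x n) (y n)) at_top sequentially}"

definition boundary_gromov_product ::
    "('a \<Rightarrow> 'a \<Rightarrow> real) \<Rightarrow> 'a \<Rightarrow> (nat \<Rightarrow> 'a) set \<Rightarrow> (nat \<Rightarrow> 'a) set \<Rightarrow> ereal" where
  "boundary_gromov_product D b \<eta> \<theta> =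
     (SUP (x, y)\<in>\<eta> \<times> \<theta>.
        Liminf (sequentially \<times>\<^sub>F sequentially) (\<lambda>(m, n). ereal (gromov_product D b (x m) (y n))))"

text \<open>
  The sets \<open>{\<theta>. boundary_gromov_product D b \<eta> \<theta> \<ge> r}\<close>, which need not be open,
  form a neighbourhood basis at \<open>\<eta>\<close>.
\<close>
definition gromov_open :: "('a \<Rightarrow> 'a \<Rightarrow> real) \<Rightarrow> 'a \<Rightarrow> (nat \<Rightarrow> 'a) set set \<Rightarrow> bool" where
  "gromov_open D b U \<longleftrightarrow>
     U \<subseteq> gromov_boundary D b \<and>
     (\<forall>\<eta>\<in>U. \<exists>r::real. \<forall>\<theta>\<in>gromov_boundary D b.
        ereal r \<le> boundary_gromov_product D b \<eta> \<theta> \<longrightarrow> \<theta> \<in> U)"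

definition gromov_topology :: "('a \<Rightarrow> 'a \<Rightarrow> real) \<Rightarrow> 'a \<Rightarrow> (nat \<Rightarrow> 'a) set topology" where
  "gromov_topology D b = topology (gromov_open D b)"

lemma istopology_gromov_open: "istopology (gromov_open D b)"
  unfolding istopology_def
proof (intro conjI allI impI)
  fix S T assume S: "gromov_open D b S" and T: "gromov_open D b T"
  show "gromov_open D b (S \<inter> T)"
    unfolding gromov_open_def
  proof (intro conjI ballI)
    show "S \<inter> T \<subseteq> gromov_boundary D b"
      using S by (auto simp: gromov_open_def)
    fix \<eta> assume "\<eta> \<in> S \<inter> T"
    then obtain r r' :: real
      where r: "\<And>\<theta>. \<theta> \<in> gromov_boundary D b \<Longrightarrow>
                  ereal r \<le> boundary_gromov_product D b \<eta> \<theta> \<Longrightarrow> \<theta> \<in> S"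
        and r': "\<And>\<theta>. \<theta> \<in> gromov_boundary D b \<Longrightarrow>
                  ereal r' \<le> boundary_gromov_product D b \<eta> \<theta> \<Longrightarrow> \<theta> \<in> T"
      using S T unfolding gromov_open_def by (metis IntD1 IntD2)
    have "\<theta> \<in> S \<inter> T"
      if "\<theta> \<in> gromov_boundary D b" "ereal (max r r') \<le> boundary_gromov_product D b \<eta> \<theta>" for \<theta>
    proof -
      have "ereal r \<le> ereal (max r r')" "ereal r' \<le> ereal (max r r')" by auto
      then show ?thesis
        using r[OF that(1)] r'[OF that(1)] that(2) by (blast intro: order_trans)
    qed
    then show "\<exists>r. \<forall>\<theta>\<in>gromov_boundary D b.
        ereal r \<le> boundary_gromov_product D b \<eta> \<theta> \<longrightarrow> \<theta> \<in> S \<inter> T"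
      by blast
  qed
next
  fix \<K> assume "\<forall>K\<in>\<K>. gromov_open D b K"
  then show "gromov_open D b (\<Union>\<K>)"
    unfolding gromov_open_def by (meson Sup_least UnionE UnionI)
qed

lemma openin_gromov_topology: "openin (gromov_topology D b) U \<longleftrightarrow> gromov_open D b U"
  by (simp add: gromov_topology_def topology_inverse'[OF istopology_gromov_open])

lemma topspace_gromov_topology: "topspace (gromov_topology D b) = gromov_boundary D b"
proof
  show "topspace (gromov_topology D b) \<subseteq> gromov_boundary D b"
    by (metis gromov_open_def openin_gromov_topology openin_topspace)
  have "gromov_open D b (gromov_boundary D b)"
    by (auto simp: gromov_open_def)
  then show "gromov_boundary D b \<subseteq> topspace (gromov_topology D b)"
    by (metis openin_gromov_topology openin_subset)
qed

text \<open>
  A ray represents a point at infinity of \<open>D\<close> if its points converge to it; the sequence of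
  parameters is arbitrary, so this does not depend on the parametrisation of the ray.
\<close>
definition ray_represents ::
    "('a::metric_space \<Rightarrow> 'a \<Rightarrow> real) \<Rightarrow> 'a \<Rightarrow> (real \<Rightarrow> 'a) \<Rightarrow> (nat \<Rightarrow> 'a) set \<Rightarrow> bool" where
  "ray_represents D b \<alpha> \<eta> \<longleftrightarrow>
     geodesic_ray \<alpha> \<and> \<eta> \<in> gromov_boundary D b \<and>
     (\<forall>t. (\<forall>n. 0 \<le> t n) \<and> filterlim t at_top sequentially \<longrightarrow> (\<lambda>n. \<alpha> (t n)) \<in> \<eta>)"

definition represented_boundary ::
    "('a::metric_space \<Rightarrow> 'a \<Rightarrow> real) \<Rightarrow> 'a \<Rightarrow> (real \<Rightarrow> 'a) set set" where
  "represented_boundary D b = {\<xi>\<in>visual_boundary. \<exists>\<alpha>\<in>\<xi>. \<exists>\<eta>. ray_represents D b \<alpha> \<eta>}"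

end

theory Submission
  imports Defs
begin

text \<open>
  A curtain that separates two points occupies an interval of length one on their geodesic, and disjoint
  curtains that separate two points are linearly ordered, so they form a chain. Hence the metric \<open>d_L\<close> counts pairwise
  \<open>L\<close>-separated curtains between two points.

  Let \<open>sepnum L b x y\<close> be the largest number of pairwise \<open>L\<close>-separated curtains that separate \<open>b\<close> from both \<open>x\<close> and
  \<open>y\<close>. A family that separates \<open>x\<close> from \<open>{y, z}\<close> and one that separates \<open>y\<close> from \<open>{x, z}\<close> can be glued after removing
  at most \<open>L + 2\<close> curtains (\<open>sepnum_glue\<close>), so this number is the Gromov product of \<open>d_L\<close> up to an error linear in \<open>L\<close>. Families that
  split four points in two different ways cannot both be numerous, not even for different \<open>L\<close>
  (\<open>sepnum_hyperbolic\<close>). Summing with the weights, whose second moment is finite, gives a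
  function \<open>sep\<close> that is the Gromov product of the curtain model up to a constant and is hyperbolic. Of a
  family of \<open>L\<close>-separated curtains a CAT(0) geodesic can cross only \<open>O(L)\<close> out and back (\<open>separated_from_both_ends\<close>),
  so CAT(0) geodesics are rough geodesics.

  The link with the CAT(0) metric is the bottleneck: if three \<open>L\<close>-separated curtains are crossed by two
  geodesics, these come within \<open>L + 1\<close> of each other at the middle curtain. If \<open>sep b x y\<close> exceeds
  \<open>M \<Sum> L\<^sup>2 \<lambda>\<^sub>L\<close>, then for some \<open>L\<close> there are \<open>M L\<^sup>2\<close> such curtains, so \<open>[b,x]\<close> and \<open>[b,y]\<close> are \<open>O(L)\<close>-close at distance
  about \<open>M L\<^sup>2\<close> from \<open>b\<close>, and by convexity \<open>8 R / M\<close>-close at distance \<open>R\<close> (\<open>fellow_travel\<close>). Hence geodesics to a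
  sequence that converges to a boundary point of the curtain model converge to a ray, which represents that
  point (\<open>limit_ray\<close>); this is the embedding, and the same estimate is its continuity. Its inverse is continuous
  because a ray that is well separated from \<open>b\<close> at one time stays so.

  For visibility and density the second use of the bottleneck is \<open>geodesic_passes_near\<close>: a geodesic between a ray
  to a boundary point and a point that is less separated from \<open>b\<close> in that direction passes within bounded distance
  of \<open>b\<close>. Geodesics between points of such a ray and of a ray to any other point of the
  visual boundary therefore subconverge to a line. For density,
  translates of two distinct boundary points work: from every point, the geodesics to one of the two pass near
  \<open>b\<close>. If there is only one boundary point, it is fixed by all isometries, and then every point of the visual
  boundary is represented.
\<close>

section \<open>Geodesics in CAT(0) spaces\<close>

lemma comparison_triangle:
  fixes a b c :: real
  assumes "0 \<le> a" "0 \<le> b" "0 \<le> c" "a \<le> b + c" "b \<le> a + c" "c \<le> a + b"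
  obtains y z :: "real ^ 2" where "norm y = a" "norm z = b" "dist y z = c"
    "inner y z = (a\<^sup>2 + b\<^sup>2 - c\<^sup>2) / 2"
proof -
  have two: "norm (vector [p, q] :: real ^ 2) = sqrt (p\<^sup>2 + q\<^sup>2)" for p q
    by (simp add: norm_vec_def L2_set_def sum_2)
  have ex: "\<exists>y z :: real ^ 2. norm y = a \<and> norm z = b \<and> dist y z = c"
  proof (cases "a = 0")
    case True
    then have "b = c" using assms by auto
    have "norm (0 :: real ^ 2) = a \<and> norm (vector [b, 0] :: real ^ 2) = b
        \<and> dist (0 :: real ^ 2) (vector [b, 0]) = c"
      using True \<open>b = c\<close> assms by (simp add: two dist_norm)
    then show ?thesis by blast
  next
    case False
    define u where "u = (a\<^sup>2 + b\<^sup>2 - c\<^sup>2) / (2 * a)"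
    have au: "2 * a * u = a\<^sup>2 + b\<^sup>2 - c\<^sup>2" using False by (simp add: u_def)
    have "(a - b)\<^sup>2 \<le> c\<^sup>2" using assms by (simp add: abs_le_square_iff[symmetric])
    moreover have "c\<^sup>2 \<le> (a + b)\<^sup>2" using assms by (simp add: power_mono)
    ultimately have "2 * a * u \<le> 2 * a * b" "- (2 * a * b) \<le> 2 * a * u"
      unfolding au by (simp_all add: power2_eq_square algebra_simps)
    then have "u \<le> b" "- b \<le> u" using False assms(1)
      by (simp_all add: algebra_simps) (metis mult_le_cancel_left minus_mult_right
          less_eq_real_def add.commute add_eq_0_iff linorder_not_le mult_minus_right)+
    then have ub: "u\<^sup>2 \<le> b\<^sup>2" by (simp add: abs_le_square_iff[symmetric] abs_le_iff)
    define v where "v = sqrt (b\<^sup>2 - u\<^sup>2)"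
    have v: "v\<^sup>2 = b\<^sup>2 - u\<^sup>2" using ub by (simp add: v_def)
    define Y Z :: "real ^ 2" where "Y = vector [a, 0]" and "Z = vector [u, v]"
    have "norm Y = a" using assms by (simp add: Y_def two)
    moreover have "norm Z = b" using assms v by (simp add: Z_def two)
    moreover have "dist Y Z = c"
    proof -
      have "Y - Z = vector [a - u, - v]"
        by (simp add: Y_def Z_def vec_eq_iff forall_2)
      then have "dist Y Z = sqrt ((a - u)\<^sup>2 + v\<^sup>2)" by (simp add: dist_norm two)
      also have "(a - u)\<^sup>2 + v\<^sup>2 = c\<^sup>2"
        using v au by (simp add: power2_eq_square algebra_simps)
      finally show ?thesis using assms by simp
    qed
    ultimately show ?thesis by blast
  qed
  then obtain y z :: "real ^ 2" where yz: "norm y = a" "norm z = b" "dist y z = c" by blast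
  then have "inner y z = (a\<^sup>2 + b\<^sup>2 - c\<^sup>2) / 2" by (simp add: dot_norm_neg dist_norm)
  then show ?thesis using that[OF yz] by simp
qed

text \<open>
  The comparison axiom written as the law of cosines, so that the plane no longer occurs. The two
  special cases used below are \<open>m = 1\<close> (a vertex and the opposite side) and \<open>l = m\<close> (contraction
  towards \<open>x\<close>).
\<close>
lemma two_sides_inequality:
  fixes x y z :: "'a::cat0_space"
  assumes al: "geodesic_between \<alpha> x y" and be: "geodesic_between \<beta> x z"
    and l: "0 \<le> l" "l \<le> 1" and m: "0 \<le> m" "m \<le> 1"
  shows "(dist (\<alpha> (l * dist x y)) (\<beta> (m * dist x z)))\<^sup>2
     \<le> l\<^sup>2 * (dist x y)\<^sup>2 + m\<^sup>2 * (dist x z)\<^sup>2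
        - l * m * ((dist x y)\<^sup>2 + (dist x z)\<^sup>2 - (dist y z)\<^sup>2)"
proof -
  obtain Y Z :: "real ^ 2" where Y: "norm Y = dist x y" and Z: "norm Z = dist x z"
    and YZ: "dist Y Z = dist y z"
    and in': "inner Y Z = ((dist x y)\<^sup>2 + (dist x z)\<^sup>2 - (dist y z)\<^sup>2) / 2"
    using comparison_triangle[of "dist x y" "dist x z" "dist y z"]
    by (metis dist_triangle dist_triangle2 dist_triangle3 dist_commute zero_le_dist)
  have "dist (\<alpha> (l * dist x y)) (\<beta> (m * dist x z)) \<le> dist (l *\<^sub>R Y) (m *\<^sub>R Z)"
  proof (rule cat0_comparison[OF al be, where x' = 0])
    show "l *\<^sub>R Y \<in> closed_segment 0 Y" "m *\<^sub>R Z \<in> closed_segment 0 Z"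
      using l m by (auto simp: in_segment)
  qed (use Y Z YZ l m in \<open>simp_all add: dist_commute mult_left_le_one_le\<close>)
  then have "(dist (\<alpha> (l * dist x y)) (\<beta> (m * dist x z)))\<^sup>2 \<le> (norm (l *\<^sub>R Y - m *\<^sub>R Z))\<^sup>2"
    by (simp add: dist_norm power_mono)
  also have "\<dots> = l\<^sup>2 * (norm Y)\<^sup>2 + m\<^sup>2 * (norm Z)\<^sup>2 - 2 * l * m * inner Y Z"
    unfolding power2_norm_eq_inner
    by (simp add: inner_diff_left inner_diff_right inner_commute[of Z Y]
        power2_eq_square algebra_simps)
  also have "\<dots> = l\<^sup>2 * (dist x y)\<^sup>2 + m\<^sup>2 * (dist x z)\<^sup>2
        - l * m * ((dist x y)\<^sup>2 + (dist x z)\<^sup>2 - (dist y z)\<^sup>2)"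
    unfolding Y Z in' by (simp add: field_simps)
  finally show ?thesis .
qed

lemma geodesic_between_unique:
  fixes x y :: "'a::cat0_space"
  assumes "geodesic_between \<alpha> x y" "geodesic_between \<beta> x y" "0 \<le> t" "t \<le> dist x y"
  shows "\<alpha> t = \<beta> t"
proof (cases "dist x y = 0")
  case True
  then show ?thesis using assms by (auto simp: geodesic_between_def)
next
  case False
  then have pos: "dist x y > 0" by simp
  define l where "l = t / dist x y"
  have l: "0 \<le> l" "l \<le> 1" "l * dist x y = t" using assms pos by (auto simp: l_def)
  have "(dist (\<alpha> (l * dist x y)) (\<beta> (l * dist x y)))\<^sup>2 \<le> 0"
    using two_sides_inequality[OF assms(1,2) l(1,2) l(1,2)]
    by (simp add: power2_eq_square)
  then show ?thesis by (simp add: l)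
qed

text \<open>
  A choice of parametrisation; by the uniqueness of geodesics it matters only outside
  \<open>[0, d(x,y)]\<close>.
\<close>
definition geo :: "'a::metric_space \<Rightarrow> 'a \<Rightarrow> real \<Rightarrow> 'a" where
  "geo x y = (SOME \<gamma>. geodesic_between \<gamma> x y)"

lemma geo_between: "geodesic_between (geo x y) x (y :: 'a::cat0_space)"
  unfolding geo_def by (rule someI_ex[OF geodesic_exists])

lemma geo_0 [simp]: "geo x y 0 = (x :: 'a::cat0_space)"
  and geo_end [simp]: "geo x y (dist x y) = (y :: 'a::cat0_space)"
  using geo_between[of x y] by (auto simp: geodesic_between_def)

lemma dist_geo:
  "\<lbrakk>0 \<le> s; s \<le> dist x y; 0 \<le> t; t \<le> dist x y\<rbrakk>
    \<Longrightarrow> dist (geo x y s) (geo x y t) = \<bar>s - t\<bar>" for x :: "'a::cat0_space"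
  using geo_between[of x y] by (auto simp: geodesic_between_def geodesic_on_def)

lemma dist_geo_left:
  "\<lbrakk>0 \<le> s; s \<le> dist x y\<rbrakk> \<Longrightarrow> dist x (geo x y s) = s" for x :: "'a::cat0_space"
  using dist_geo[of 0 x y s] by simp

lemma dist_geo_right:
  "\<lbrakk>0 \<le> s; s \<le> dist x y\<rbrakk> \<Longrightarrow> dist (geo x y s) y = dist x y - s" for x :: "'a::cat0_space"
  using dist_geo[of s x y "dist x y"] by simp

lemma geo_unique:
  "\<lbrakk>geodesic_between \<gamma> x y; 0 \<le> t; t \<le> dist x y\<rbrakk> \<Longrightarrow> geo x y t = \<gamma> t" for x :: "'a::cat0_space"
  using geodesic_between_unique[OF geo_between] by blast

lemma geodesic_betweenI:
  assumes "\<gamma> 0 = x" "\<gamma> (dist x y) = y"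
    "\<And>s t. \<lbrakk>0 \<le> s; s \<le> t; t \<le> dist x y\<rbrakk> \<Longrightarrow> dist (\<gamma> s) (\<gamma> t) = t - s"
  shows "geodesic_between \<gamma> x y"
  unfolding geodesic_between_def geodesic_on_def
proof (intro conjI ballI)
  fix s t assume "s \<in> {0..dist x y}" "t \<in> {0..dist x y}"
  then show "dist (\<gamma> s) (\<gamma> t) = \<bar>s - t\<bar>"
    using assms(3)[of s t] assms(3)[of t s] by (cases "s \<le> t") (auto simp: dist_commute)
qed (use assms in \<open>auto simp: is_interval_cc\<close>)

lemma geodesic_on_between:
  assumes "geodesic_on I \<alpha>" "s \<in> I" "t \<in> I" "s \<le> t"
  shows "geodesic_between (\<lambda>u. \<alpha> (s + u)) (\<alpha> s) (\<alpha> t)"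
proof -
  have iv: "\<And>u. s \<le> u \<Longrightarrow> u \<le> t \<Longrightarrow> u \<in> I"
    using assms by (metis geodesic_on_def is_interval_1)
  have d: "\<And>u v. u \<in> I \<Longrightarrow> v \<in> I \<Longrightarrow> dist (\<alpha> u) (\<alpha> v) = \<bar>u - v\<bar>"
    using assms by (auto simp: geodesic_on_def)
  have st: "dist (\<alpha> s) (\<alpha> t) = t - s" using d[OF assms(2,3)] assms(4) by simp
  show ?thesis
    by (rule geodesic_betweenI) (use st d iv in auto)
qed

lemma geo_on:
  fixes \<alpha> :: "real \<Rightarrow> 'a::cat0_space"
  assumes "geodesic_on I \<alpha>" "s \<in> I" "t \<in> I" "s \<le> t" "0 \<le> u" "u \<le> t - s"
  shows "geo (\<alpha> s) (\<alpha> t) u = \<alpha> (s + u)"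
proof -
  have "dist (\<alpha> s) (\<alpha> t) = t - s" using assms by (auto simp: geodesic_on_def)
  then show ?thesis using geo_unique[OF geodesic_on_between[OF assms(1-4)]] assms by simp
qed

lemma geodesic_on_geo: "geodesic_on {0..dist x y} (geo x (y :: 'a::cat0_space))"
  using geo_between[of x y] by (simp add: geodesic_between_def)

lemma geo_init:
  "\<lbrakk>0 \<le> t; t \<le> s; s \<le> dist x y\<rbrakk> \<Longrightarrow> geo x (geo x y s) t = geo x y t" for x :: "'a::cat0_space"
  using geo_on[OF geodesic_on_geo, of 0 x y s t] by auto

lemma geo_tail:
  "\<lbrakk>0 \<le> t; 0 \<le> s; s + t \<le> dist x y\<rbrakk> \<Longrightarrow> geo (geo x y s) y t = geo x y (s + t)"
  for x :: "'a::cat0_space"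
  using geo_on[OF geodesic_on_geo, of s x y "dist x y" t] by auto

lemma geo_reverse:
  "\<lbrakk>0 \<le> t; t \<le> dist x y\<rbrakk> \<Longrightarrow> geo y x t = geo x y (dist x y - t)" for x :: "'a::cat0_space"
  by (rule geo_unique, rule geodesic_betweenI) (auto simp: dist_geo dist_commute)

lemma continuous_on_geodesic: "geodesic_on I \<alpha> \<Longrightarrow> continuous_on I \<alpha>"
  unfolding continuous_on_iff geodesic_on_def by (metis dist_real_def)

lemma continuous_on_geo: "continuous_on {0..dist x y} (geo x (y :: 'a::cat0_space))"
  by (rule continuous_on_geodesic[OF geodesic_on_geo])

lemma connected_geo:
  "\<lbrakk>0 \<le> s; t \<le> dist x y\<rbrakk> \<Longrightarrow> connected (geo x y ` {s..t})" for x :: "'a::cat0_space"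
  by (rule connected_continuous_image[OF continuous_on_subset[OF continuous_on_geo]]) auto

text \<open>
  The comparison for a vertex and a point on the opposite side is the Bruhat--Tits inequality;
  uniqueness of projections and their Lipschitz property follow from it alone.
\<close>
lemma bruhat_tits:
  fixes x y z :: "'a::cat0_space"
  assumes "0 \<le> l" "l \<le> 1"
  shows "(dist z (geo x y (l * dist x y)))\<^sup>2
     \<le> (1 - l) * (dist z x)\<^sup>2 + l * (dist z y)\<^sup>2 - l * (1 - l) * (dist x y)\<^sup>2"
  using two_sides_inequality[OF geo_between geo_between assms, of 1 x y z]
  by (simp add: dist_commute power2_eq_square algebra_simps)

lemma geo_fan_ratio:
  fixes x y z :: "'a::cat0_space"
  assumes "0 \<le> l" "l \<le> 1"
  shows "dist (geo x y (l * dist x y)) (geo x z (l * dist x z)) \<le> l * dist y z"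
proof -
  have "(dist (geo x y (l * dist x y)) (geo x z (l * dist x z)))\<^sup>2 \<le> (l * dist y z)\<^sup>2"
    using two_sides_inequality[OF geo_between geo_between assms assms, of x y z]
    by (simp add: power2_eq_square algebra_simps)
  then show ?thesis using assms by (simp add: abs_le_square_iff[symmetric])
qed

lemma geo_fan:
  fixes x y z :: "'a::cat0_space"
  assumes "0 \<le> R" "R \<le> t" "0 < t" "t \<le> dist x y" "t \<le> dist x z"
  shows "dist (geo x y R) (geo x z R) \<le> R / t * dist (geo x y t) (geo x z t)"
proof -
  have "dist x (geo x y t) = t" "dist x (geo x z t) = t" using assms by (auto simp: dist_geo_left)
  then show ?thesis
    using geo_fan_ratio[of "R / t" x "geo x y t" "geo x z t"] assms by (simp add: geo_init)
qed

text \<open>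
  Two geodesics from \<open>x\<close> that come within \<open>E\<close> of each other far from \<open>x\<close> are close to each
  other near \<open>x\<close>. The convergence of geodesics from a common origin rests on this.
\<close>
lemma geo_fan_close:
  fixes x y z :: "'a::cat0_space"
  assumes s: "s \<le> dist x y" and s': "0 \<le> s'" "s' \<le> dist x z"
    and E: "dist (geo x y s) (geo x z s') \<le> E" and l: "0 < l" "l + E \<le> s" and R: "0 \<le> R" "R \<le> l"
  shows "dist (geo x y R) (geo x z R) \<le> 2 * E * R / l"
proof -
  have E0: "0 \<le> E" using E zero_le_dist[of "geo x y s" "geo x z s'"] by linarith
  have ss: "dist x (geo x y s) = s" "dist x (geo x z s') = s'" using assms E0 by (auto simp: dist_geo_left)
  have abs: "\<bar>s - s'\<bar> \<le> E"
    using E dist_triangle[of x "geo x y s" "geo x z s'"] dist_triangle[of x "geo x z s'" "geo x y s"]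
    unfolding ss by (simp add: dist_commute)
  define t where "t = min s s'"
  have t: "l \<le> t" "t \<le> s" "t \<le> s'" using abs l E0 by (auto simp: t_def)
  have "dist (geo x y t) (geo x z t) \<le> dist (geo x y t) (geo x y s) + dist (geo x y s) (geo x z s')
      + dist (geo x z s') (geo x z t)"
    by (meson dist_triangle order_trans add_mono order_refl)
  also have "\<dots> \<le> (s - t) + E + (s' - t)"
    using t l s s' E E0 by (simp add: dist_geo)
  also have "\<dots> \<le> 2 * E" using abs by (auto simp: t_def min_def split: if_splits)
  finally have *: "dist (geo x y t) (geo x z t) \<le> 2 * E" .
  have "dist (geo x y R) (geo x z R) \<le> R / t * dist (geo x y t) (geo x z t)"
    by (rule geo_fan) (use t l s s' R in auto)
  also have "\<dots> \<le> R / l * (2 * E)"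
    by (intro mult_mono divide_left_mono *) (use t l R E0 in auto)
  finally show ?thesis by (simp add: field_simps)
qed

section \<open>Projection to a geodesic\<close>

text \<open>
  Projection to a geodesic is described by the parameter of the nearest point, a real-valued
  function on the space.
\<close>
definition coord :: "real set \<Rightarrow> (real \<Rightarrow> 'a::metric_space) \<Rightarrow> 'a \<Rightarrow> real" where
  "coord I \<alpha> x = (SOME t. t \<in> I \<and> (\<forall>s\<in>I. dist x (\<alpha> t) \<le> dist x (\<alpha> s)))"

text \<open>
  The minimum is attained on a compact set of parameters: beyond distance \<open>2D\<close> from a parameter whose point
  has distance \<open>D\<close> to \<open>x\<close>, the points of the geodesic are farther away than \<open>D\<close>.
\<close>
lemma coord_exists:
  assumes g: "geodesic_on I \<alpha>" and I: "closed I" "I \<noteq> {}"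
  shows "\<exists>t. t \<in> I \<and> (\<forall>s\<in>I. dist x (\<alpha> t) \<le> dist x (\<alpha> s))"
proof -
  obtain t0 where t0: "t0 \<in> I" using I by blast
  define D where "D = dist x (\<alpha> t0)"
  let ?K = "I \<inter> {t0 - 2 * D..t0 + 2 * D}"
  have "compact ?K" using I by (metis compact_Icc closed_Int_compact)
  moreover have "?K \<noteq> {}" using t0 by (auto simp: D_def)
  moreover have "continuous_on ?K (\<lambda>t. dist x (\<alpha> t))"
    by (intro continuous_intros continuous_on_subset[OF continuous_on_geodesic[OF g]]) auto
  ultimately have "\<exists>t\<in>?K. \<forall>s\<in>?K. dist x (\<alpha> t) \<le> dist x (\<alpha> s)"
    by (rule continuous_attains_inf)
  then obtain t where t: "t \<in> ?K" "\<And>s. s \<in> ?K \<Longrightarrow> dist x (\<alpha> t) \<le> dist x (\<alpha> s)"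
    by blast
  have "dist x (\<alpha> t) \<le> dist x (\<alpha> s)" if s: "s \<in> I" for s
  proof (cases "s \<in> ?K")
    case False
    then have "2 * D < \<bar>t0 - s\<bar>" using s by auto
    also have "\<dots> = dist (\<alpha> t0) (\<alpha> s)" using g t0 s by (auto simp: geodesic_on_def)
    also have "\<dots> \<le> D + dist x (\<alpha> s)" unfolding D_def by (metis dist_commute dist_triangle)
    finally have "D \<le> dist x (\<alpha> s)" by simp
    moreover have "t0 \<in> ?K" using t0 by (auto simp: D_def)
    ultimately show ?thesis using t(2)[of t0] by (simp add: D_def)
  qed (use t in auto)
  then show ?thesis using t by blast
qed

lemma coord:
  assumes "geodesic_on I \<alpha>" "closed I" "I \<noteq> {}"
  shows coord_in: "coord I \<alpha> x \<in> I"
    and coord_le: "s \<in> I \<Longrightarrow> dist x (\<alpha> (coord I \<alpha> x)) \<le> dist x (\<alpha> s)"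
  using someI_ex[OF coord_exists[OF assms]] unfolding coord_def by blast+

text \<open>
  A minimiser of the distance to \<open>x\<close> makes an angle of at least a right angle: compare with points
  of \<open>[\<alpha> t, \<alpha> s]\<close> that tend to \<open>\<alpha> t\<close>.
\<close>
lemma pythagoras_at_minimiser:
  fixes \<alpha> :: "real \<Rightarrow> 'a::cat0_space"
  assumes g: "geodesic_on I \<alpha>" and t: "t \<in> I" and s: "s \<in> I"
    and min: "\<And>s. s \<in> I \<Longrightarrow> dist x (\<alpha> t) \<le> dist x (\<alpha> s)"
  shows "(dist x (\<alpha> t))\<^sup>2 + (t - s)\<^sup>2 \<le> (dist x (\<alpha> s))\<^sup>2"
proof -
  have dts: "dist (\<alpha> t) (\<alpha> s) = \<bar>t - s\<bar>" using g t s by (auto simp: geodesic_on_def)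
  have min': "dist x (\<alpha> t) \<le> dist x (geo (\<alpha> t) (\<alpha> s) u)" if "0 \<le> u" "u \<le> \<bar>t - s\<bar>" for u
  proof (cases "t \<le> s")
    case True
    then have "geo (\<alpha> t) (\<alpha> s) u = \<alpha> (t + u)"
      using geo_on[OF g t s True] that by simp
    moreover have "t + u \<in> I"
      using g t s that True mem_is_interval_1_I[of I t s "t + u"] by (auto simp: geodesic_on_def)
    ultimately have "dist x (\<alpha> t) \<le> dist x (geo (\<alpha> t) (\<alpha> s) u)" using min by simp
    then show ?thesis using min by simp
  next
    case False
    have "geo (\<alpha> t) (\<alpha> s) u = geo (\<alpha> s) (\<alpha> t) (\<bar>t - s\<bar> - u)"
      using geo_reverse[of u "\<alpha> t" "\<alpha> s"] geo_reverse[of u "\<alpha> s" "\<alpha> t"] that dts by (simp add: dist_commute)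
    also have "\<dots> = \<alpha> (t - u)" using geo_on[OF g s t, of "\<bar>t - s\<bar> - u"] False that by simp
    finally have "geo (\<alpha> t) (\<alpha> s) u = \<alpha> (t - u)" .
    moreover have "t - u \<in> I" using g t s that False mem_is_interval_1_I[of I s t "t - u"]
      by (auto simp: geodesic_on_def)
    ultimately show ?thesis using min by simp
  qed
  have key: "(dist x (\<alpha> t))\<^sup>2 + (1 - l) * (t - s)\<^sup>2 \<le> (dist x (\<alpha> s))\<^sup>2" if l: "0 < l" "l \<le> 1" for l
  proof -
    have "(dist x (\<alpha> t))\<^sup>2 \<le> (dist x (geo (\<alpha> t) (\<alpha> s) (l * dist (\<alpha> t) (\<alpha> s))))\<^sup>2"
      by (intro power_mono min') (use l in \<open>auto simp: dts mult_left_le_one_le\<close>)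
    also have "\<dots> \<le> (1 - l) * (dist x (\<alpha> t))\<^sup>2 + l * (dist x (\<alpha> s))\<^sup>2 - l * (1 - l) * (t - s)\<^sup>2"
      using bruhat_tits[of l x "\<alpha> t" "\<alpha> s"] l by (simp add: dts)
    finally have "l * ((dist x (\<alpha> t))\<^sup>2 + (1 - l) * (t - s)\<^sup>2) \<le> l * (dist x (\<alpha> s))\<^sup>2"
      by (simp add: algebra_simps)
    then show ?thesis using l by (simp add: mult_le_cancel_left_pos)
  qed
  have "((\<lambda>l. (dist x (\<alpha> t))\<^sup>2 + (1 - l) * (t - s)\<^sup>2) \<longlongrightarrow> (dist x (\<alpha> t))\<^sup>2 + (1 - 0) * (t - s)\<^sup>2)
      (at_right (0::real))"
    by (intro tendsto_intros)
  moreover have "\<forall>\<^sub>F l in at_right (0::real). (dist x (\<alpha> t))\<^sup>2 + (1 - l) * (t - s)\<^sup>2 \<le> (dist x (\<alpha> s))\<^sup>2"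
    by (rule eventually_at_rightI[of 0 1]) (use key in auto)
  ultimately show ?thesis
    using tendsto_upperbound[of _ _ "at_right (0::real)"] by simp
qed

locale closed_geodesic =
  fixes I :: "real set" and \<alpha> :: "real \<Rightarrow> 'a::cat0_space"
  assumes geodesic: "geodesic_on I \<alpha>" and closed: "closed I" and nonempty: "I \<noteq> {}"
begin

lemmas coord_mem = coord_in[OF geodesic closed nonempty]
lemmas coord_min = coord_le[OF geodesic closed nonempty]

lemma dist_param: "s \<in> I \<Longrightarrow> t \<in> I \<Longrightarrow> dist (\<alpha> s) (\<alpha> t) = \<bar>s - t\<bar>"
  using geodesic by (auto simp: geodesic_on_def)

lemma pythagoras: "s \<in> I \<Longrightarrow> (dist x (\<alpha> (coord I \<alpha> x)))\<^sup>2 + (coord I \<alpha> x - s)\<^sup>2 \<le> (dist x (\<alpha> s))\<^sup>2"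
  by (rule pythagoras_at_minimiser[OF geodesic coord_mem _ coord_min])

lemma coord_unique:
  assumes "t \<in> I" "\<And>s. s \<in> I \<Longrightarrow> dist x (\<alpha> t) \<le> dist x (\<alpha> s)"
  shows "coord I \<alpha> x = t"
proof -
  have "(dist x (\<alpha> t))\<^sup>2 \<le> (dist x (\<alpha> (coord I \<alpha> x)))\<^sup>2"
    by (intro power_mono assms coord_mem) auto
  then have "(coord I \<alpha> x - t)\<^sup>2 \<le> 0" using pythagoras[OF assms(1), of x] by linarith
  then show ?thesis by simp
qed

lemma coord_self [simp]: "t \<in> I \<Longrightarrow> coord I \<alpha> (\<alpha> t) = t"
  by (rule coord_unique) auto

lemma closest_proj_eq: "closest_proj (\<alpha> ` I) x = \<alpha> (coord I \<alpha> x)"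
  unfolding closest_proj_def
proof (rule the_equality)
  fix p assume "p \<in> \<alpha> ` I \<and> (\<forall>q\<in>\<alpha> ` I. dist x p \<le> dist x q)"
  then show "p = \<alpha> (coord I \<alpha> x)" using coord_unique by fastforce
qed (use coord_mem coord_min in auto)

lemma proj_vimage: "J \<subseteq> I \<Longrightarrow> closest_proj (\<alpha> ` I) -` (\<alpha> ` J) = coord I \<alpha> -` J"
proof -
  assume J: "J \<subseteq> I"
  have "\<alpha> (coord I \<alpha> x) = \<alpha> t \<longleftrightarrow> coord I \<alpha> x = t" if "t \<in> J" for x t
    using that J dist_param[OF coord_mem, of t x] by auto
  then show ?thesis by (auto simp: closest_proj_eq)
qed

text \<open>
  The inequality \<open>d(x,v)\<^sup>2 + d(y,u)\<^sup>2 \<le> d(x,u)\<^sup>2 + d(y,v)\<^sup>2 + d(x,y)\<^sup>2 + d(u,v)\<^sup>2\<close> holds for any four points;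
  against it stand the two right angles at the projections \<open>u\<close> of \<open>x\<close> and \<open>v\<close> of \<open>y\<close>.
\<close>
lemma coord_lipschitz: "\<bar>coord I \<alpha> x - coord I \<alpha> y\<bar> \<le> dist x y"
proof -
  define u v where "u = \<alpha> (coord I \<alpha> x)" and "v = \<alpha> (coord I \<alpha> y)"
  define m where "m = geo x v (1/2 * dist x v)"
  have uv: "dist u v = \<bar>coord I \<alpha> x - coord I \<alpha> y\<bar>" by (simp add: u_def v_def dist_param coord_mem)
  have "(dist u m)\<^sup>2 \<le> (dist u x)\<^sup>2 / 2 + (dist u v)\<^sup>2 / 2 - (dist x v)\<^sup>2 / 4"
    using bruhat_tits[of "1/2" u x v] by (simp add: m_def)
  moreover have "(dist y m)\<^sup>2 \<le> (dist y x)\<^sup>2 / 2 + (dist y v)\<^sup>2 / 2 - (dist x v)\<^sup>2 / 4"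
    using bruhat_tits[of "1/2" y x v] by (simp add: m_def)
  moreover have "(dist y u)\<^sup>2 \<le> 2 * (dist u m)\<^sup>2 + 2 * (dist y m)\<^sup>2"
  proof -
    have "(dist y u)\<^sup>2 \<le> (dist u m + dist y m)\<^sup>2"
      by (intro power_mono) (metis add.commute dist_commute dist_triangle, simp)
    also have "\<dots> \<le> 2 * (dist u m)\<^sup>2 + 2 * (dist y m)\<^sup>2"
      using zero_le_power2[of "dist u m - dist y m"] by (simp add: power2_eq_square algebra_simps)
    finally show ?thesis .
  qed
  moreover have "(dist x u)\<^sup>2 + (dist u v)\<^sup>2 \<le> (dist x v)\<^sup>2"
    using pythagoras[OF coord_mem, of x y] by (simp add: u_def v_def dist_param coord_mem)
  moreover have "(dist y v)\<^sup>2 + (dist u v)\<^sup>2 \<le> (dist y u)\<^sup>2"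
    using pythagoras[OF coord_mem, of y x] by (simp add: u_def v_def dist_param coord_mem power2_commute)
  ultimately have "(dist u v)\<^sup>2 \<le> (dist x y)\<^sup>2"
    unfolding dist_commute[of u x] dist_commute[of y x] by linarith
  then show ?thesis using uv by (simp add: abs_le_square_iff[symmetric])
qed

lemma coord_on_perpendicular:
  assumes "0 \<le> s" "s \<le> dist x (\<alpha> (coord I \<alpha> x))"
  shows "coord I \<alpha> (geo x (\<alpha> (coord I \<alpha> x)) s) = coord I \<alpha> x"
proof (rule coord_unique[OF coord_mem])
  fix t assume t: "t \<in> I"
  let ?u = "\<alpha> (coord I \<alpha> x)" and ?z = "geo x (\<alpha> (coord I \<alpha> x)) s"
  have "dist ?z ?u = dist x ?u - s" by (rule dist_geo_right[OF assms])
  also have "\<dots> \<le> dist x (\<alpha> t) - s" using coord_min[OF t] by simp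
  also have "\<dots> \<le> dist ?z (\<alpha> t)" using dist_triangle[of x "\<alpha> t" ?z] dist_geo_left[OF assms] by simp
  finally show "dist ?z ?u \<le> dist ?z (\<alpha> t)" .
qed

text \<open>Preimages of intervals are star-shaped towards the geodesic.\<close>
lemma connected_coord_vimage:
  assumes J: "is_interval J"
  shows "connected (coord I \<alpha> -` J)"
proof -
  let ?S = "coord I \<alpha> -` J" and ?c = "coord I \<alpha>"
  define seg where "seg x = geo x (\<alpha> (?c x)) ` {0..dist x (\<alpha> (?c x))}" for x
  have core: "connected (\<alpha> ` (J \<inter> I))"
  proof (rule connected_continuous_image)
    show "continuous_on (J \<inter> I) \<alpha>"
      by (rule continuous_on_subset[OF continuous_on_geodesic[OF geodesic]]) auto
    show "connected (J \<inter> I)"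
      using J geodesic by (simp add: is_interval_connected_1[symmetric] is_interval_Int geodesic_on_def)
  qed
  have sub: "\<alpha> ` (J \<inter> I) \<subseteq> ?S" by auto
  have seg: "connected (seg x)" "seg x \<subseteq> ?S" "x \<in> seg x" "\<alpha> (?c x) \<in> seg x" if "x \<in> ?S" for x
  proof -
    show "connected (seg x)" unfolding seg_def by (rule connected_geo) auto
    show "seg x \<subseteq> ?S" using that coord_on_perpendicular by (auto simp: seg_def)
    show "x \<in> seg x" by (force simp: seg_def image_iff intro!: bexI[of _ 0])
    show "\<alpha> (?c x) \<in> seg x" by (force simp: seg_def image_iff intro!: bexI[of _ "dist x (\<alpha> (?c x))"])
  qed
  have con: "connected (seg x \<union> \<alpha> ` (J \<inter> I))" if x: "x \<in> ?S" for x
    by (rule connected_Un[OF seg(1)[OF x] core]) (use seg[OF x] x coord_mem in auto)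
  have "?S = (\<Union>x\<in>?S. seg x \<union> \<alpha> ` (J \<inter> I))"
  proof
    show "?S \<subseteq> (\<Union>x\<in>?S. seg x \<union> \<alpha> ` (J \<inter> I))" using seg(3) by (intro subsetI UN_I) auto
    show "(\<Union>x\<in>?S. seg x \<union> \<alpha> ` (J \<inter> I)) \<subseteq> ?S" by (intro UN_least Un_least seg(2) sub)
  qed
  moreover have "connected (\<Union>x\<in>?S. seg x \<union> \<alpha> ` (J \<inter> I))"
  proof (cases "?S = {}")
    case False
    then obtain x where "x \<in> ?S" by blast
    then have "\<alpha> (?c x) \<in> \<alpha> ` (J \<inter> I)" using coord_mem by auto
    then show ?thesis by (intro connected_Union) (use con in auto)
  qed auto
  ultimately show ?thesis by simp
qed

end

section \<open>Curtains and the points that they separate\<close>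

text \<open>
  The properties of a curtain on which its separation properties rest: it is the preimage of an interval of
  length one under a \<open>1\<close>-Lipschitz function all of whose preimages of intervals are connected. The point at
  height \<open>r\<close> makes the curtain nonempty.
\<close>
definition slab :: "('a::metric_space \<Rightarrow> real) \<Rightarrow> real \<Rightarrow> 'a set \<Rightarrow> bool" where
  "slab f r h \<longleftrightarrow> (\<forall>x y. \<bar>f x - f y\<bar> \<le> dist x y) \<and> (\<forall>J. is_interval J \<longrightarrow> connected (f -` J)) \<and>
     h = f -` {r - 1/2..r + 1/2} \<and> (\<exists>x. f x = r)"

lemma curtain_data_closed_geodesic:
  "curtain_data I \<alpha> r \<Longrightarrow> closed_geodesic I (\<alpha> :: real \<Rightarrow> 'a::cat0_space)"
  using interior_subset[of I] unfolding curtain_data_def closed_geodesic_def by force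

lemma curtain_data_vimage:
  fixes \<alpha> :: "real \<Rightarrow> 'a::cat0_space"
  assumes "curtain_data I \<alpha> r"
  shows "dual_curtain I \<alpha> r = coord I \<alpha> -` {r - 1/2..r + 1/2}"
    and "neg_halfspace I \<alpha> r = {x. coord I \<alpha> x < r - 1/2}"
    and "pos_halfspace I \<alpha> r = {x. r + 1/2 < coord I \<alpha> x}"
    and "slab (coord I \<alpha>) r (dual_curtain I \<alpha> r)"
proof -
  interpret closed_geodesic I \<alpha> by (rule curtain_data_closed_geodesic[OF assms])
  have sub: "{r - 1/2..r + 1/2} \<subseteq> I"
    using assms interior_subset[of I] by (auto simp: curtain_data_def)
  show d: "dual_curtain I \<alpha> r = coord I \<alpha> -` {r - 1/2..r + 1/2}"
    unfolding dual_curtain_def by (rule proj_vimage[OF sub])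
  show "neg_halfspace I \<alpha> r = {x. coord I \<alpha> x < r - 1/2}"
    unfolding neg_halfspace_def by (subst proj_vimage) (use coord_mem in auto)
  show "pos_halfspace I \<alpha> r = {x. r + 1/2 < coord I \<alpha> x}"
    unfolding pos_halfspace_def by (subst proj_vimage) (use coord_mem in auto)
  have "r \<in> I" using sub by auto
  then show "slab (coord I \<alpha>) r (dual_curtain I \<alpha> r)"
    unfolding slab_def d using coord_lipschitz connected_coord_vimage coord_self by blast
qed

lemma slab_continuous:
  assumes "slab f r h"
  shows "continuous_on S f"
proof -
  have "1-lipschitz_on S f" using assms by (auto simp: slab_def lipschitz_on_def dist_real_def)
  then show ?thesis by (rule lipschitz_on_continuous_on)
qed

definition cut :: "'a::metric_space set \<Rightarrow> 'a \<Rightarrow> 'a \<Rightarrow> bool" where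
  "cut h x y \<longleftrightarrow> separates h {x} {y}"

lemma cut_commute: "cut h x y \<longleftrightarrow> cut h y x"
  unfolding cut_def separates_def by auto

lemma cut_is_curtain: "cut h x y \<Longrightarrow> is_curtain h"
  unfolding cut_def separates_def is_curtain_def by blast

text \<open>
  The two sides of a slab are the components of its complement. So they do not depend on its
  description as a slab, and any such description decides which points it separates.
\<close>
lemma slab_component:
  assumes sl: "slab f r h"
  shows "x \<notin> h \<and> y \<notin> h \<and> \<not> connected_component (- h) x y \<longleftrightarrow>
    f x < r - 1/2 \<and> r + 1/2 < f y \<or> f y < r - 1/2 \<and> r + 1/2 < f x"
proof -
  have v: "h = f -` {r - 1/2..r + 1/2}" using sl by (simp add: slab_def)
  have comp: "connected_component (- h) x y" if "x \<in> f -` S" "y \<in> f -` S"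
    and S: "S = {..<r - 1/2} \<or> S = {r + 1/2<..}" for S
  proof -
    have "is_interval S" using S by (auto simp: is_interval_1)
    then have "connected (f -` S)" using sl unfolding slab_def by blast
    moreover have "f -` S \<subseteq> - h" using S v by auto
    ultimately show ?thesis using that unfolding connected_component_def by blast
  qed
  have ncomp: False
    if opp: "f x < r - 1/2 \<and> r + 1/2 < f y \<or> f y < r - 1/2 \<and> r + 1/2 < f x"
      and cc: "connected_component (- h) x y"
  proof -
    obtain S where S: "connected S" "S \<subseteq> - h" "x \<in> S" "y \<in> S"
      using cc unfolding connected_component_def by blast
    have "connected (f ` S)" by (rule connected_continuous_image[OF slab_continuous[OF sl] S(1)])
    moreover have "f x \<in> f ` S" "f y \<in> f ` S" using S by auto
    moreover have "f x \<le> r \<and> r \<le> f y \<or> f y \<le> r \<and> r \<le> f x" using opp by auto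
    ultimately have "r \<in> f ` S" by (auto simp: connected_iff_interval)
    then show False using S(2) v by auto
  qed
  show ?thesis
  proof
    assume *: "x \<notin> h \<and> y \<notin> h \<and> \<not> connected_component (- h) x y"
    show "f x < r - 1/2 \<and> r + 1/2 < f y \<or> f y < r - 1/2 \<and> r + 1/2 < f x"
      using * comp[of "{..<r - 1/2}"] comp[of "{r + 1/2<..}"] v by auto
  next
    assume "f x < r - 1/2 \<and> r + 1/2 < f y \<or> f y < r - 1/2 \<and> r + 1/2 < f x"
    then show "x \<notin> h \<and> y \<notin> h \<and> \<not> connected_component (- h) x y"
      using ncomp v by auto
  qed
qed

lemma curtain_data_cut:
  fixes \<alpha> :: "real \<Rightarrow> 'a::cat0_space"
  assumes "curtain_data I \<alpha> r"
    and "coord I \<alpha> x < r - 1/2 \<and> r + 1/2 < coord I \<alpha> y \<or> coord I \<alpha> y < r - 1/2 \<and> r + 1/2 < coord I \<alpha> x"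
  shows "cut (dual_curtain I \<alpha> r) x y"
  unfolding cut_def separates_def
  by (intro exI[of _ I] exI[of _ \<alpha>] exI[of _ r]) (use assms in \<open>auto simp: curtain_data_vimage\<close>)

lemma cut_iff_component:
  fixes h :: "'a::cat0_space set"
  assumes "is_curtain h"
  shows "cut h x y \<longleftrightarrow> x \<notin> h \<and> y \<notin> h \<and> \<not> connected_component (- h) x y"
proof
  assume "cut h x y"
  then obtain I \<alpha> r where d: "curtain_data I \<alpha> r" "h = dual_curtain I \<alpha> r"
    and xy: "x \<in> neg_halfspace I \<alpha> r \<and> y \<in> pos_halfspace I \<alpha> r \<or>
          y \<in> neg_halfspace I \<alpha> r \<and> x \<in> pos_halfspace I \<alpha> r"
    unfolding cut_def separates_def by auto
  then show "x \<notin> h \<and> y \<notin> h \<and> \<not> connected_component (- h) x y"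
    unfolding d(2) slab_component[OF curtain_data_vimage(4)[OF d(1)]]
    by (auto simp: curtain_data_vimage[OF d(1)])
next
  assume *: "x \<notin> h \<and> y \<notin> h \<and> \<not> connected_component (- h) x y"
  obtain I \<alpha> r where d: "curtain_data I \<alpha> r" "h = dual_curtain I \<alpha> r"
    using assms unfolding is_curtain_def by blast
  show "cut h x y"
    using * curtain_data_cut[OF d(1)] unfolding d(2) slab_component[OF curtain_data_vimage(4)[OF d(1)]]
    by blast
qed

text \<open>
  A description of \<open>h\<close> as a slab, bundled with the fact that it decides separation by \<open>h\<close>.
\<close>
definition height :: "('a::metric_space \<Rightarrow> real) \<Rightarrow> real \<Rightarrow> 'a set \<Rightarrow> bool" where
  "height f r h \<longleftrightarrow> slab f r h \<and>
     (\<forall>x y. cut h x y \<longleftrightarrow> f x < r - 1/2 \<and> r + 1/2 < f y \<or> f y < r - 1/2 \<and> r + 1/2 < f x)"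

lemma heightD:
  assumes "height f r h"
  shows "\<bar>f x - f y\<bar> \<le> dist x y" and "is_interval J \<Longrightarrow> connected (f -` J)"
    and "z \<in> h \<longleftrightarrow> r - 1/2 \<le> f z \<and> f z \<le> r + 1/2" and "\<exists>x. f x = r"
    and "cut h x y \<longleftrightarrow> f x < r - 1/2 \<and> r + 1/2 < f y \<or> f y < r - 1/2 \<and> r + 1/2 < f x"
  using assms unfolding height_def slab_def by (blast, blast, auto)

lemma curtain_height:
  fixes h :: "'a::cat0_space set"
  assumes "is_curtain h"
  shows "\<exists>f r. height f r h"
proof -
  obtain I \<alpha> r where d: "curtain_data I \<alpha> r" "h = dual_curtain I \<alpha> r"
    using assms unfolding is_curtain_def by blast
  have sl: "slab (coord I \<alpha>) r h" using curtain_data_vimage(4)[OF d(1)] d(2) by simp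
  have "height (coord I \<alpha>) r h"
    unfolding height_def cut_iff_component[OF assms] slab_component[OF sl] using sl by simp
  then show ?thesis by blast
qed

lemma cut_notin: "cut h x y \<Longrightarrow> x \<notin> h \<and> y \<notin> h" for x :: "'a::cat0_space"
  using cut_iff_component[OF cut_is_curtain[of h x y], of x y] by blast

lemma not_cut_refl: "\<not> cut h x x" for x :: "'a::cat0_space"
  using cut_iff_component[OF cut_is_curtain[of h x x], of x x] by auto

text \<open>
  A curtain has exactly two sides.
\<close>
lemma cut_third: "\<lbrakk>cut h x y; z \<notin> h\<rbrakk> \<Longrightarrow> cut h x z \<longleftrightarrow> \<not> cut h z y" for x :: "'a::cat0_space"
proof -
  assume xy: "cut h x y" and z: "z \<notin> h"
  obtain f r where hf: "height f r h" using curtain_height[OF cut_is_curtain[OF xy]] by blast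
  note c = heightD(5)[OF hf]
  have "f z < r - 1/2 \<or> r + 1/2 < f z" using heightD(3)[OF hf, of z] z by auto
  then show ?thesis using xy unfolding c by linarith
qed

lemma curtain_connected: "is_curtain h \<Longrightarrow> connected h" for h :: "'a::cat0_space set"
proof -
  assume "is_curtain h"
  then obtain f r where hf: "height f r h" using curtain_height by blast
  have "h = f -` {r - 1/2..r + 1/2}" by (auto simp: heightD(3)[OF hf])
  then show ?thesis using heightD(2)[OF hf is_interval_cc] by simp
qed

lemma curtain_nonempty: "is_curtain h \<Longrightarrow> h \<noteq> {}" for h :: "'a::cat0_space set"
proof -
  assume "is_curtain h"
  then obtain f r where hf: "height f r h" using curtain_height by blast
  then obtain x where "f x = r" using heightD(4) by blast
  then have "x \<in> h" using heightD(3)[OF hf, of x] by auto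
  then show ?thesis by blast
qed

lemma connected_meets_curtain:
  "\<lbrakk>connected S; x \<in> S; y \<in> S; cut h x y\<rbrakk> \<Longrightarrow> S \<inter> h \<noteq> {}" for x :: "'a::cat0_space"
  using cut_iff_component[OF cut_is_curtain[of h x y], of x y] unfolding connected_component_def by blast

definition side :: "'a::metric_space set \<Rightarrow> 'a \<Rightarrow> 'a set" where
  "side h x = {z. z \<notin> h \<and> \<not> cut h x z}"

lemma connected_side:
  fixes h :: "'a::cat0_space set"
  assumes h: "is_curtain h" and x: "x \<notin> h"
  shows "connected (side h x)" and "connected (h \<union> side h x)"
proof -
  obtain f r where hf: "height f r h" using curtain_height[OF h] by blast
  note c = heightD(5)[OF hf] and v = heightD(3)[OF hf] and con = heightD(2)[OF hf]
  have "connected (side h x) \<and> connected (h \<union> side h x)"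
  proof (cases "f x < r - 1/2")
    case True
    have "side h x = f -` {..<r - 1/2}" "h \<union> side h x = f -` {..r + 1/2}"
      using True by (auto simp: side_def c v)
    then show ?thesis using con by (simp add: is_interval_1)
  next
    case False
    then have gt: "r + 1/2 < f x" using x v by auto
    have "side h x = f -` {r + 1/2<..}" "h \<union> side h x = f -` {r - 1/2..}"
      using gt by (auto simp: side_def c v)
    then show ?thesis using con by (simp add: is_interval_1)
  qed
  then show "connected (side h x)" "connected (h \<union> side h x)" by auto
qed

lemma cut_connected_cong:
  fixes h k :: "'a::cat0_space set"
  assumes "connected k" "k \<inter> h = {}" "v \<in> k" "v' \<in> k" "cut h z v"
  shows "cut h z v'"
  using assms cut_third[of h z v v'] connected_meets_curtain[of k v' v h] by blast

subsection \<open>The order of disjoint curtains between two points\<close>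

text \<open>On disjoint curtains that separate \<open>x\<close> from a further point this is a linear order.\<close>
definition before :: "'a::metric_space \<Rightarrow> 'a set \<Rightarrow> 'a set \<Rightarrow> bool" where
  "before x h k \<longleftrightarrow> (\<forall>v\<in>k. cut h x v)"

text \<open>
  The side of \<open>h\<close> that contains \<open>x\<close>, together with \<open>h\<close>, is connected and misses \<open>k\<close>, so \<open>k\<close> does not separate
  \<open>x\<close> from \<open>h\<close>.
\<close>
lemma before_swap:
  fixes h k :: "'a::cat0_space set"
  assumes hk: "h \<inter> k = {}" and h: "cut h x y" and k: "cut k x y" and b: "before x h k"
  shows "before y k h"
  unfolding before_def
proof
  fix u assume u: "u \<in> h"
  have "connected (h \<union> side h x)"
    using connected_side cut_is_curtain[OF h] cut_notin[OF h] by blast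
  moreover have "(h \<union> side h x) \<inter> k = {}" using hk b by (auto simp: before_def side_def)
  moreover have "x \<in> side h x" using cut_notin[OF h] not_cut_refl by (auto simp: side_def)
  ultimately have "\<not> cut k x u" using connected_meets_curtain u by (metis UnI1 UnI2)
  moreover have "u \<notin> k" using u hk by auto
  ultimately show "cut k y u" using cut_third[OF k] cut_commute by blast
qed

lemma before_total:
  fixes h k :: "'a::cat0_space set"
  assumes hk: "h \<inter> k = {}" and h: "cut h x y" and k: "cut k x y"
  shows "before x h k \<or> before x k h"
proof -
  obtain v where v: "v \<in> k" using curtain_nonempty cut_is_curtain[OF k] by blast
  have con: "connected k" using curtain_connected cut_is_curtain[OF k] by blast
  have "v \<notin> h" using v hk by auto
  then consider "cut h x v" | "cut h y v" using cut_third[OF h] cut_commute by blast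
  then show ?thesis
  proof cases
    case 1
    then show ?thesis using cut_connected_cong[OF con _ v] hk unfolding before_def by blast
  next
    case 2
    then have "before y h k" using cut_connected_cong[OF con _ v] hk unfolding before_def by blast
    then show ?thesis using before_swap[OF hk, of y x] h k cut_commute by blast
  qed
qed

text \<open>
  The curtain \<open>k\<close> and its side that contains \<open>y\<close> form a connected set that misses \<open>h\<close> and contains \<open>l\<close>.
\<close>
lemma before_trans:
  fixes h k l :: "'a::cat0_space set"
  assumes hk: "h \<inter> k = {}" and h: "cut h x y" and k: "cut k x y"
    and xhk: "before x h k" and xkl: "before x k l"
  shows "before x h l"
  unfolding before_def
proof
  fix w assume w: "w \<in> l"
  obtain v where v: "v \<in> k" using curtain_nonempty cut_is_curtain[OF k] by blast
  have con: "connected (k \<union> side k y)"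
    using connected_side cut_is_curtain[OF k] cut_notin[OF k] by blast
  have "before y k h" by (rule before_swap[OF hk h k xhk])
  then have dis: "(k \<union> side k y) \<inter> h = {}" using hk by (auto simp: before_def side_def)
  have "cut k x w" using w xkl by (auto simp: before_def)
  then have "w \<in> side k y" using cut_third[OF k, of w] cut_notin cut_commute unfolding side_def by blast
  then have "\<not> cut h v w" "w \<notin> h" using connected_meets_curtain[OF con, of v w h] dis v by auto
  moreover have "cut h x v" using v xhk by (auto simp: before_def)
  ultimately show "cut h x w" using cut_third[of h x v w] cut_commute by blast
qed

definition cutting :: "'a::metric_space set set \<Rightarrow> 'a \<Rightarrow> 'a \<Rightarrow> bool" where
  "cutting H x y \<longleftrightarrow> pairwise disjnt H \<and> (\<forall>h\<in>H. cut h x y)"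

lemma cutting_subset: "\<lbrakk>cutting H x y; K \<subseteq> H\<rbrakk> \<Longrightarrow> cutting K x y"
  unfolding cutting_def by (meson pairwise_subset subsetD)

lemma cuttingD:
  assumes "cutting H x y"
  shows "h \<in> H \<Longrightarrow> cut h x y" and "\<lbrakk>h \<in> H; k \<in> H; h \<noteq> k\<rbrakk> \<Longrightarrow> h \<inter> k = {}"
  using assms unfolding cutting_def pairwise_def disjnt_def by auto

lemma last_curtain:
  fixes x :: "'a::cat0_space"
  assumes "finite H" "H \<noteq> {}" "cutting H x y"
  shows "\<exists>h\<in>H. \<forall>k\<in>H - {h}. before x k h"
  using assms
proof (induction H rule: finite_ne_induct)
  case (insert a H)
  have cH: "cutting H x y" using insert.prems cutting_subset by blast
  then obtain h where h: "h \<in> H" "\<And>k. k \<in> H - {h} \<Longrightarrow> before x k h" using insert.IH by blast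
  note c = cuttingD(1)[OF insert.prems] and d = cuttingD(2)[OF insert.prems]
  have ah: "a \<inter> h = {}" by (rule d) (use h insert.hyps in auto)
  consider "before x a h" | "before x h a"
    using before_total[OF ah, of x y] c h(1) by auto
  then show ?case
  proof cases
    case 1
    then have "\<forall>k\<in>insert a H - {h}. before x k h" using h by blast
    then show ?thesis using h by blast
  next
    case 2
    have "before x k a" if "k \<in> H" for k
    proof (cases "k = h")
      case False
      show ?thesis by (rule before_trans[where k = h and y = y]) (use False that h c d 2 in auto)
    qed (use 2 in simp)
    then show ?thesis by blast
  qed
qed simp

lemma cutting_enumeration:
  fixes x :: "'a::cat0_space"
  assumes "finite H" "cutting H x y"
  shows "\<exists>e::nat \<Rightarrow> 'a set. H = e ` {..<card H} \<and> (\<forall>j<card H. \<forall>i<j. before x (e i) (e j))"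
  using assms
proof (induction "card H" arbitrary: H)
  case (Suc n)
  then have "H \<noteq> {}" by auto
  then obtain h where h: "h \<in> H" "\<forall>k\<in>H - {h}. before x k h"
    using last_curtain[OF Suc.prems(1) _ Suc.prems(2)] by blast
  have n: "n = card (H - {h})" using Suc.hyps(2) h Suc.prems by simp
  obtain e where e: "H - {h} = e ` {..<n}" "\<forall>j<n. \<forall>i<j. before x (e i) (e j)"
    using Suc.hyps(1)[OF n] Suc.prems cutting_subset[of H x y "H - {h}"] n by auto
  have "H = (e(n := h)) ` {..<card H}"
    using e(1) h(1) unfolding Suc.hyps(2)[symmetric] lessThan_Suc by auto
  moreover have "before x ((e(n := h)) i) ((e(n := h)) j)" if "j < card H" "i < j" for i j
  proof (cases "j = n")
    case True
    then have "e i \<in> H - {h}" using that e(1) by auto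
    then show ?thesis using True that h(2) by simp
  next
    case False
    then show ?thesis using that e(2) Suc.hyps(2) by simp
  qed
  ultimately show ?case by blast
qed auto

lemma separatesI:
  fixes h :: "'a::cat0_space set"
  assumes h: "cut h x y" and A: "\<And>a. a \<in> A \<Longrightarrow> cut h y a" and B: "\<And>b. b \<in> B \<Longrightarrow> cut h x b"
  shows "separates h A B"
proof -
  obtain I \<alpha> r where d: "curtain_data I \<alpha> r" "h = dual_curtain I \<alpha> r"
    using h unfolding cut_def separates_def by blast
  let ?f = "coord I \<alpha>"
  have c: "cut h p q \<longleftrightarrow> ?f p < r - 1/2 \<and> r + 1/2 < ?f q \<or> ?f q < r - 1/2 \<and> r + 1/2 < ?f p" for p q
    using cut_iff_component[OF cut_is_curtain[OF h]] slab_component[OF curtain_data_vimage(4)[OF d(1)]]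
    unfolding d(2) by blast
  have "A \<subseteq> neg_halfspace I \<alpha> r \<and> B \<subseteq> pos_halfspace I \<alpha> r \<or>
        B \<subseteq> neg_halfspace I \<alpha> r \<and> A \<subseteq> pos_halfspace I \<alpha> r"
  proof (cases "?f x < r - 1/2")
    case True
    then have y: "r + 1/2 < ?f y" using h c by auto
    have "?f a < r - 1/2" if "a \<in> A" for a using A[OF that] y unfolding c by linarith
    moreover have "r + 1/2 < ?f b" if "b \<in> B" for b using B[OF that] True unfolding c by linarith
    ultimately show ?thesis by (auto simp: curtain_data_vimage[OF d(1)])
  next
    case False
    then have xy: "r + 1/2 < ?f x" "?f y < r - 1/2" using h c by auto
    have "r + 1/2 < ?f a" if "a \<in> A" for a using A[OF that] xy unfolding c by linarith
    moreover have "?f b < r - 1/2" if "b \<in> B" for b using B[OF that] xy unfolding c by linarith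
    ultimately show ?thesis by (auto simp: curtain_data_vimage[OF d(1)])
  qed
  then show ?thesis using d unfolding separates_def by blast
qed

text \<open>
  So the order along a chain comes for free: a chain that separates two points is just a finite set of
  disjoint curtains that separate them.
\<close>
lemma cutting_is_chain:
  fixes x :: "'a::cat0_space"
  assumes fin: "finite H" and H: "cutting H x y"
  shows "is_chain H"
proof -
  define n where "n = card H"
  obtain e where e: "H = e ` {..<n}" and be': "\<forall>j<n. \<forall>i<j. before x (e i) (e j)"
    using cutting_enumeration[OF assms] unfolding n_def by blast
  then have be: "before x (e i) (e j)" if "i < j" "j < n" for i j using that by blast
  have c: "cut (e i) x y" if "i < n" for i by (rule cuttingD(1)[OF H]) (use that e in auto)
  have ne: "e i \<noteq> e j" if ij: "i < j" "j < n" for i j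
  proof
    assume eq: "e i = e j"
    obtain v where v: "v \<in> e j" using curtain_nonempty[OF cut_is_curtain[OF c[OF ij(2)]]] by blast
    then have "cut (e j) x v" using be[OF ij] eq by (auto simp: before_def)
    then show False using cut_notin v by blast
  qed
  have d: "e i \<inter> e j = {}" if "i < n" "j < n" "i \<noteq> j" for i j
  proof -
    have "e i \<noteq> e j" using ne[of i j] ne[of j i] that by (metis nat_neq_iff)
    then show ?thesis by (intro cuttingD(2)[OF H]) (use that e in auto)
  qed
  define g where "g i = e (nat i)" for i :: int
  show ?thesis
    unfolding is_chain_def
  proof (intro exI[of _ "{0..<int n}"] exI[of _ g] conjI allI ballI impI)
    show "H = g ` {0..<int n}"
    proof -
      have "g ` {0..<int n} = e ` (nat ` {0..<int n})" by (auto simp: g_def image_image)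
      also have "nat ` {0..<int n} = {..<n}"
      proof
        show "{..<n} \<subseteq> nat ` {0..<int n}" by (auto intro!: image_eqI[of _ nat "int _"])
      qed auto
      finally show ?thesis using e by simp
    qed
    show "is_curtain (g i)" if "i \<in> {0..<int n}" for i
      using that c[of "nat i"] cut_is_curtain unfolding g_def by (metis atLeastLessThan_iff nat_less_iff)
    show "disjoint_family_on g {0..<int n}"
      unfolding disjoint_family_on_def g_def
    proof (intro ballI impI)
      fix i k assume "i \<in> {0..<int n}" "k \<in> {0..<int n}" "i \<noteq> k"
      then show "e (nat i) \<inter> e (nat k) = {}" by (intro d) auto
    qed
    show "separates (g i) (g (i - 1)) (g (i + 1))"
      if "i - 1 \<in> {0..<int n} \<and> i + 1 \<in> {0..<int n}" for i
    proof -
      define j where "j = nat (i - 1)"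
      have j: "nat (i - 1) = j" "nat i = Suc j" "nat (i + 1) = Suc (Suc j)" "Suc (Suc j) < n"
        using that by (auto simp: j_def)
      have "before y (e (Suc j)) (e j)"
        by (rule before_swap[OF d c c be]) (use j in auto)
      moreover have "before x (e (Suc j)) (e (Suc (Suc j)))" by (rule be) (use j in auto)
      ultimately show ?thesis
        unfolding g_def j using separatesI[OF c[of "Suc j"]] j unfolding before_def by auto
    qed
  qed auto
qed

subsection \<open>Curtains are thick\<close>

text \<open>
  The interval begins at the last time \<open>g\<close> is at most \<open>a\<close> before it first reaches \<open>a + 1\<close>.
\<close>
lemma crossing_interval:
  fixes g :: "real \<Rightarrow> real"
  assumes lip: "\<And>s t. \<lbrakk>0 \<le> s; s \<le> d; 0 \<le> t; t \<le> d\<rbrakk> \<Longrightarrow> \<bar>g s - g t\<bar> \<le> \<bar>s - t\<bar>"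
    and d: "0 \<le> d" and g0: "g 0 < a" and gd: "a + 1 < g d"
  shows "\<exists>s\<ge>0. s + 1 \<le> d \<and> (\<forall>t. s < t \<and> t < s + 1 \<longrightarrow> a \<le> g t \<and> g t \<le> a + 1)"
proof -
  have cont: "continuous_on {0..d} g"
    by (rule lipschitz_on_continuous_on[of 1]) (auto simp: lipschitz_on_def dist_real_def lip)
  define T where "T = {t \<in> {0..d}. a + 1 \<le> g t}"
  have "closed T" unfolding T_def
    by (intro continuous_closed_imp_Cauchy_continuous continuous_on_closed_Collect_le cont continuous_on_const closed_atLeastAtMost)
  moreover have "bounded T" unfolding T_def by (rule bounded_subset[of "{0..d}"]) auto
  moreover have "d \<in> T" using d gd by (auto simp: T_def)
  ultimately obtain t1 where t1: "t1 \<in> T" "\<And>t. t \<in> T \<Longrightarrow> t1 \<le> t"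
    using compact_attains_inf[of T] compact_eq_bounded_closed by blast
  define S where "S = {t \<in> {0..t1}. g t \<le> a}"
  have t1d: "0 \<le> t1" "t1 \<le> d" "a + 1 \<le> g t1" using t1 by (auto simp: T_def)
  have "closed S" unfolding S_def
    by (intro continuous_on_closed_Collect_le continuous_on_subset[OF cont] continuous_on_const closed_atLeastAtMost)
      (use t1d in auto)
  moreover have "bounded S" unfolding S_def by (rule bounded_subset[of "{0..t1}"]) auto
  moreover have "0 \<in> S" using t1d g0 by (auto simp: S_def)
  ultimately obtain t0 where t0: "t0 \<in> S" "\<And>t. t \<in> S \<Longrightarrow> t \<le> t0"
    using compact_attains_sup[of S] compact_eq_bounded_closed by blast
  have t0': "0 \<le> t0" "t0 \<le> t1" "g t0 \<le> a" using t0 by (auto simp: S_def)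
  have "1 \<le> t1 - t0" using lip[of t1 t0] t0' t1d by auto
  moreover have "a \<le> g t \<and> g t \<le> a + 1" if "t0 < t" "t < t0 + 1" for t
  proof -
    have "t \<notin> S" "t \<notin> T" using t0(2)[of t] t1(2)[of t] that \<open>1 \<le> t1 - t0\<close> by auto
    then show ?thesis using that t0' t1d \<open>1 \<le> t1 - t0\<close> by (auto simp: S_def T_def)
  qed
  ultimately show ?thesis using t0' t1d by (intro exI[of _ t0]) auto
qed

lemma cut_crossing:
  fixes x y :: "'a::cat0_space"
  assumes "cut h x y"
  shows "\<exists>s\<ge>0. s + 1 \<le> dist x y \<and> (\<forall>t. s < t \<and> t < s + 1 \<longrightarrow> geo x y t \<in> h)"
proof -
  obtain f r where hf: "height f r h" using curtain_height[OF cut_is_curtain[OF assms]] by blast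
  note c = heightD(5)[OF hf] and v = heightD(3)[OF hf]
  have lip: "\<bar>f (geo x y s) - f (geo x y t)\<bar> \<le> \<bar>s - t\<bar>"
    if "0 \<le> s" "s \<le> dist x y" "0 \<le> t" "t \<le> dist x y" for s t
    using heightD(1)[OF hf, of "geo x y s" "geo x y t"] dist_geo[OF that] by simp
  consider "f x < r - 1/2" "r + 1/2 < f y" | "f y < r - 1/2" "r + 1/2 < f x"
    using assms c by blast
  then show ?thesis
  proof cases
    case 1
    have "\<exists>s\<ge>0. s + 1 \<le> dist x y \<and> (\<forall>t. s < t \<and> t < s + 1 \<longrightarrow>
        r - 1/2 \<le> f (geo x y t) \<and> f (geo x y t) \<le> r - 1/2 + 1)"
      by (rule crossing_interval) (use lip 1 in auto)
    then show ?thesis unfolding v by (simp add: algebra_simps)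
  next
    case 2
    have "\<exists>s\<ge>0. s + 1 \<le> dist x y \<and> (\<forall>t. s < t \<and> t < s + 1 \<longrightarrow>
        - r - 1/2 \<le> - f (geo x y t) \<and> - f (geo x y t) \<le> - r - 1/2 + 1)"
      by (rule crossing_interval) (use lip 2 in \<open>auto simp: abs_minus_commute\<close>)
    moreover have "- r - 1/2 \<le> - z \<and> - z \<le> - r - 1/2 + 1 \<longleftrightarrow> r - 1/2 \<le> z \<and> z \<le> r + 1/2" for z
      by auto
    ultimately show ?thesis unfolding v by simp
  qed
qed

text \<open>
  Each curtain occupies an open interval of length one on the geodesic from \<open>x\<close> to \<open>y\<close>, and these intervals
  are disjoint; so the integer parts of their left ends are distinct.
\<close>
lemma cutting_card:
  fixes x y :: "'a::cat0_space"
  assumes H: "cutting H x y"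
  shows "finite H" and "real (card H) \<le> dist x y"
proof -
  obtain s where s: "\<And>h. h \<in> H \<Longrightarrow> 0 \<le> s h \<and> s h + 1 \<le> dist x y"
    and st: "\<And>h t. h \<in> H \<Longrightarrow> s h < t \<Longrightarrow> t < s h + 1 \<Longrightarrow> geo x y t \<in> h"
    using cut_crossing[OF cuttingD(1)[OF H]] by metis
  define N where "N = nat \<lfloor>dist x y\<rfloor>"
  have inj: "inj_on (\<lambda>h. nat \<lfloor>s h\<rfloor>) H"
  proof (rule inj_onI, rule ccontr)
    fix h k assume hk: "h \<in> H" "k \<in> H" "nat \<lfloor>s h\<rfloor> = nat \<lfloor>s k\<rfloor>" "h \<noteq> k"
    then have "\<lfloor>s h\<rfloor> = \<lfloor>s k\<rfloor>" using s by (metis eq_nat_nat_iff zero_le_floor)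
    then have "\<bar>s h - s k\<bar> < 1" by linarith
    moreover define t where "t = (s h + s k + 1) / 2"
    ultimately have "s h < t" "t < s h + 1" "s k < t" "t < s k + 1" by (auto simp: abs_less_iff)
    then have "geo x y t \<in> h \<inter> k" using st hk by auto
    then show False using cuttingD(2)[OF H hk(1,2,4)] by auto
  qed
  have ran: "(\<lambda>h. nat \<lfloor>s h\<rfloor>) ` H \<subseteq> {..<N}"
  proof
    fix n assume "n \<in> (\<lambda>h. nat \<lfloor>s h\<rfloor>) ` H"
    then obtain h where h: "h \<in> H" "n = nat \<lfloor>s h\<rfloor>" by blast
    have "\<lfloor>s h\<rfloor> + 1 \<le> \<lfloor>dist x y\<rfloor>" using s[OF h(1)] by (simp add: le_floor_iff) linarith
    then show "n \<in> {..<N}" using s[OF h(1)] h(2) unfolding N_def by auto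
  qed
  show fin: "finite H" using inj ran by (metis finite_imageD finite_lessThan finite_subset)
  have "card H \<le> N" using card_inj_on_le[OF inj ran] by simp
  then have "real (card H) \<le> real N" by simp
  also have "\<dots> \<le> dist x y" unfolding N_def by simp
  finally show "real (card H) \<le> dist x y" .
qed

lemma L_separated_cutting:
  fixes x y :: "'a::cat0_space"
  assumes "L_separated L h k" "cutting C x y" "\<And>c. c \<in> C \<Longrightarrow> c \<inter> h \<noteq> {} \<and> c \<inter> k \<noteq> {}"
  shows "card C \<le> L"
  using assms cutting_is_chain[OF cutting_card(1)[OF assms(2)] assms(2)] unfolding L_separated_def by blast

text \<open>
  If \<open>h\<close> and \<open>k\<close> both project onto \<open>[s, t]\<close> in a geodesic, then every curtain dual to the geodesic at a
  time in between meets both. If \<open>t - s\<close> exceeds \<open>L + 1\<close>, then \<open>L + 1\<close> such curtains fit in disjointly.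
\<close>
lemma L_separated_overlap:
  fixes x y :: "'a::cat0_space"
  defines "f \<equiv> coord {0..dist x y} (geo x y)"
  assumes L: "L_separated L h k" and hk: "connected h" "connected k"
    and st: "0 \<le> s" "t \<le> dist x y"
    and h: "u1 \<in> h" "f u1 \<le> s" "v1 \<in> h" "t \<le> f v1"
    and k: "u2 \<in> k" "f u2 \<le> s" "v2 \<in> k" "t \<le> f v2"
  shows "t - s \<le> real L + 1"
proof (rule ccontr)
  assume "\<not> t - s \<le> real L + 1"
  then have big: "real L + 1 < t - s" by simp
  interpret closed_geodesic "{0..dist x y}" "geo x y"
    by unfold_locales (auto simp: geodesic_on_geo)
  \<comment> \<open>Spacing above one keeps the dual curtains disjoint although they are closed.\<close>
  define \<delta> where "\<delta> = (t - s) / (real L + 1)"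
  have \<delta>: "1 < \<delta>" "\<delta> * (real L + 1) = t - s" using big by (auto simp: \<delta>_def field_simps)
  define r where "r i = s + (real i + 1/2) * \<delta>" for i :: nat
  define c where "c i = dual_curtain {0..dist x y} (geo x y) (r i)" for i
  have r: "s + 1/2 < r i" "r i + 1/2 < t" if "i \<le> L" for i
  proof -
    have "(1/2) * 1 < (1/2 :: real) * \<delta>" using \<delta> by simp
    also have "\<dots> \<le> (real i + 1/2) * \<delta>" using \<delta> by (intro mult_right_mono) auto
    finally show "s + 1/2 < r i" by (simp add: r_def)
    have "(real i + 1) * \<delta> \<le> (real L + 1) * \<delta>" using that \<delta> by (intro mult_right_mono) auto
    moreover have "(real i + 1) * \<delta> = (real i + 1/2) * \<delta> + \<delta> / 2" by (simp add: algebra_simps)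
    ultimately show "r i + 1/2 < t" using \<delta> unfolding r_def by (simp add: mult.commute)
  qed
  have cd: "curtain_data {0..dist x y} (geo x y) (r i)" if "i \<le> L" for i
    using r[OF that] st unfolding curtain_data_def by (auto simp: geodesic_on_geo)
  have civ: "c i = f -` {r i - 1/2..r i + 1/2}" if "i \<le> L" for i
    unfolding c_def f_def by (rule curtain_data_vimage(1)[OF cd[OF that]])
  have ends: "f x = 0" "f y = dist x y"
    using coord_self[of 0] coord_self[of "dist x y"] by (auto simp: f_def)
  have ccut: "cut (c i) x y" if "i \<le> L" for i
    unfolding c_def by (rule curtain_data_cut[OF cd[OF that]])
      (use ends r[OF that] st in \<open>auto simp: f_def[symmetric]\<close>)
  have disj: "c i \<inter> c j = {}" if "i \<le> L" "j \<le> L" "i < j" for i j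
  proof -
    have "(real i + 1) * \<delta> \<le> real j * \<delta>" using that \<delta> by (intro mult_right_mono) auto
    moreover have "r j - r i = real j * \<delta> - (real i + 1) * \<delta> + \<delta>" by (simp add: r_def algebra_simps)
    ultimately have "r i + 1/2 < r j - 1/2" using \<delta> by linarith
    then show ?thesis by (auto simp: civ that)
  qed
  have disj': "c i \<inter> c j = {}" if "i \<le> L" "j \<le> L" "i \<noteq> j" for i j
    using disj[of i j] disj[of j i] that by (metis Int_commute nat_neq_iff)
  have inj: "inj_on c {..L}"
  proof (rule inj_onI, rule ccontr)
    fix i j assume ij: "i \<in> {..L}" "j \<in> {..L}" "c i = c j" "i \<noteq> j"
    then have "c i = {}" using disj'[of i j] by auto
    then show False using curtain_nonempty[OF cut_is_curtain[OF ccut]] ij by auto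
  qed
  have cont: "continuous_on S f" for S
    unfolding f_def by (rule slab_continuous[OF curtain_data_vimage(4)[OF cd[of 0]]]) simp
  have meets: "c i \<inter> m \<noteq> {}" if "i \<le> L" "connected m" "u \<in> m" "f u \<le> s" "v \<in> m" "t \<le> f v" for i m u v
  proof -
    have "connected (f ` m)" by (rule connected_continuous_image[OF cont that(2)])
    moreover have "f u \<in> f ` m" "f v \<in> f ` m" "f u \<le> r i" "r i \<le> f v" using that r[OF that(1)] by auto
    ultimately have "r i \<in> f ` m" by (auto simp: connected_iff_interval)
    then obtain z where "z \<in> m" "f z = r i" by auto
    then have "z \<in> c i \<inter> m" using civ[OF that(1)] by simp
    then show ?thesis by blast
  qed
  have "card (c ` {..L}) \<le> L"
  proof (rule L_separated_cutting[OF L])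
    show "cutting (c ` {..L}) x y"
      unfolding cutting_def pairwise_def disjnt_def using ccut disj' by auto
    show "a \<inter> h \<noteq> {} \<and> a \<inter> k \<noteq> {}" if "a \<in> c ` {..L}" for a
      using that meets[OF _ hk(1) h] meets[OF _ hk(2) k] by auto
  qed
  then show False using card_image[OF inj] by simp
qed

subsection \<open>The bottleneck\<close>

text \<open>
  Let \<open>u\<close> be the projection of \<open>q\<close> to \<open>[b,x]\<close> and \<open>\<sigma> = [u,q]\<close>. All of \<open>[b,x]\<close> projects to the end \<open>u\<close> of
  \<open>\<sigma>\<close>, and one of the two parts of \<open>[p,y]\<close> at \<open>q\<close> projects to the other end. Two of the three curtains meet
  both \<open>[b,x]\<close> and that part, so they overlap along all of \<open>\<sigma>\<close>.
\<close>
lemma bottleneck: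
  fixes b x p y :: "'a::cat0_space"
  assumes h: "connected h1" "connected h2" "connected h3"
    and L: "L_separated L h1 h2" "L_separated L h2 h3"
    and m: "0 \<le> m1" "m1 \<le> m" "m \<le> m3" "m3 \<le> dist p y"
      "geo p y m1 \<in> h1" "geo p y m \<in> h2" "geo p y m3 \<in> h3"
    and v: "v1 \<in> {0..dist b x}" "v2 \<in> {0..dist b x}" "v3 \<in> {0..dist b x}"
      "geo b x v1 \<in> h1" "geo b x v2 \<in> h2" "geo b x v3 \<in> h3"
  shows "\<exists>u\<in>{0..dist b x}. dist (geo p y m) (geo b x u) \<le> real L + 1"
proof -
  interpret G: closed_geodesic "{0..dist b x}" "geo b x"
    by unfold_locales (auto simp: geodesic_on_geo)
  define q u w where "q = geo p y m" and "u = coord {0..dist b x} (geo b x) q" and "w = geo b x u"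
  define \<sigma> H where "\<sigma> = geo w q" and "H = dist w q"
  have u: "u \<in> {0..dist b x}" unfolding u_def by (rule G.coord_mem)
  interpret S: closed_geodesic "{0..dist w q}" "geo w q"
    by unfold_locales (auto simp: geodesic_on_geo)
  define f where "f = coord {0..dist w q} (geo w q)"
  have f_base: "f (geo b x v) = 0" if v: "v \<in> {0..dist b x}" for v
    unfolding f_def
  proof (rule S.coord_unique)
    fix s assume s: "s \<in> {0..dist w q}"
    let ?z = "geo w q s"
    have z: "?z = geo q w (dist w q - s)"
      using geo_reverse[of s q w] s by (simp add: dist_commute)
    have cz: "coord {0..dist b x} (geo b x) ?z = u"
      unfolding z using G.coord_on_perpendicular[of "dist w q - s" q] s
      by (simp add: u_def[symmetric] w_def[symmetric] dist_commute)
    have "(dist w (geo b x v))\<^sup>2 \<le> (dist ?z (geo b x v))\<^sup>2"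
      using G.pythagoras[OF v, of ?z] G.dist_param[OF u v] unfolding cz w_def[symmetric]
      by (simp add: w_def) (smt (verit) zero_le_power2)
    then show "dist (geo b x v) (geo w q 0) \<le> dist (geo b x v) ?z"
      by (simp add: dist_commute abs_le_square_iff[symmetric])
  qed simp
  have f_q: "f q = H" using S.coord_self[of "dist w q"] by (simp add: f_def H_def)
  have nearer: "dist a (geo w q t) < dist a q"
    if a: "f a \<noteq> H" and t: "f a \<le> t" "t < H" for a t
  proof -
    define s where "s = f a"
    have s: "0 \<le> s" "s \<le> H" using S.coord_mem[of a] by (auto simp: s_def f_def H_def)
    have min: "dist a (geo w q s) < dist a q"
    proof (rule ccontr)
      assume "\<not> ?thesis"
      then have "dist a (geo w q (dist w q)) \<le> dist a (geo w q (coord {0..dist w q} (geo w q) a))"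
        by (simp add: s_def f_def)
      then have "dist a (geo w q (dist w q)) \<le> dist a (geo w q s')" if "s' \<in> {0..dist w q}" for s'
        using S.coord_min[OF that, of a] by linarith
      then have "f a = H" unfolding f_def H_def by (intro S.coord_unique) auto
      then show False using a by simp
    qed
    define l where "l = (t - s) / (H - s)"
    have sH: "s < H" using t by (simp add: s_def)
    have l: "0 \<le> l" "l < 1" "l * (H - s) = t - s" using t sH by (auto simp: l_def s_def)
    have ds: "dist (geo w q s) q = H - s" using dist_geo_right[of s w q] s by (simp add: H_def)
    have "geo (geo w q s) q (l * dist (geo w q s) q) = geo w q t"
      unfolding ds l(3) using geo_tail[of "t - s" s w q] s t by (simp add: H_def s_def)
    then have "(dist a (geo w q t))\<^sup>2 \<le> (1 - l) * (dist a (geo w q s))\<^sup>2 + l * (dist a q)\<^sup>2 - l * (1 - l) * (dist (geo w q s) q)\<^sup>2"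
      using bruhat_tits[of l a "geo w q s" q] l by simp
    also have "\<dots> \<le> (1 - l) * (dist a (geo w q s))\<^sup>2 + l * (dist a q)\<^sup>2" using l by simp
    also have "\<dots> < (1 - l) * (dist a q)\<^sup>2 + l * (dist a q)\<^sup>2"
      using l min by (intro add_strict_right_mono mult_strict_left_mono power_strict_mono) auto
    finally have "(dist a (geo w q t))\<^sup>2 < (dist a q)\<^sup>2" by (simp add: algebra_simps)
    then show ?thesis by (rule power2_less_imp_less) simp
  qed
  have "f (geo p y m1) = H \<or> f (geo p y m3) = H"
  proof (rule ccontr)
    let ?a = "geo p y m1" and ?c = "geo p y m3"
    assume "\<not> ?thesis"
    then have ne: "f ?a \<noteq> H" "f ?c \<noteq> H" by auto
    define t where "t = max (f ?a) (f ?c)"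
    have "f ?a \<le> H" "f ?c \<le> H" using S.coord_mem unfolding f_def H_def by auto
    then have t: "t < H" "f ?a \<le> t" "f ?c \<le> t" using ne by (auto simp: t_def)
    have "dist ?a ?c \<le> dist ?a (geo w q t) + dist ?c (geo w q t)"
      by (metis dist_commute dist_triangle)
    also have "\<dots> < dist ?a q + dist ?c q"
      using nearer[OF ne(1) t(2,1)] nearer[OF ne(2) t(3,1)] by simp
    also have "\<dots> = dist ?a ?c" unfolding q_def using m by (simp add: dist_geo)
    finally show False by simp
  qed
  moreover have "H \<le> real L + 1" if "f (geo p y m1) = H"
    using L_separated_overlap[OF L(1) h(1,2), of 0 "dist w q" w q "geo b x v1" "geo p y m1" "geo b x v2" q]
      that f_base v m f_q unfolding f_def H_def by (simp add: q_def)
  moreover have "H \<le> real L + 1" if "f (geo p y m3) = H"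
    using L_separated_overlap[OF L(2) h(2,3), of 0 "dist w q" w q "geo b x v2" q "geo b x v3" "geo p y m3"]
      that f_base v m f_q unfolding f_def H_def by (simp add: q_def)
  ultimately have "H \<le> real L + 1" by blast
  then show ?thesis using u unfolding H_def w_def q_def by (auto simp: dist_commute)
qed

lemma meets_geo:
  fixes x y :: "'a::cat0_space"
  assumes "cut h (geo x y s) (geo x y t)" "0 \<le> s" "s \<le> t" "t \<le> dist x y"
  shows "\<exists>m\<in>{s..t}. geo x y m \<in> h"
  using connected_meets_curtain[OF connected_geo[of s t x y] _ _ assms(1)] assms by auto

text \<open>
  The last two curtains before \<open>y\<close> and an earlier one serve as the bottleneck, with the point \<open>geo p y m\<close> on the
  last but one. All curtains but the last two lie between \<open>p\<close> and that point, which is therefore far from \<open>p\<close>,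
  because curtains are thick.
\<close>
lemma bottleneck_chain:
  fixes b x p y :: "'a::cat0_space"
  assumes K: "pairwise (L_separated L) K" and card: "3 \<le> card K"
    and bx: "\<And>k. k \<in> K \<Longrightarrow> cut k b x" and py: "\<And>k. k \<in> K \<Longrightarrow> cut k p y"
  shows "\<exists>m\<in>{0..dist p y}. \<exists>u\<in>{0..dist b x}.
    dist (geo p y m) (geo b x u) \<le> real L + 1 \<and> real (card K) - 2 \<le> m"
proof -
  have disj: "pairwise disjnt K" using K unfolding pairwise_def disjnt_def L_separated_def by blast
  have c: "cutting K p y" using disj py by (auto simp: cutting_def)
  have fin: "finite K" using card card.infinite by force
  have "K \<noteq> {}" using card by auto
  then obtain h3 where h3: "h3 \<in> K" "\<forall>k\<in>K - {h3}. before p k h3"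
    using last_curtain[OF fin _ c] by blast
  have "card (K - {h3}) = card K - 1" using fin h3 by simp
  then have ne3: "K - {h3} \<noteq> {}" using card by (metis card.empty diff_is_0_eq not_numeral_le_zero
        numeral_3_eq_3 Suc_le_mono One_nat_def nat_le_linear not_less_eq_eq)
  have c3: "cutting (K - {h3}) p y" by (rule cutting_subset[OF c]) auto
  obtain h2 where h2: "h2 \<in> K - {h3}" "\<forall>k\<in>K - {h3} - {h2}. before p k h2"
    using last_curtain[OF _ ne3 c3] fin by blast
  define K' where "K' = K - {h3} - {h2}"
  have cK': "card K' = card K - 2" unfolding K'_def using fin h2 h3 by simp
  then have "K' \<noteq> {}" using card by auto
  then obtain h1 where h1: "h1 \<in> K'" by blast
  have ne: "h1 \<noteq> h2" "h2 \<noteq> h3" "h1 \<in> K" "h2 \<in> K" using h1 h2 by (auto simp: K'_def)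
  obtain m where m: "m \<in> {0..dist p y}" "geo p y m \<in> h2"
    using meets_geo[of h2 p y 0 "dist p y"] py[OF ne(4)] by auto
  have K'cut: "cut k p (geo p y m)" if "k \<in> K'" for k
    using h2(2) that m unfolding K'_def before_def by blast
  obtain m1 where m1: "m1 \<in> {0..m}" "geo p y m1 \<in> h1"
    using meets_geo[of h1 p y 0 m] K'cut[OF h1] m by auto
  have "before y h3 h2"
    by (rule before_swap[of h2 h3 p]) (use disj ne h3 h2 py in \<open>auto simp: pairwise_def disjnt_def\<close>)
  then have "cut h3 (geo p y m) y" using m cut_commute unfolding before_def by blast
  then obtain m3 where m3: "m3 \<in> {m..dist p y}" "geo p y m3 \<in> h3"
    using meets_geo[of h3 p y m "dist p y"] m by auto
  have hit: "\<exists>v\<in>{0..dist b x}. geo b x v \<in> k" if "k \<in> K" for k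
    using meets_geo[of k b x 0 "dist b x"] bx[OF that] by auto
  obtain v1 v2 v3 where v: "v1 \<in> {0..dist b x}" "geo b x v1 \<in> h1" "v2 \<in> {0..dist b x}" "geo b x v2 \<in> h2"
    "v3 \<in> {0..dist b x}" "geo b x v3 \<in> h3"
    using hit ne h3(1) by metis
  have con: "connected k" if "k \<in> K" for k
    using curtain_connected[OF cut_is_curtain[OF py[OF that]]] .
  have "L_separated L h1 h2" "L_separated L h2 h3" using K ne h3(1) unfolding pairwise_def by blast+
  then obtain u where u: "u \<in> {0..dist b x}" "dist (geo p y m) (geo b x u) \<le> real L + 1"
    using bottleneck[of h1 h2 h3 L m1 m m3 p y v1 b x v2 v3] con[OF ne(3)] con[OF ne(4)] con[OF h3(1)]
      m m1 m3 v by auto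
  have "cutting K' p (geo p y m)"
    using disj K'cut unfolding cutting_def K'_def by (auto intro: pairwise_subset)
  then have "real (card K') \<le> m" using cutting_card(2) dist_geo_left[of m p y] m by fastforce
  then show ?thesis using m u cK' card by (intro bexI[of _ m] bexI[of _ u]) auto
qed

section \<open>Counting separated curtains\<close>

text \<open>
  Up to an error linear in \<open>L\<close> this is the Gromov product of \<open>x\<close> and \<open>y\<close> at \<open>b\<close> for the metric \<open>d_L\<close>, and
  \<open>sepnum L b x x\<close> is \<open>d_L L b x - 1\<close> for \<open>x \<noteq> b\<close>. The maximum exists because curtains are thick.
\<close>
definition sepnum :: "nat \<Rightarrow> 'a::metric_space \<Rightarrow> 'a \<Rightarrow> 'a \<Rightarrow> nat" where
  "sepnum L b x y =
     Max {card H | H. pairwise (L_separated L) H \<and> (\<forall>h\<in>H. cut h b x \<and> cut h b y)}"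

lemma pairwise_L_separated_disjnt: "pairwise (L_separated L) H \<Longrightarrow> pairwise disjnt H"
  unfolding pairwise_def by (simp add: L_separated_def disjnt_def)

lemma L_separated_cuttingI:
  "\<lbrakk>pairwise (L_separated L) H; \<And>h. h \<in> H \<Longrightarrow> cut h x y\<rbrakk> \<Longrightarrow> cutting H x y"
  using pairwise_L_separated_disjnt unfolding cutting_def by blast

lemma L_separated_commute: "L_separated L h k \<longleftrightarrow> L_separated L k h"
  unfolding L_separated_def by (auto simp: Int_commute)

lemma sepnum_set:
  fixes b :: "'a::cat0_space"
  defines "S \<equiv> \<lambda>L b x y. {card H | H :: 'a set set. pairwise (L_separated L) H \<and> (\<forall>h\<in>H. cut h b x \<and> cut h b y)}"
  shows "finite (S L b x y)" and "S L b x y \<noteq> {}"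
proof -
  have "n \<le> nat \<lfloor>dist b x\<rfloor>" if "n \<in> S L b x y" for n
  proof -
    obtain H where H: "pairwise (L_separated L) H" "\<forall>h\<in>H. cut h b x" and n: "n = card H"
      using \<open>n \<in> S L b x y\<close> unfolding S_def by blast
    have "cutting H b x" by (rule L_separated_cuttingI[OF H(1)]) (use H(2) in blast)
    then have "real n \<le> dist b x" using cutting_card(2) n by blast
    then show ?thesis by (simp add: le_nat_floor)
  qed
  then show "finite (S L b x y)" by (meson finite_nat_set_iff_bounded_le)
  have "card {} \<in> S L b x y" unfolding S_def by (intro CollectI exI[of _ "{}"]) auto
  then show "S L b x y \<noteq> {}" by blast
qed

lemma sepnum_ge:
  fixes b :: "'a::cat0_space"
  assumes "pairwise (L_separated L) H" "\<And>h. h \<in> H \<Longrightarrow> cut h b x" "\<And>h. h \<in> H \<Longrightarrow> cut h b y"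
  shows "card H \<le> sepnum L b x y"
  unfolding sepnum_def by (rule Max_ge[OF sepnum_set(1)]) (use assms in blast)

lemma sepnum_attained:
  fixes b :: "'a::cat0_space"
  obtains H where "pairwise (L_separated L) H" "\<And>h. h \<in> H \<Longrightarrow> cut h b x" "\<And>h. h \<in> H \<Longrightarrow> cut h b y"
    "card H = sepnum L b x y" "finite H"
proof -
  have "sepnum L b x y \<in> {card H | H. pairwise (L_separated L) H \<and> (\<forall>h\<in>H. cut h b x \<and> cut h b y)}"
    unfolding sepnum_def by (rule Max_in[OF sepnum_set])
  then obtain H where H: "pairwise (L_separated L) H" "\<forall>h\<in>H. cut h b x" "\<forall>h\<in>H. cut h b y"
    "card H = sepnum L b x y"
    by auto
  have "finite H"
    by (rule cutting_card(1)[OF L_separated_cuttingI[OF H(1)]]) (use H(2) in blast)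
  then show ?thesis using that H by blast
qed

lemma sepnum_le_dist: "real (sepnum L b x y) \<le> dist b x" for b :: "'a::cat0_space"
proof -
  obtain H where H: "pairwise (L_separated L) H" "\<And>h. h \<in> H \<Longrightarrow> cut h b x" "card H = sepnum L b x y"
    using sepnum_attained[of L b x y] by metis
  show ?thesis using cutting_card(2)[OF L_separated_cuttingI[OF H(1,2)]] H(3) by simp
qed

lemma sepnum_commute: "sepnum L b x y = sepnum L b y x"
  unfolding sepnum_def by (metis (no_types, lifting))

lemma sepnum_swap: "sepnum L x y y = sepnum L y x x"
  unfolding sepnum_def by (simp add: cut_commute)

lemma sepnum_le_left: "sepnum L b x y \<le> sepnum L b x x" for b :: "'a::cat0_space"
  by (rule sepnum_attained[of L b x y]) (metis sepnum_ge)

lemma sepnum_le_right: "sepnum L b x y \<le> sepnum L b y y" for b :: "'a::cat0_space"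
  using sepnum_le_left[of L b y x] by (simp add: sepnum_commute)

lemma d_L_eq_sepnum:
  fixes x y :: "'a::cat0_space"
  shows "d_L L x y = (if x = y then 0 else 1 + sepnum L x y y)"
proof -
  have "L_chain L c \<and> chain_separates c {x} {y} \<longleftrightarrow>
      pairwise (L_separated L) c \<and> (\<forall>h\<in>c. cut h x y \<and> cut h x y)" for c
  proof
    assume "pairwise (L_separated L) c \<and> (\<forall>h\<in>c. cut h x y \<and> cut h x y)"
    then have "cutting c x y" and c: "pairwise (L_separated L) c" "\<forall>h\<in>c. cut h x y"
      using L_separated_cuttingI by blast+
    then have "is_chain c" using cutting_is_chain cutting_card(1) by blast
    then show "L_chain L c \<and> chain_separates c {x} {y}"
      using c unfolding L_chain_def chain_separates_def cut_def by blast
  qed (auto simp: L_chain_def chain_separates_def cut_def)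
  then show ?thesis unfolding d_L_def sepnum_def by simp
qed

lemma sepnum_self: "sepnum L x x x = 0" for x :: "'a::cat0_space"
  using sepnum_le_dist[of L x x x] by simp

text \<open>A further point splits a family of disjoint curtains, up to the one that may contain the point.\<close>
lemma cutting_split:
  fixes x y z :: "'a::cat0_space"
  assumes H: "cutting H x y"
  shows "card H \<le> card {h \<in> H. cut h x z} + card {h \<in> H. cut h z y} + 1"
proof -
  let ?Z = "{h \<in> H. z \<in> h}"
  have fin: "finite H" by (rule cutting_card(1)[OF H])
  have "h = k" if "h \<in> ?Z" "k \<in> ?Z" for h k
    using cuttingD(2)[OF H, of h k] that by auto
  then have Z: "card ?Z \<le> 1" using fin by (simp add: card_le_Suc0_iff_eq)
  have "H \<subseteq> {h \<in> H. cut h x z} \<union> {h \<in> H. cut h z y} \<union> ?Z"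
    using cut_third cuttingD(1)[OF H] by blast
  then have "card H \<le> card ({h \<in> H. cut h x z} \<union> {h \<in> H. cut h z y} \<union> ?Z)"
    using fin by (intro card_mono) auto
  also have "\<dots> \<le> card {h \<in> H. cut h x z} + card {h \<in> H. cut h z y} + card ?Z"
    using card_Un_le[of "{h \<in> H. cut h x z} \<union> {h \<in> H. cut h z y}" ?Z]
      card_Un_le[of "{h \<in> H. cut h x z}" "{h \<in> H. cut h z y}"] by linarith
  finally show ?thesis using Z by linarith
qed

lemma sepnum_triangle: "sepnum L x z z \<le> sepnum L x y y + sepnum L y z z + 1" for x :: "'a::cat0_space"
proof -
  obtain H where H: "pairwise (L_separated L) H" "\<And>h. h \<in> H \<Longrightarrow> cut h x z" "card H = sepnum L x z z"
    using sepnum_attained[of L x z z] by metis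
  have "card {h \<in> H. cut h x y} \<le> sepnum L x y y" "card {h \<in> H. cut h y z} \<le> sepnum L y z z"
    by (intro sepnum_ge pairwise_subset[OF H(1)]; auto)+
  then show ?thesis using cutting_split[OF L_separated_cuttingI[OF H(1,2)], of y] H(3) by linarith
qed

lemma sepnum_perturb: "real (sepnum L b x y) \<le> sepnum L b x' y + dist x x' + 1" for x :: "'a::cat0_space"
proof -
  obtain H where H: "pairwise (L_separated L) H" "\<And>h. h \<in> H \<Longrightarrow> cut h b x" "\<And>h. h \<in> H \<Longrightarrow> cut h b y"
    "card H = sepnum L b x y"
    using sepnum_attained[of L b x y] by metis
  have c: "cutting H b x" by (rule L_separated_cuttingI[OF H(1,2)])
  have "card {h \<in> H. cut h b x'} \<le> sepnum L b x' y"
    by (intro sepnum_ge pairwise_subset[OF H(1)]) (use H in auto)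
  moreover have "cutting {h \<in> H. cut h x' x} x' x"
    by (rule L_separated_cuttingI[OF pairwise_subset[OF H(1)]]) auto
  then have "real (card {h \<in> H. cut h x' x}) \<le> dist x x'"
    using cutting_card(2)[of "{h \<in> H. cut h x' x}" x' x] by (simp add: dist_commute)
  ultimately show ?thesis using cutting_split[OF c, of x'] H(4) by linarith
qed

text \<open>
  If \<open>x\<close> and \<open>y\<close> are jointly separated from \<open>b\<close> by more curtains than \<open>x\<close> and \<open>z\<close> are, the surplus separates
  \<open>{b, z}\<close> from \<open>{x, y}\<close>.
\<close>
lemma sepnum_surplus:
  fixes b x y z :: "'a::cat0_space"
  assumes "sepnum L b x z + n + 1 \<le> sepnum L b x y"
  obtains P where "pairwise (L_separated L) P" "n \<le> card P" "finite P"
    "\<And>h. h \<in> P \<Longrightarrow> cut h b x \<and> cut h b y \<and> cut h z x \<and> cut h z y"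
proof -
  obtain H where H: "pairwise (L_separated L) H" "\<And>h. h \<in> H \<Longrightarrow> cut h b x" "\<And>h. h \<in> H \<Longrightarrow> cut h b y"
    "card H = sepnum L b x y" "finite H"
    using sepnum_attained[of L b x y] by metis
  define P where "P = {h \<in> H. cut h z x}"
  have "card {h \<in> H. cut h b z} \<le> sepnum L b x z"
    by (intro sepnum_ge pairwise_subset[OF H(1)]) (use H in auto)
  then have n: "n \<le> card P"
    using cutting_split[OF L_separated_cuttingI[OF H(1,2)], of z] H(4) assms unfolding P_def by linarith
  have "cut h b x \<and> cut h b y \<and> cut h z x \<and> cut h z y" if "h \<in> P" for h
  proof -
    have h: "cut h b x" "cut h b y" "cut h z x" using that H by (auto simp: P_def)
    then have "\<not> cut h b z" using cut_third[OF h(1), of z] cut_notin[OF h(3)] by blast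
    then show ?thesis using h cut_third[OF h(2), of z] cut_notin[OF h(3)] by blast
  qed
  moreover have "pairwise (L_separated L) P" by (rule pairwise_subset[OF H(1)]) (auto simp: P_def)
  moreover have "finite P" using H(5) by (auto simp: P_def)
  ultimately show ?thesis using that n by blast
qed

subsection \<open>Gluing\<close>

text \<open>
  A connected set that meets \<open>h\<close> and \<open>k\<close> meets every curtain \<open>m\<close> between them.
\<close>
lemma L_separated_beyond:
  fixes h m k :: "'a::cat0_space set"
  assumes L: "L_separated L h m" and m: "cut m x y"
    and h: "\<And>u. u \<in> h \<Longrightarrow> cut m y u" and k: "\<And>v. v \<in> k \<Longrightarrow> cut m x v"
  shows "L_separated L h k"
proof -
  have sep: "cut m u v" if "u \<in> h" "v \<in> k" for u v
  proof -
    have u: "cut m y u" and v: "cut m x v" using that h k by auto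
    then have "\<not> cut m x u" using cut_third[OF m, of u] cut_notin[OF u] cut_commute by blast
    then show ?thesis using cut_third[OF v, of u] cut_notin[OF u] by blast
  qed
  have "h \<inter> k = {}" using sep not_cut_refl by blast
  moreover have "finite c \<and> card c \<le> L"
    if c: "is_chain c" "\<forall>e\<in>c. e \<inter> h \<noteq> {} \<and> e \<inter> k \<noteq> {}" for c
  proof -
    have "e \<inter> m \<noteq> {}" if e: "e \<in> c" for e
    proof -
      have "is_curtain e" using c(1) e unfolding is_chain_def by auto
      moreover obtain u v where "u \<in> e" "u \<in> h" "v \<in> e" "v \<in> k" using c(2) e by blast
      ultimately show ?thesis using connected_meets_curtain[OF curtain_connected] sep by blast
    qed
    then show ?thesis using L c unfolding L_separated_def by blast
  qed
  ultimately show ?thesis unfolding L_separated_def by blast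
qed

text \<open>
  Of the second family at most \<open>L\<close> curtains meet both of the last two curtains \<open>h, h'\<close> of the first one.
  Every other one lies beyond \<open>h\<close> or beyond \<open>h'\<close>, so it is \<open>L\<close>-separated from the rest of the first family.
\<close>
lemma sepnum_glue:
  fixes x y z :: "'a::cat0_space"
  assumes H: "pairwise (L_separated L) H" "\<And>h. h \<in> H \<Longrightarrow> cut h x z" "\<And>h. h \<in> H \<Longrightarrow> cut h x y"
    and K: "pairwise (L_separated L) K" "\<And>k. k \<in> K \<Longrightarrow> cut k y z" "\<And>k. k \<in> K \<Longrightarrow> cut k y x"
  shows "card H + card K \<le> sepnum L x y y + L + 2"
proof (cases "card H < 2")
  case True
  have "card K \<le> sepnum L x y y" by (rule sepnum_ge) (use K cut_commute in blast)+
  then show ?thesis using True by linarith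
next
  case False
  have cH: "cutting H x y" by (rule L_separated_cuttingI[OF H(1,3)])
  have cK: "cutting K x y" by (rule L_separated_cuttingI[OF K(1)]) (use K(3) cut_commute in blast)
  have fin: "finite H" "finite K" using cutting_card(1) cH cK by blast+
  have "H \<noteq> {}" using False by auto
  then obtain h where h: "h \<in> H" "\<forall>k\<in>H - {h}. before x k h" using last_curtain[OF fin(1) _ cH] by blast
  have "card (H - {h}) = card H - 1" using fin h by simp
  then have "card (H - {h}) \<noteq> 0" using False by linarith
  then have ne: "H - {h} \<noteq> {}" by force
  obtain h2 where h2: "h2 \<in> H - {h}" "\<forall>k\<in>H - {h} - {h2}. before x k h2"
    using last_curtain[OF _ ne cutting_subset[OF cH]] fin by blast
  define H' where "H' = H - {h} - {h2}"
  have cH': "card H' = card H - 2" unfolding H'_def using fin h h2 by simp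
  define K0 where "K0 = {k \<in> K. k \<inter> h \<noteq> {} \<and> k \<inter> h2 \<noteq> {}}"
  have "L_separated L h h2" using H(1) h(1) h2(1) unfolding pairwise_def by blast
  then have K0: "card K0 \<le> L"
    by (rule L_separated_cutting[OF _ cutting_subset[OF cK]]) (auto simp: K0_def)
  have cross: "L_separated L h' k" if h': "h' \<in> H'" and k: "k \<in> K - K0" for h' k
  proof -
    have kK: "k \<in> K" and h'H: "h' \<in> H" "h' \<noteq> h" "h' \<noteq> h2" using that by (auto simp: H'_def)
    have "k \<inter> h = {} \<or> k \<inter> h2 = {}" using k by (auto simp: K0_def)
    then obtain m where m: "m \<in> H" "m \<noteq> h'" "before x h' m" "k \<inter> m = {}"
    proof
      assume "k \<inter> h = {}"
      then show thesis using that[of h] h h'H by auto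
    next
      assume "k \<inter> h2 = {}"
      then show thesis using that[of h2] h2 h'H by auto
    qed
    have mc: "cut m x z" "cut m x y" using H m by auto
    have "before y m h'"
      by (rule before_swap[OF _ _ mc(2) m(3)]) (use cuttingD[OF cH] m h'H(1) in auto)
    moreover have "cut m x v" if v: "v \<in> k" for v
    proof -
      have nm: "y \<notin> m" using mc cut_notin by blast
      have "z \<in> side m y" "y \<in> side m y"
        using cut_third[OF mc(2), of z] mc cut_notin cut_commute not_cut_refl unfolding side_def by blast+
      then have "side m y \<inter> k \<noteq> {}"
        using connected_meets_curtain[OF connected_side(1)[OF cut_is_curtain[OF mc(1)] nm]] K(2)[OF kK] by blast
      then obtain v0 where v0: "v0 \<in> k" "v0 \<notin> m" "\<not> cut m y v0" by (auto simp: side_def)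
      then have "cut m x v0" using cut_third[OF mc(2)] cut_commute by blast
      then show ?thesis
        using cut_connected_cong[OF curtain_connected[OF cut_is_curtain[OF K(2)[OF kK]]] m(4) v0(1) v] by blast
    qed
    moreover have "L_separated L h' m" using H(1) m(1,2) h'H(1) unfolding pairwise_def by blast
    ultimately show ?thesis using L_separated_beyond[OF _ mc(2)] unfolding before_def by blast
  qed
  have disj: "H' \<inter> (K - K0) = {}"
  proof -
    have "k \<noteq> {}" if "k \<in> K" for k using curtain_nonempty[OF cut_is_curtain[OF K(2)[OF that]]] .
    moreover have "h' \<inter> k = {}" if "h' \<in> H'" "k \<in> K - K0" for h' k
      using cross[OF that] by (simp add: L_separated_def)
    ultimately show ?thesis by blast
  qed
  have "card (H' \<union> (K - K0)) \<le> sepnum L x y y"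
  proof (rule sepnum_ge)
    have K': "cut k x y" if "k \<in> K" for k using K(3)[OF that] cut_commute by blast
    show "cut u x y" if "u \<in> H' \<union> (K - K0)" for u using that H(3) K' by (auto simp: H'_def)
    then show "cut u x y" if "u \<in> H' \<union> (K - K0)" for u using that .
    have "L_separated L u v" if u: "u \<in> H' \<union> (K - K0)" and v: "v \<in> H' \<union> (K - K0)" and "u \<noteq> v" for u v
    proof -
      consider "u \<in> H" "v \<in> H" | "u \<in> K" "v \<in> K" | "u \<in> H'" "v \<in> K - K0" | "v \<in> H'" "u \<in> K - K0"
        using u v unfolding H'_def by blast
      then show ?thesis
      proof cases
        case 1
        then show ?thesis using pairwiseD[OF H(1)] \<open>u \<noteq> v\<close> by blast
      next
        case 2
        then show ?thesis using pairwiseD[OF K(1)] \<open>u \<noteq> v\<close> by blast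
      next
        case 3
        then show ?thesis by (rule cross)
      next
        case 4
        then have "L_separated L v u" by (rule cross)
        then show ?thesis by (simp add: L_separated_commute)
      qed
    qed
    then show "pairwise (L_separated L) (H' \<union> (K - K0))" unfolding pairwise_def by blast
  qed
  moreover have "card (H' \<union> (K - K0)) = card H' + card (K - K0)"
    using disj fin by (intro card_Un_disjoint) (auto simp: H'_def)
  moreover have "card (K - K0) = card K - card K0" using fin by (intro card_Diff_subset) (auto simp: K0_def)
  ultimately show ?thesis using K0 cH' False by linarith
qed

text \<open>
  Take maximal families for \<open>b, x\<close> and for \<open>b, y\<close>. Their curtains that do not separate \<open>b\<close> from both \<open>x\<close> and
  \<open>y\<close> separate \<open>x\<close> from \<open>{b, y}\<close> or \<open>y\<close> from \<open>{b, x}\<close>, and these glue.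
\<close>
lemma sepnum_gromov_upper:
  fixes b x y :: "'a::cat0_space"
  shows "sepnum L b x x + sepnum L b y y \<le> sepnum L x y y + 2 * sepnum L b x y + L + 4"
proof -
  obtain H where H: "pairwise (L_separated L) H" "\<And>h. h \<in> H \<Longrightarrow> cut h b x" "card H = sepnum L b x x"
    using sepnum_attained[of L b x x] by metis
  obtain K where K: "pairwise (L_separated L) K" "\<And>h. h \<in> K \<Longrightarrow> cut h b y" "card K = sepnum L b y y"
    using sepnum_attained[of L b y y] by metis
  have "card {h \<in> H. cut h b y} \<le> sepnum L b x y" "card {h \<in> K. cut h b x} \<le> sepnum L b x y"
    by (intro sepnum_ge pairwise_subset[OF H(1)] pairwise_subset[OF K(1)]; use H K in auto)+
  moreover have "card {h \<in> H. cut h y x} + card {h \<in> K. cut h x y} \<le> sepnum L x y y + L + 2"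
  proof (rule sepnum_glue[where z = b])
    show "pairwise (L_separated L) {h \<in> H. cut h y x}" by (rule pairwise_subset[OF H(1)]) auto
    show "pairwise (L_separated L) {h \<in> K. cut h x y}" by (rule pairwise_subset[OF K(1)]) auto
  qed (use H(2) K(2) cut_commute in blast)+
  ultimately show ?thesis
    using cutting_split[OF L_separated_cuttingI[OF H(1,2)], of y]
      cutting_split[OF L_separated_cuttingI[OF K(1,2)], of x] H(3) K(3) by linarith
qed

text \<open>
  A maximal family that separates \<open>b\<close> from \<open>{x, y}\<close> glues with each of the two parts into which \<open>b\<close> splits a
  maximal family for \<open>x, y\<close>.
\<close>
lemma sepnum_gromov_lower:
  fixes b x y :: "'a::cat0_space"
  shows "sepnum L x y y + 2 * sepnum L b x y \<le> sepnum L b x x + sepnum L b y y + 2 * L + 5"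
proof -
  obtain C where C: "pairwise (L_separated L) C" "\<And>h. h \<in> C \<Longrightarrow> cut h b x" "\<And>h. h \<in> C \<Longrightarrow> cut h b y"
    "card C = sepnum L b x y"
    using sepnum_attained[of L b x y] by metis
  obtain E where E: "pairwise (L_separated L) E" "\<And>h. h \<in> E \<Longrightarrow> cut h x y" "card E = sepnum L x y y"
    using sepnum_attained[of L x y y] by metis
  have "card C + card {h \<in> E. cut h x b} \<le> sepnum L b x x + L + 2"
    by (rule sepnum_glue[OF C(1,3,2), where K = "{h \<in> E. cut h x b}"])
      (use E in \<open>auto intro: pairwise_subset\<close>)
  moreover have "card C + card {h \<in> E. cut h b y} \<le> sepnum L b y y + L + 2"
    by (rule sepnum_glue[OF C(1,2,3), where K = "{h \<in> E. cut h b y}"])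
      (use E cut_commute in \<open>auto intro: pairwise_subset\<close>)
  ultimately show ?thesis
    using cutting_split[OF L_separated_cuttingI[OF E(1,2)], of b] C(4) E(3) by linarith
qed

subsection \<open>Hyperbolicity\<close>

text \<open>
  The four points lie in the four quadrants that \<open>h\<close> and \<open>k\<close> would form: \<open>h\<close> has points on both sides of \<open>k\<close>.
\<close>
lemma crossing_curtains_meet:
  fixes h k :: "'a::cat0_space set"
  assumes h: "cut h b x" "cut h z y" and k: "cut k b z" "cut k b y" "cut k x y"
  shows "h \<inter> k \<noteq> {}"
proof
  assume dis: "h \<inter> k = {}"
  have nin: "b \<notin> k" "z \<notin> k" "x \<notin> k" "y \<notin> k" using k cut_notin by blast+
  have con: "connected (side k b)" "connected (side k z)"
    using connected_side cut_is_curtain[OF k(1)] nin by blast+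
  have "\<not> cut k b x" using cut_third[OF k(2), of x] nin k(3) by blast
  then have "side k b \<inter> h \<noteq> {}"
    using connected_meets_curtain[OF con(1) _ _ h(1)] nin not_cut_refl by (auto simp: side_def)
  then obtain u where u: "u \<in> h" "u \<notin> k" "\<not> cut k b u" by (auto simp: side_def)
  have "\<not> cut k z y" using cut_third[OF k(2), of z] nin k(1) by blast
  then have "side k z \<inter> h \<noteq> {}"
    using connected_meets_curtain[OF con(2) _ _ h(2)] nin not_cut_refl by (auto simp: side_def)
  then obtain v where v: "v \<in> h" "v \<notin> k" "\<not> cut k z v" by (auto simp: side_def)
  have "cut k u z" using cut_third[OF k(1) u(2)] u(3) by blast
  then have "cut k u v" using cut_third[of k u z v] v cut_commute by blast
  then show False
    using connected_meets_curtain[OF curtain_connected[OF cut_is_curtain[OF h(1)]] u(1) v(1)] dis by blast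
qed

text \<open>
  Curtains that separate \<open>{b, z}\<close> from \<open>{x, y}\<close> meet all curtains that separate
  \<open>{b, x}\<close> from \<open>{y, z}\<close>, and two \<open>L\<close>-separated curtains meet at most \<open>L\<close> disjoint ones in common. So
  the two kinds cannot both be numerous, not even for different values of \<open>L\<close>. This uniformity in \<open>L\<close>
  is what makes the weighted sum of the metrics hyperbolic.
\<close>
lemma sepnum_hyperbolic:
  fixes b x y z :: "'a::cat0_space"
  shows "(\<forall>L. sepnum L b x y \<le> sepnum L b x z + L + 2) \<or> (\<forall>L. sepnum L b y z \<le> sepnum L b x z + L + 2)"
proof (rule ccontr)
  assume "\<not> ?thesis"
  then obtain L1 L2 where "sepnum L1 b x z + L1 + 2 < sepnum L1 b x y" "sepnum L2 b x z + L2 + 2 < sepnum L2 b y z"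
    by (auto simp: not_le)
  then have L12: "sepnum L1 b x z + (L1 + 2) + 1 \<le> sepnum L1 b x y" "sepnum L2 b z x + (L2 + 2) + 1 \<le> sepnum L2 b z y"
    by (auto simp: sepnum_commute)
  obtain P where P: "pairwise (L_separated L1) P" "L1 + 2 \<le> card P" "finite P"
    "\<And>h. h \<in> P \<Longrightarrow> cut h b x \<and> cut h b y \<and> cut h z x \<and> cut h z y"
    using sepnum_surplus[OF L12(1)] by metis
  obtain Q where Q: "pairwise (L_separated L2) Q" "L2 + 2 \<le> card Q" "finite Q"
    "\<And>h. h \<in> Q \<Longrightarrow> cut h b z \<and> cut h b y \<and> cut h x z \<and> cut h x y"
    using sepnum_surplus[OF L12(2)] by metis
  have meet: "h \<inter> k \<noteq> {}" if "h \<in> P" "k \<in> Q" for h k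
    using crossing_curtains_meet[of h b x z y k] P(4)[OF that(1)] Q(4)[OF that(2)] by blast
  have two: "\<exists>h k. h \<in> S \<and> k \<in> S \<and> h \<noteq> k" if card: "2 \<le> card S" for S :: "'a set set"
  proof -
    obtain T where "T \<subseteq> S" "card T = 2" using obtain_subset_with_card_n[OF card] by metis
    then show ?thesis by (auto simp: card_2_iff)
  qed
  have cP: "cutting P b x" by (rule L_separated_cuttingI[OF P(1)]) (use P(4) in blast)
  have cQ: "cutting Q b z" by (rule L_separated_cuttingI[OF Q(1)]) (use Q(4) in blast)
  show False
  proof (cases "L1 \<le> L2")
    case True
    obtain h k where hk: "h \<in> P" "k \<in> P" "h \<noteq> k" using two[of P] P(2) by auto
    then have "L_separated L1 h k" using P(1) unfolding pairwise_def by blast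
    then have "card Q \<le> L1" by (rule L_separated_cutting[OF _ cQ]) (use meet hk in blast)
    then show False using True Q(2) by linarith
  next
    case False
    obtain h k where hk: "h \<in> Q" "k \<in> Q" "h \<noteq> k" using two[of Q] Q(2) by auto
    then have "L_separated L2 h k" using Q(1) unfolding pairwise_def by blast
    then have "card P \<le> L2" by (rule L_separated_cutting[OF _ cP]) (use meet hk in blast)
    then show False using False P(2) by linarith
  qed
qed

subsection \<open>Geodesics of the CAT(0) metric are rough geodesics\<close>

text \<open>
  Curtains that separate \<open>q \<in> [b,x]\<close> from both ends are crossed on the way out and on the way back. The two
  nearest to \<open>b\<close> overlap along the stretch of \<open>[b,x]\<close> between two crossings of the second one, so this stretch is
  short; all the others are crossed in it.
\<close>
lemma separated_from_both_ends:
  fixes b x :: "'a::cat0_space"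
  assumes s: "0 \<le> s" "s \<le> dist b x" and Pw: "pairwise (L_separated L) P"
    and Pc: "\<And>h. h \<in> P \<Longrightarrow> cut h b (geo b x s) \<and> cut h x (geo b x s)"
  shows "card P \<le> L + 3"
proof (rule ccontr)
  assume neg: "\<not> card P \<le> L + 3"
  define q where "q = geo b x s"
  have "cutting P b q" by (rule L_separated_cuttingI[OF Pw]) (use Pc in \<open>auto simp: q_def\<close>)
  then have P: "pairwise (L_separated L) P" "L + 4 \<le> card P" "finite P"
    "\<And>h. h \<in> P \<Longrightarrow> cut h b q \<and> cut h x q"
    using Pw Pc neg cutting_card(1) by (auto simp: q_def)
  have cP: "cutting P q b" by (rule L_separated_cuttingI[OF P(1)]) (use P(4) cut_commute in blast)
  have "P \<noteq> {}" using P(2) by auto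
  then obtain h1 where h1: "h1 \<in> P" "\<forall>k\<in>P - {h1}. before q k h1" using last_curtain[OF P(3) _ cP] by blast
  have "card (P - {h1}) = card P - 1" using P(3) h1 by simp
  then have "card (P - {h1}) \<noteq> 0" using P(2) by linarith
  then have ne: "P - {h1} \<noteq> {}" by force
  obtain h2 where h2: "h2 \<in> P - {h1}" "\<forall>k\<in>P - {h1} - {h2}. before q k h2"
    using last_curtain[OF _ ne cutting_subset[OF cP]] P(3) by blast
  define P' where "P' = P - {h1} - {h2}"
  have cP': "card P' = card P - 2" unfolding P'_def using P(3) h1 h2 by simp
  have c1: "cut h1 b q" "cut h1 x q" and c2: "cut h2 b q" "cut h2 x q" using P(4) h1 h2 by auto
  have c2': "cut h2 q x" using c2(2) cut_commute by blast
  obtain u1 where u1: "u1 \<in> {0..s}" "geo b x u1 \<in> h2"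
    using meets_geo[of h2 b x 0 s] c2 s by (auto simp: q_def)
  obtain u2 where u2: "u2 \<in> {s..dist b x}" "geo b x u2 \<in> h2"
    using meets_geo[of h2 b x s "dist b x"] c2' s by (auto simp: q_def)
  have "before b h1 h2"
    by (rule before_swap[of h2 h1 q]) (use cuttingD[OF cP] h1 h2 in auto)
  then have o: "cut h1 b (geo b x u1)" "cut h1 b (geo b x u2)" using u1 u2 by (auto simp: before_def)
  have "\<not> cut h1 b x" using cut_third[OF c1(1), of x] c1 cut_notin by blast
  then have "cut h1 (geo b x u2) x" using cut_third[OF o(2), of x] c1 cut_notin cut_commute by blast
  then obtain t2 where t2: "t2 \<in> {u2..dist b x}" "geo b x t2 \<in> h1"
    using meets_geo[of h1 b x u2 "dist b x"] u2 s by auto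
  obtain t1 where t1: "t1 \<in> {0..u1}" "geo b x t1 \<in> h1"
    using meets_geo[of h1 b x 0 u1] o(1) u1 s by auto
  interpret closed_geodesic "{0..dist b x}" "geo b x"
    by unfold_locales (auto simp: geodesic_on_geo)
  have "L_separated L h1 h2" using P(1) h1 h2 unfolding pairwise_def by blast
  then have "u2 - u1 \<le> real L + 1"
    by (rule L_separated_overlap[of L h1 h2 u1 u2 b x "geo b x t1" "geo b x t2" "geo b x u1" "geo b x u2"])
      (use curtain_connected cut_is_curtain[OF c1(1)] cut_is_curtain[OF c2(1)] u1 u2 t1 t2 s in auto)
  moreover have "cutting P' q (geo b x u1)"
    by (rule L_separated_cuttingI[OF pairwise_subset[OF P(1)]])
      (use h2(2) u1 in \<open>auto simp: P'_def before_def\<close>)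
  then have "real (card P') \<le> dist q (geo b x u1)" by (rule cutting_card(2))
  moreover have "dist q (geo b x u1) = s - u1" unfolding q_def using dist_geo[of s b x u1] u1 s by auto
  ultimately have "real (card P') \<le> real L + 1" using u2 by auto
  then show False using cP' P(2) by linarith
qed

lemma sepnum_on_geodesic:
  fixes b x :: "'a::cat0_space"
  assumes s: "0 \<le> s" "s \<le> dist b x"
  defines "q \<equiv> geo b x s"
  shows "sepnum L b q q \<le> sepnum L b q x + L + 4"
proof (rule ccontr)
  assume "\<not> ?thesis"
  then have "sepnum L b q x + (L + 4) + 1 \<le> sepnum L b q q" by simp
  then obtain P where "pairwise (L_separated L) P" "L + 4 \<le> card P"
    "\<And>h. h \<in> P \<Longrightarrow> cut h b q \<and> cut h b q \<and> cut h x q \<and> cut h x q"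
    using sepnum_surplus by metis
  then show False using separated_from_both_ends[OF s, of L P] by (auto simp: q_def)
qed

subsection \<open>Invariance under isometries\<close>

context
  fixes g :: "'a::cat0_space \<Rightarrow> 'a"
  assumes g: "g \<in> isometries"
begin

lemma isometry_bij: "bij g" and isometry_dist: "dist (g x) (g y) = dist x y"
  using g by (auto simp: isometries_def)

lemma isometry_inv: "inv g \<in> isometries"
  unfolding isometries_def using isometry_bij isometry_dist
  by (auto simp: bij_imp_bij_inv) (metis bij_inv_eq_iff)

lemma isometry_geodesic: "geodesic_on I \<alpha> \<Longrightarrow> geodesic_on I (g \<circ> \<alpha>)"
  by (simp add: geodesic_on_def isometry_dist)

lemma isometry_coord:
  assumes "closed_geodesic I \<alpha>"
  shows "coord I (g \<circ> \<alpha>) (g x) = coord I \<alpha> x"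
proof -
  interpret closed_geodesic I \<alpha> by (rule assms)
  interpret G: closed_geodesic I "g \<circ> \<alpha>"
    by unfold_locales (use isometry_geodesic geodesic closed nonempty in auto)
  show ?thesis by (rule G.coord_unique) (auto simp: isometry_dist coord_mem coord_min)
qed

lemma isometry_curtain_data:
  assumes d: "curtain_data I \<alpha> r"
  shows "curtain_data I (g \<circ> \<alpha>) r"
    and "dual_curtain I (g \<circ> \<alpha>) r = g ` dual_curtain I \<alpha> r"
    and "neg_halfspace I (g \<circ> \<alpha>) r = g ` neg_halfspace I \<alpha> r"
    and "pos_halfspace I (g \<circ> \<alpha>) r = g ` pos_halfspace I \<alpha> r"
proof -
  show d': "curtain_data I (g \<circ> \<alpha>) r" using d isometry_geodesic by (simp add: curtain_data_def)
  note c = isometry_coord[OF curtain_data_closed_geodesic[OF d]]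
  have img: "{x. P (coord I (g \<circ> \<alpha>) x)} = g ` {x. P (coord I \<alpha> x)}" for P
  proof
    show "{x. P (coord I (g \<circ> \<alpha>) x)} \<subseteq> g ` {x. P (coord I \<alpha> x)}"
    proof
      fix x assume "x \<in> {x. P (coord I (g \<circ> \<alpha>) x)}"
      moreover obtain x' where "x = g x'" using isometry_bij by (metis bij_pointE)
      ultimately show "x \<in> g ` {x. P (coord I \<alpha> x)}" using c by auto
    qed
  qed (use c in auto)
  show "dual_curtain I (g \<circ> \<alpha>) r = g ` dual_curtain I \<alpha> r"
    using img[of "\<lambda>t. t \<in> {r - 1/2..r + 1/2}"]
    unfolding curtain_data_vimage(1)[OF d] curtain_data_vimage(1)[OF d'] vimage_def .
  show "neg_halfspace I (g \<circ> \<alpha>) r = g ` neg_halfspace I \<alpha> r"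
    unfolding curtain_data_vimage(2)[OF d] curtain_data_vimage(2)[OF d'] by (rule img)
  show "pos_halfspace I (g \<circ> \<alpha>) r = g ` pos_halfspace I \<alpha> r"
    unfolding curtain_data_vimage(3)[OF d] curtain_data_vimage(3)[OF d'] by (rule img)
qed

lemma isometry_is_curtain: "is_curtain h \<Longrightarrow> is_curtain (g ` h)"
  unfolding is_curtain_def using isometry_curtain_data by metis

lemma isometry_separates:
  assumes "separates h A B"
  shows "separates (g ` h) (g ` A) (g ` B)"
proof -
  obtain I \<alpha> r where d: "curtain_data I \<alpha> r" "h = dual_curtain I \<alpha> r"
    and "A \<subseteq> neg_halfspace I \<alpha> r \<and> B \<subseteq> pos_halfspace I \<alpha> r \<or>
         B \<subseteq> neg_halfspace I \<alpha> r \<and> A \<subseteq> pos_halfspace I \<alpha> r"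
    using assms unfolding separates_def by blast
  then have "g ` A \<subseteq> neg_halfspace I (g \<circ> \<alpha>) r \<and> g ` B \<subseteq> pos_halfspace I (g \<circ> \<alpha>) r \<or>
         g ` B \<subseteq> neg_halfspace I (g \<circ> \<alpha>) r \<and> g ` A \<subseteq> pos_halfspace I (g \<circ> \<alpha>) r"
    unfolding isometry_curtain_data[OF d(1)] by (auto intro: image_mono)
  then show ?thesis using isometry_curtain_data(1,2)[OF d(1)] d(2) unfolding separates_def by metis
qed

lemma isometry_is_chain: "is_chain c \<Longrightarrow> is_chain ((`) g ` c)"
proof -
  assume "is_chain c"
  then obtain J :: "int set" and h where J: "\<forall>i\<in>J. \<forall>k\<in>J. {i..k} \<subseteq> J" "c = h ` J" "\<forall>i\<in>J. is_curtain (h i)"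
    "disjoint_family_on h J" "\<forall>i. i - 1 \<in> J \<and> i + 1 \<in> J \<longrightarrow> separates (h i) (h (i - 1)) (h (i + 1))"
    unfolding is_chain_def by blast
  have "disjoint_family_on (\<lambda>i. g ` h i) J"
    using J(4) isometry_bij unfolding disjoint_family_on_def
    by (metis bij_is_inj image_Int image_empty)
  then show ?thesis
    unfolding is_chain_def
    by (intro exI[of _ J] exI[of _ "\<lambda>i. g ` h i"])
      (use J isometry_is_curtain isometry_separates in \<open>auto simp: image_image\<close>)
qed

end

text \<open>
  Chains that meet the images of \<open>h\<close> and \<open>k\<close> are pulled back by the inverse isometry.
\<close>
lemma isometry_L_separated:
  fixes g :: "'a::cat0_space \<Rightarrow> 'a"
  assumes g: "g \<in> isometries" and L: "L_separated L h k"
  shows "L_separated L (g ` h) (g ` k)"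
proof -
  have inj: "inj g" and bij: "bij g" using isometry_bij[OF g] by (auto simp: bij_is_inj)
  have inv: "inv g ` g ` S = S" for S by (simp add: inj image_inv_f_f)
  have inji: "inj (inv g)" using bij by (simp add: bij_imp_bij_inv bij_is_inj)
  have "(g ` h) \<inter> (g ` k) = {}" using L inj unfolding L_separated_def by (metis image_Int image_empty)
  moreover have "finite c \<and> card c \<le> L"
    if c: "is_chain c" "\<forall>e\<in>c. e \<inter> g ` h \<noteq> {} \<and> e \<inter> g ` k \<noteq> {}" for c
  proof -
    let ?c = "(`) (inv g) ` c"
    have "is_chain ?c" by (rule isometry_is_chain[OF isometry_inv[OF g] c(1)])
    moreover have "e \<inter> h \<noteq> {} \<and> e \<inter> k \<noteq> {}" if "e \<in> ?c" for e
    proof -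
      obtain e' where e': "e' \<in> c" "e = inv g ` e'" using \<open>e \<in> ?c\<close> by blast
      have meets: "e \<inter> S \<noteq> {}" if S: "e' \<inter> g ` S \<noteq> {}" for S
      proof -
        obtain u where u: "u \<in> S" "g u \<in> e'" using S by blast
        then have "inv g (g u) \<in> e" using e'(2) by blast
        then show ?thesis using u(1) inj by auto
      qed
      have "e' \<inter> g ` h \<noteq> {}" "e' \<inter> g ` k \<noteq> {}" using c(2) e'(1) by auto
      then show ?thesis using meets by simp
    qed
    ultimately have "finite ?c \<and> card ?c \<le> L" using L unfolding L_separated_def by blast
    moreover have "inj_on ((`) (inv g)) c" by (rule inj_onI) (simp add: inj_image_eq_iff[OF inji])
    ultimately show ?thesis by (simp add: card_image finite_image_iff)
  qed
  ultimately show ?thesis unfolding L_separated_def by blast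
qed

lemma isometry_sepnum_le:
  fixes g :: "'a::cat0_space \<Rightarrow> 'a"
  assumes g: "g \<in> isometries"
  shows "sepnum L b x y \<le> sepnum L (g b) (g x) (g y)"
proof -
  obtain H where H: "pairwise (L_separated L) H" "\<And>h. h \<in> H \<Longrightarrow> cut h b x" "\<And>h. h \<in> H \<Longrightarrow> cut h b y"
    "card H = sepnum L b x y"
    using sepnum_attained[of L b x y] by metis
  have c: "cut (g ` h) (g u) (g v)" if "cut h u v" for h u v
    using isometry_separates[OF g, of h "{u}" "{v}"] that unfolding cut_def by simp
  have "inj_on ((`) g) H" 
    by (rule inj_onI) (simp add: inj_image_eq_iff[OF bij_is_inj[OF isometry_bij[OF g]]])
  then have "card ((`) g ` H) = card H" by (rule card_image)
  moreover have "card ((`) g ` H) \<le> sepnum L (g b) (g x) (g y)"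
  proof (rule sepnum_ge)
    show "pairwise (L_separated L) ((`) g ` H)"
      using H(1) isometry_L_separated[OF g] unfolding pairwise_def by blast
  qed (use H c in auto)
  ultimately show ?thesis using H(4) by simp
qed

lemma isometry_d_L:
  fixes g :: "'a::cat0_space \<Rightarrow> 'a"
  assumes g: "g \<in> isometries"
  shows "d_L L (g x) (g y) = d_L L x y"
proof -
  have b: "bij g" by (rule isometry_bij[OF g])
  then have i: "inv g (g z) = z" for z by (simp add: bij_is_inj)
  have "sepnum L (g x) (g y) (g y) \<le> sepnum L x y y"
    using isometry_sepnum_le[OF isometry_inv[OF g], of L "g x" "g y" "g y"] by (simp add: i)
  then have "sepnum L (g x) (g y) (g y) = sepnum L x y y"
    using isometry_sepnum_le[OF g, of L x y y] by simp
  moreover have "g x = g y \<longleftrightarrow> x = y" using b by (simp add: bij_is_inj inj_eq)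
  ultimately show ?thesis by (simp add: d_L_eq_sepnum)
qed

section \<open>The weighted sum over all L\<close>

locale curtain_model =
  fixes lam :: "nat \<Rightarrow> real" and b :: "'a::cat0_space"
  assumes weights: "curtain_weights lam"
    and proper: "\<And>(x::'a) r. compact (cball x r)"
begin

definition wsum :: "(nat \<Rightarrow> real) \<Rightarrow> real" where
  "wsum f = (\<Sum>n. lam (Suc n) * f (Suc n))"

definition Lam :: real where
  "Lam = (\<Sum>n. real (Suc n) ^ 2 * lam (Suc n))"

text \<open>
  The terms of a weighted sum may grow like \<open>L\<^sup>2\<close>, since \<open>\<Sum> L\<^sup>2 \<lambda>\<^sub>L\<close> converges. Every error term below is
  absorbed into a multiple of \<open>L\<^sup>2\<close> and so contributes a multiple of that sum.
\<close>
definition admissible :: "(nat \<Rightarrow> real) \<Rightarrow> bool" where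
  "admissible f \<longleftrightarrow> (\<exists>B. \<forall>L\<ge>1. \<bar>f L\<bar> \<le> B * real L ^ 2)"

lemma lam_pos: "0 < lam (Suc n)"
  using weights by (simp add: curtain_weights_def)

lemma sumLam: "summable (\<lambda>n. real (Suc n) ^ 2 * lam (Suc n))"
  using weights by (simp add: curtain_weights_def)

lemma Lam_pos: "0 < Lam"
  unfolding Lam_def by (rule suminf_pos[OF sumLam]) (simp add: lam_pos)

lemma summable_wsum: "admissible f \<Longrightarrow> summable (\<lambda>n. lam (Suc n) * f (Suc n))"
proof -
  assume "admissible f"
  then obtain B where B: "\<And>L. L \<ge> 1 \<Longrightarrow> \<bar>f L\<bar> \<le> B * real L ^ 2" by (auto simp: admissible_def)
  show ?thesis
  proof (rule summable_comparison_test'[OF summable_mult[OF sumLam, of B], of 0])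
    fix n :: nat
    have "norm (lam (Suc n) * f (Suc n)) = lam (Suc n) * \<bar>f (Suc n)\<bar>"
      using lam_pos[of n] by (simp add: abs_mult)
    also have "\<dots> \<le> lam (Suc n) * (B * real (Suc n) ^ 2)"
      using lam_pos[of n] B[of "Suc n"] by (intro mult_left_mono) auto
    finally show "norm (lam (Suc n) * f (Suc n)) \<le> B * (real (Suc n) ^ 2 * lam (Suc n))"
      by (simp add: mult_ac)
  qed
qed

lemma admissible_bounded:
  assumes "\<And>L. \<bar>f L\<bar> \<le> B"
  shows "admissible f"
proof -
  have B: "0 \<le> B" using assms[of 0] by linarith
  have "\<bar>f L\<bar> \<le> B * real L ^ 2" if "L \<ge> 1" for L
  proof -
    have "\<bar>f L\<bar> \<le> B * 1" using assms by simp
    also have "\<dots> \<le> B * real L ^ 2" using that B by (intro mult_left_mono) auto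
    finally show ?thesis .
  qed
  then show ?thesis unfolding admissible_def by blast
qed

lemma admissible_add:
  assumes "admissible f" "admissible g"
  shows "admissible (\<lambda>L. f L + g L)"
proof -
  obtain B C where "\<And>L. L \<ge> 1 \<Longrightarrow> \<bar>f L\<bar> \<le> B * real L ^ 2" "\<And>L. L \<ge> 1 \<Longrightarrow> \<bar>g L\<bar> \<le> C * real L ^ 2"
    using assms by (auto simp: admissible_def)
  then have "\<bar>f L + g L\<bar> \<le> (B + C) * real L ^ 2" if "L \<ge> 1" for L
    using that abs_triangle_ineq[of "f L" "g L"] by (smt (verit) distrib_right)
  then show ?thesis unfolding admissible_def by blast
qed

lemma wsum_add: "\<lbrakk>admissible f; admissible g\<rbrakk> \<Longrightarrow> wsum (\<lambda>L. f L + g L) = wsum f + wsum g"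
  unfolding wsum_def by (simp add: distrib_left suminf_add[OF summable_wsum summable_wsum])

lemma wsum_le:
  assumes f: "admissible f" and g: "admissible g"
    and le: "\<And>L. 1 \<le> L \<Longrightarrow> f L \<le> g L + c * real L ^ 2"
  shows "wsum f \<le> wsum g + c * Lam"
proof -
  have adm: "admissible (\<lambda>L. c * real L ^ 2)"
    unfolding admissible_def by (intro exI[of _ "\<bar>c\<bar>"]) (auto simp: abs_mult)
  have "wsum f \<le> wsum (\<lambda>L. g L + c * real L ^ 2)"
    unfolding wsum_def
    by (intro suminf_le summable_wsum admissible_add f g adm mult_left_mono le)
      (use lam_pos in \<open>auto intro: less_imp_le\<close>)
  also have "\<dots> = wsum g + wsum (\<lambda>L. c * real L ^ 2)" by (rule wsum_add[OF g adm])
  also have "wsum (\<lambda>L. c * real L ^ 2) = c * Lam"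
    unfolding wsum_def Lam_def using suminf_mult[OF sumLam, of c] by (simp add: mult_ac)
  finally show ?thesis .
qed

abbreviation D :: "'a \<Rightarrow> 'a \<Rightarrow> real" where
  "D \<equiv> curtain_dist lam"

text \<open>
  The Gromov product of the curtain model up to a bounded error.
\<close>
definition sep :: "'a \<Rightarrow> 'a \<Rightarrow> 'a \<Rightarrow> real" where
  "sep a x y = wsum (\<lambda>L. real (sepnum L a x y))"

lemma D_wsum: "D x y = wsum (\<lambda>L. real (d_L L x y))"
  by (simp add: curtain_dist_def wsum_def)

lemma admissible_sepnum: "admissible (\<lambda>L. real (sepnum L a x (y :: 'a)))"
  by (rule admissible_bounded[of _ "dist a x"]) (simp add: sepnum_le_dist)

lemma admissible_d_L: "admissible (\<lambda>L. real (d_L L x (y :: 'a)))"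
  by (rule admissible_bounded[of _ "1 + dist x y"]) (simp add: sepnum_le_dist d_L_eq_sepnum)

lemma square_ge:
  assumes "1 \<le> L"
  shows "real L \<le> real L ^ 2" "1 \<le> real L ^ 2"
  using assms self_le_power[of "real L" 2] one_le_power[of "real L" 2] by auto

lemma sep_le:
  assumes "\<And>L. 1 \<le> L \<Longrightarrow> real (sepnum L a x y) \<le> real (sepnum L a' x' y') + c * real L ^ 2"
  shows "sep a x y \<le> sep a' x' y' + c * Lam"
  unfolding sep_def by (rule wsum_le[OF admissible_sepnum admissible_sepnum assms])

text \<open>
  A strict inequality between weighted sums is visible at some single \<open>L\<close>, with room of order \<open>L\<^sup>2\<close>.
\<close>
lemma sep_gap:
  assumes "sep a' x' y' + c * Lam < sep a x y"
  obtains L where "1 \<le> L" "real (sepnum L a' x' y') + c * real L ^ 2 < real (sepnum L a x y)"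
  using sep_le[of a x y a' x' y' c] assms by (metis not_le)

lemma sep_self: "sep a a a = 0"
  by (simp add: sep_def wsum_def sepnum_self)

lemma sep_commute: "sep a x y = sep a y x"
  by (simp add: sep_def sepnum_commute)

lemma sep_le_left: "sep a x y \<le> sep a x x"
  using sep_le[of a x y a x x 0] sepnum_le_left[of _ a x y] by simp

lemma sep_le_dist: "sep a x y \<le> dist a x * Lam"
proof -
  have "sep a x y \<le> sep a a a + dist a x * Lam"
  proof (rule sep_le)
    fix L :: nat assume L: "1 \<le> L"
    have "real (sepnum L a x y) \<le> dist a x * 1" using sepnum_le_dist by simp
    also have "\<dots> \<le> dist a x * real L ^ 2" using square_ge(2)[OF L] by (intro mult_left_mono) auto
    finally show "real (sepnum L a x y) \<le> real (sepnum L a a a) + dist a x * real L ^ 2" by simp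
  qed
  then show ?thesis by (simp add: sep_self)
qed

lemma sep_perturb: "sep a x y \<le> sep a x' y + (dist x x' + 1) * Lam"
proof (rule sep_le)
  fix L :: nat assume L: "1 \<le> L"
  have "real (sepnum L a x y) \<le> real (sepnum L a x' y) + (dist x x' + 1) * 1"
    using sepnum_perturb[of L a x y x'] by simp
  also have "\<dots> \<le> real (sepnum L a x' y) + (dist x x' + 1) * real L ^ 2"
    using square_ge(2)[OF L] by (intro add_left_mono mult_left_mono) auto
  finally show "real (sepnum L a x y) \<le> real (sepnum L a x' y) + (dist x x' + 1) * real L ^ 2" .
qed

lemma sep_hyperbolic: "min (sep a x y) (sep a y z) \<le> sep a x z + 3 * Lam"
proof -
  have *: "real L + 2 \<le> 3 * real L ^ 2" if "1 \<le> L" for L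
    using square_ge[OF that] by linarith
  from sepnum_hyperbolic[of a x y z] show ?thesis
  proof
    assume h: "\<forall>L. sepnum L a x y \<le> sepnum L a x z + L + 2"
    have "sep a x y \<le> sep a x z + 3 * Lam"
    proof (rule sep_le)
      fix L :: nat assume "1 \<le> L"
      then show "real (sepnum L a x y) \<le> real (sepnum L a x z) + 3 * real L ^ 2"
        using h[rule_format, of L] *[of L] by linarith
    qed
    then show ?thesis by linarith
  next
    assume h: "\<forall>L. sepnum L a y z \<le> sepnum L a x z + L + 2"
    have "sep a y z \<le> sep a x z + 3 * Lam"
    proof (rule sep_le)
      fix L :: nat assume "1 \<le> L"
      then show "real (sepnum L a y z) \<le> real (sepnum L a x z) + 3 * real L ^ 2"
        using h[rule_format, of L] *[of L] by linarith
    qed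
    then show ?thesis by linarith
  qed
qed

lemma sep_on_geodesic:
  assumes "0 \<le> s" "s \<le> dist a x"
  shows "sep a (geo a x s) (geo a x s) \<le> sep a (geo a x s) x + 5 * Lam"
proof (rule sep_le)
  fix L :: nat assume L: "1 \<le> L"
  show "real (sepnum L a (geo a x s) (geo a x s)) \<le> real (sepnum L a (geo a x s) x) + 5 * real L ^ 2"
    using sepnum_on_geodesic[OF assms, of L] square_ge[OF L] by linarith
qed

lemma gromov_product_sep: "\<bar>gromov_product D a x y - sep a x y\<bar> \<le> 4 * Lam"
proof -
  let ?d = "\<lambda>x y L. real (d_L L x y)" and ?w = "\<lambda>L. real (sepnum L a x y)"
  have dm: "sepnum L u v v \<le> d_L L u v \<and> d_L L u v \<le> 1 + sepnum L u v v" for L and u v :: 'a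
    by (auto simp: d_L_eq_sepnum sepnum_self)
  have 2: "wsum (\<lambda>L. ?w L + ?w L) = 2 * sep a x y"
    unfolding wsum_add[OF admissible_sepnum admissible_sepnum] sep_def by simp
  have a1: "admissible (\<lambda>L. ?d a x L + ?d a y L)" by (intro admissible_add admissible_d_L)
  have a2: "admissible (\<lambda>L. ?d x y L + (?w L + ?w L))"
    by (intro admissible_add admissible_d_L admissible_sepnum)
  have s1: "wsum (\<lambda>L. ?d a x L + ?d a y L) = D a x + D a y"
    by (simp add: wsum_add admissible_d_L D_wsum)
  have s2: "wsum (\<lambda>L. ?d x y L + (?w L + ?w L)) = D x y + 2 * sep a x y"
    by (simp only: wsum_add admissible_d_L admissible_add admissible_sepnum D_wsum 2)
  have "D a x + D a y \<le> (D x y + 2 * sep a x y) + 7 * Lam"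
    unfolding s1[symmetric] s2[symmetric]
  proof (rule wsum_le[OF a1 a2])
    fix L :: nat assume L: "1 \<le> L"
    show "?d a x L + ?d a y L \<le> ?d x y L + (?w L + ?w L) + 7 * real L ^ 2"
      using sepnum_gromov_upper[of L a x y] dm[of L a x] dm[of L a y] dm[of L x y] square_ge[OF L] by linarith
  qed
  moreover have "D x y + 2 * sep a x y \<le> (D a x + D a y) + 8 * Lam"
    unfolding s1[symmetric] s2[symmetric]
  proof (rule wsum_le[OF a2 a1])
    fix L :: nat assume L: "1 \<le> L"
    show "?d x y L + (?w L + ?w L) \<le> ?d a x L + ?d a y L + 8 * real L ^ 2"
      using sepnum_gromov_lower[of L x y a] dm[of L a x] dm[of L a y] dm[of L x y] square_ge[OF L] by linarith
  qed
  ultimately have "\<bar>(D a x + D a y - D x y) - 2 * sep a x y\<bar> \<le> 8 * Lam" using Lam_pos by linarith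
  moreover have "gromov_product D a x y - sep a x y = ((D a x + D a y - D x y) - 2 * sep a x y) / 2"
    by (simp add: gromov_product_def field_simps)
  ultimately show ?thesis by (simp add: abs_divide)
qed

lemma D_sep: "sep x y y \<le> D x y" "D x y \<le> sep x y y + Lam"
proof -
  have dm: "sepnum L x y y \<le> d_L L x y \<and> d_L L x y \<le> 1 + sepnum L x y y" for L
    by (auto simp: d_L_eq_sepnum sepnum_self)
  have "sep x y y \<le> D x y + 0 * Lam"
    unfolding sep_def D_wsum by (rule wsum_le[OF admissible_sepnum admissible_d_L]) (use dm in auto)
  then show "sep x y y \<le> D x y" by simp
  have "D x y \<le> sep x y y + 1 * Lam"
    unfolding sep_def D_wsum
  proof (rule wsum_le[OF admissible_d_L admissible_sepnum])
    fix L :: nat assume L: "1 \<le> L"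
    show "real (d_L L x y) \<le> real (sepnum L x y y) + 1 * real L ^ 2" using dm[of L] square_ge[OF L] by linarith
  qed
  then show "D x y \<le> sep x y y + Lam" by simp
qed

lemma D_commute: "D x y = D y x"
  by (cases "x = y") (simp_all add: curtain_dist_def d_L_eq_sepnum sepnum_swap[of _ x y])

lemma D_triangle: "D x z \<le> D x y + D y z"
proof -
  have "D x z \<le> wsum (\<lambda>L. real (d_L L x y) + real (d_L L y z)) + 0 * Lam"
    unfolding D_wsum
  proof (rule wsum_le[OF admissible_d_L admissible_add[OF admissible_d_L admissible_d_L]])
    fix L :: nat
    show "real (d_L L x z) \<le> real (d_L L x y) + real (d_L L y z) + 0 * real L ^ 2"
      using sepnum_triangle[of L x z y] by (auto simp: d_L_eq_sepnum)
  qed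
  then show ?thesis by (simp add: wsum_add admissible_d_L D_wsum)
qed

lemma D_le_dist: "D x y \<le> (dist x y + 1) * Lam"
  using D_sep(2)[of x y] sep_le_dist[of x y y] by (simp add: algebra_simps)

lemma D_isometry: "g \<in> isometries \<Longrightarrow> D (g x) (g y) = D x y"
  by (simp add: curtain_dist_def isometry_d_L)

section \<open>From separation to fellow-travelling\<close>

text \<open>
  A large weighted sum forces a large term for some \<open>L\<close>: \<open>M L\<^sup>2\<close> curtains that are \<open>L\<close>-separated, since
  \<open>\<Sum> L\<^sup>2 \<lambda>\<^sub>L\<close> is finite. Thus \<open>[a,x]\<close> and \<open>[a,y]\<close> come within \<open>O(L)\<close> of each other at distance about \<open>M L\<^sup>2\<close> from
  \<open>a\<close>; the quotient is \<open>O(1/M)\<close>, whatever \<open>L\<close> is.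
\<close>
lemma fellow_travel:
  assumes M: "8 \<le> M" "M * Lam < sep a x y" and R: "0 \<le> R" "R \<le> M / 2"
  shows "dist (geo a x R) (geo a y R) \<le> 8 * R / M"
proof -
  have "sep a a a + M * Lam < sep a x y" using M by (simp add: sep_self)
  then obtain L where L: "1 \<le> L" "real (sepnum L a a a) + M * real L ^ 2 < real (sepnum L a x y)"
    by (rule sep_gap)
  then have big: "M * real L ^ 2 < real (sepnum L a x y)" by simp
  note sq = square_ge[OF L(1)]
  have M8: "8 * real L ^ 2 \<le> M * real L ^ 2" "M \<le> M * real L ^ 2" using M sq by (auto intro: mult_right_mono)
  obtain H where H: "pairwise (L_separated L) H" "\<And>h. h \<in> H \<Longrightarrow> cut h a x" "\<And>h. h \<in> H \<Longrightarrow> cut h a y"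
    "card H = sepnum L a x y"
    using sepnum_attained[of L a x y] by metis
  have "8 < real (card H)" using big M8 M H(4) by linarith
  then have "3 \<le> card H" by linarith
  then obtain m u where m: "0 \<le> m" "m \<le> dist a y" and u: "0 \<le> u" "u \<le> dist a x"
    and mu: "dist (geo a y m) (geo a x u) \<le> real L + 1" "real (card H) - 2 \<le> m"
    using bottleneck_chain[OF H(1) _ H(2,3)] by (auto simp: Bex_def)
  \<comment> \<open>The other half of \<open>M L\<^sup>2\<close> absorbs the losses \<open>2\<close> and \<open>L + 1\<close>.\<close>
  define l where "l = M * real L ^ 2 / 2"
  have "l + (real L + 1) \<le> m" using mu(2) big H(4) M8(1) sq unfolding l_def by linarith
  moreover have "0 < l" "R \<le> l" unfolding l_def using M8 M(1) R by linarith+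
  ultimately have "dist (geo a y R) (geo a x R) \<le> 2 * (real L + 1) * R / l"
    using geo_fan_close[OF m(2) u mu(1), of l R] R by simp
  also have "\<dots> \<le> 8 * R / M"
  proof -
    have "real L + 1 \<le> 2 * real L ^ 2" using sq by linarith
    then have "(real L + 1) * (R * M) \<le> (2 * real L ^ 2) * (R * M)"
      by (rule mult_right_mono) (use R M in auto)
    then show ?thesis using M L(1) unfolding l_def by (simp add: field_simps)
  qed
  finally show ?thesis by (simp add: dist_commute)
qed

text \<open>
  If \<open>p = geo a y t\<close> is separated from \<open>a\<close> less than \<open>{x, y}\<close> is, then at least \<open>L\<close> curtains separate \<open>{a, p}\<close> from
  \<open>{x, y}\<close> for some \<open>L\<close>. Then \<open>L \<le> d(a,x)\<close>, and \<open>[p,y]\<close> still comes within \<open>L + 1\<close> of \<open>[a,x]\<close>, which ends at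
  distance \<open>d(a,x)\<close>.
\<close>
lemma progress_along_geodesic:
  assumes t: "0 \<le> t" "t \<le> dist a y" and gap: "sep a (geo a y t) (geo a y t) + 5 * Lam < sep a x y"
  shows "t \<le> 2 * dist a x"
proof -
  let ?p = "geo a y t"
  obtain L where L: "1 \<le> L" "real (sepnum L a ?p ?p) + 5 * real L ^ 2 < real (sepnum L a x y)"
    using gap by (rule sep_gap)
  have "real (sepnum L a y ?p) \<le> real (sepnum L a ?p ?p)" by (simp add: sepnum_le_right)
  then have "real (sepnum L a y ?p) + real L + 3 \<le> real (sepnum L a x y)"
    using L(2) square_ge[OF L(1)] by linarith
  then have "real (sepnum L a y ?p + (L + 2) + 1) \<le> real (sepnum L a y x)"
    by (simp add: sepnum_commute[of L a x y])
  then have "sepnum L a y ?p + (L + 2) + 1 \<le> sepnum L a y x" by (simp only: of_nat_le_iff)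
  then obtain P where P: "pairwise (L_separated L) P" "L + 2 \<le> card P" "finite P"
    "\<And>h. h \<in> P \<Longrightarrow> cut h a y \<and> cut h a x \<and> cut h ?p y \<and> cut h ?p x"
    using sepnum_surplus by metis
  have c: "cutting P a x" by (rule L_separated_cuttingI[OF P(1)]) (use P(4) in blast)
  have "3 \<le> card P" using P(2) L(1) by linarith
  then obtain m u where m: "0 \<le> m" "m \<le> dist ?p y" and u: "0 \<le> u" "u \<le> dist a x"
    and mu: "dist (geo ?p y m) (geo a x u) \<le> real L + 1"
    using bottleneck_chain[OF P(1), of a x ?p y] P(4) by (auto simp: Bex_def)
  have tm: "t + m \<le> dist a y" using m dist_geo_right[OF t] by simp
  have "dist a (geo ?p y m) = t + m"
    using geo_tail[OF m(1) t(1) tm] dist_geo_left[of "t + m" a y] m t tm by simp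
  moreover have "dist a (geo ?p y m) \<le> dist a (geo a x u) + dist (geo ?p y m) (geo a x u)"
    by (metis dist_commute dist_triangle)
  moreover have "dist a (geo a x u) = u" using u by (rule dist_geo_left)
  moreover have "real (card P) \<le> dist a x" by (rule cutting_card(2)[OF c])
  ultimately show ?thesis using mu u m P(2) by linarith
qed

text \<open>
  Let \<open>p = geo a z s\<close>. If \<open>p\<close> is separated from \<open>a\<close> much more than \<open>{p, c}\<close> is, then \<open>[c,z]\<close> is forced through a
  bounded neighbourhood of \<open>a\<close>: more than \<open>L\<close> curtains that are \<open>L\<close>-separated separate \<open>{a, c}\<close> from \<open>{p, z}\<close>, and
  their number, hence \<open>L\<close>, is at most \<open>d(a,p) = s\<close>.
\<close>
lemma geodesic_passes_near:
  assumes s: "0 \<le> s" "s \<le> dist a z" and gap: "sep a (geo a z s) c + 10 * Lam < sep a (geo a z s) (geo a z s)"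
  shows "\<exists>m\<in>{0..dist c z}. dist a (geo c z m) \<le> 2 * s"
proof -
  let ?p = "geo a z s"
  obtain L where L: "1 \<le> L" "real (sepnum L a ?p c) + 10 * real L ^ 2 < real (sepnum L a ?p ?p)"
    using gap by (rule sep_gap)
  then have "real (sepnum L a ?p c) + 2 * real L + 8 \<le> real (sepnum L a ?p ?p)"
    using square_ge[OF L(1)] by linarith
  then have "real (sepnum L a ?p c + (2 * L + 7) + 1) \<le> real (sepnum L a ?p ?p)" by simp
  then have "sepnum L a ?p c + (2 * L + 7) + 1 \<le> sepnum L a ?p ?p" by (simp only: of_nat_le_iff)
  then obtain P where P: "pairwise (L_separated L) P" "2 * L + 7 \<le> card P" "finite P"
    "\<And>h. h \<in> P \<Longrightarrow> cut h a ?p \<and> cut h a ?p \<and> cut h c ?p \<and> cut h c ?p"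
    using sepnum_surplus by metis
  \<comment> \<open>At most \<open>L + 3\<close> curtains are crossed back before \<open>z\<close> and one may contain \<open>z\<close>, which leaves \<open>L + 3\<close>.\<close>
  define Q where "Q = {h \<in> P. cut h a z}"
  have cP: "cutting P a ?p" by (rule L_separated_cuttingI[OF P(1)]) (use P(4) in blast)
  have "card {h \<in> P. cut h z ?p} \<le> L + 3"
    by (rule separated_from_both_ends[OF s pairwise_subset[OF P(1)]]) (use P(4) in auto)
  then have cQ: "L + 3 \<le> card Q" using cutting_split[OF cP, of z] P(2) unfolding Q_def by linarith
  have Q: "pairwise (L_separated L) Q" by (rule pairwise_subset[OF P(1)]) (auto simp: Q_def)
  have Qz: "cut h c z" if "h \<in> Q" for h
  proof -
    have h: "cut h a ?p" "cut h c ?p" "cut h a z" using that P(4) by (auto simp: Q_def)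
    have "z \<notin> h" using h(3) cut_notin by blast
    then show ?thesis using cut_third[OF h(1), of z] cut_third[OF h(2), of z] h(3) by blast
  qed
  have Qp: "cut h a ?p" if "h \<in> Q" for h using that P(4) by (auto simp: Q_def)
  have "3 \<le> card Q" using cQ by linarith
  then obtain m u where m: "m \<in> {0..dist c z}" and u: "0 \<le> u" "u \<le> dist a ?p"
    and mu: "dist (geo c z m) (geo a ?p u) \<le> real L + 1"
    using bottleneck_chain[OF Q _ Qp Qz] by (auto simp: Bex_def)
  have "real (card Q) \<le> dist a ?p"
    by (rule cutting_card(2)[OF cutting_subset[OF cP]]) (auto simp: Q_def)
  moreover have "dist a ?p = s" using s by (rule dist_geo_left)
  moreover have "dist a (geo c z m) \<le> dist a (geo a ?p u) + dist (geo c z m) (geo a ?p u)"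
    by (metis dist_commute dist_triangle)
  moreover have "dist a (geo a ?p u) = u" using u by (rule dist_geo_left)
  ultimately have "dist a (geo c z m) \<le> 2 * s" using mu u cQ by linarith
  then show ?thesis using m by blast
qed

end

section \<open>Rays and the visual boundary\<close>

definition asymptotic :: "(real \<Rightarrow> 'a::metric_space) \<Rightarrow> (real \<Rightarrow> 'a) \<Rightarrow> bool" where
  "asymptotic \<alpha> \<beta> \<longleftrightarrow> (\<exists>C. \<forall>t\<ge>0. dist (\<alpha> t) (\<beta> t) \<le> C)"

lemma ray_dist: "\<lbrakk>geodesic_ray \<alpha>; 0 \<le> s; 0 \<le> t\<rbrakk> \<Longrightarrow> dist (\<alpha> s) (\<alpha> t) = \<bar>s - t\<bar>"
  by (simp add: geodesic_ray_def geodesic_on_def)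

lemma ray_geo:
  fixes \<alpha> :: "real \<Rightarrow> 'a::cat0_space"
  shows "\<lbrakk>geodesic_ray \<alpha>; 0 \<le> s; s \<le> t\<rbrakk> \<Longrightarrow> geo (\<alpha> 0) (\<alpha> t) s = \<alpha> s"
  using geo_on[of "{0..}" \<alpha> 0 t s] by (simp add: geodesic_ray_def)

lemma geodesic_rayI:
  assumes "\<And>s t. \<lbrakk>0 \<le> s; 0 \<le> t\<rbrakk> \<Longrightarrow> dist (\<alpha> s) (\<alpha> t) = \<bar>s - t\<bar>"
  shows "geodesic_ray \<alpha>"
  using assms by (simp add: geodesic_ray_def geodesic_on_def is_interval_1)

lemma asymptotic_refl: "asymptotic \<alpha> \<alpha>"
  unfolding asymptotic_def by (intro exI[of _ 0]) simp

lemma asymptotic_sym: "asymptotic \<alpha> \<beta> \<Longrightarrow> asymptotic \<beta> \<alpha>"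
  unfolding asymptotic_def by (simp add: dist_commute)

lemma asymptotic_trans:
  assumes "asymptotic \<alpha> \<beta>" "asymptotic \<beta> \<gamma>"
  shows "asymptotic \<alpha> \<gamma>"
proof -
  obtain C C' where C: "\<forall>t\<ge>0. dist (\<alpha> t) (\<beta> t) \<le> C" "\<forall>t\<ge>0. dist (\<beta> t) (\<gamma> t) \<le> C'"
    using assms unfolding asymptotic_def by blast
  have "dist (\<alpha> t) (\<gamma> t) \<le> C + C'" if "0 \<le> t" for t
    using C that dist_triangle[of "\<alpha> t" "\<gamma> t" "\<beta> t"] by force
  then show ?thesis unfolding asymptotic_def by blast
qed

lemma finite_hausdorff_dist_iff_asymptotic:
  assumes a: "geodesic_ray \<alpha>" and b: "geodesic_ray \<beta>"
  shows "finite_hausdorff_dist (\<alpha> ` {0..}) (\<beta> ` {0..}) \<longleftrightarrow> asymptotic \<alpha> \<beta>"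
proof
  assume "finite_hausdorff_dist (\<alpha> ` {0..}) (\<beta> ` {0..})"
  then obtain C where C: "\<forall>p\<in>\<alpha> ` {0..}. \<exists>q\<in>\<beta> ` {0..}. dist p q \<le> C"
    unfolding finite_hausdorff_dist_def by blast
  have "dist (\<alpha> t) (\<beta> t) \<le> 2 * C + dist (\<alpha> 0) (\<beta> 0)" if t: "0 \<le> t" for t
  proof -
    obtain s where s: "0 \<le> s" "dist (\<alpha> t) (\<beta> s) \<le> C" using C t by fastforce
    have "dist (\<alpha> 0) (\<alpha> t) \<le> dist (\<alpha> 0) (\<beta> 0) + dist (\<beta> 0) (\<beta> s) + dist (\<alpha> t) (\<beta> s)"
      "dist (\<beta> 0) (\<beta> s) \<le> dist (\<alpha> 0) (\<beta> 0) + dist (\<alpha> 0) (\<alpha> t) + dist (\<alpha> t) (\<beta> s)"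
      by metric+
    then have "\<bar>t - s\<bar> \<le> dist (\<alpha> 0) (\<beta> 0) + C"
      using s ray_dist[OF a _ t, of 0] ray_dist[OF b _ s(1), of 0] t by simp
    moreover have "dist (\<beta> s) (\<beta> t) = \<bar>s - t\<bar>" by (rule ray_dist[OF b s(1) t])
    moreover have "dist (\<alpha> t) (\<beta> t) \<le> dist (\<alpha> t) (\<beta> s) + dist (\<beta> s) (\<beta> t)" by (rule dist_triangle)
    ultimately show ?thesis using s(2) by linarith
  qed
  then show "asymptotic \<alpha> \<beta>" unfolding asymptotic_def by blast
next
  assume "asymptotic \<alpha> \<beta>"
  then obtain C where C: "\<And>t. 0 \<le> t \<Longrightarrow> dist (\<alpha> t) (\<beta> t) \<le> C" unfolding asymptotic_def by blast
  then show "finite_hausdorff_dist (\<alpha> ` {0..}) (\<beta> ` {0..})"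
    unfolding finite_hausdorff_dist_def by (intro exI[of _ C]) fastforce
qed

definition ray_class :: "(real \<Rightarrow> 'a::metric_space) \<Rightarrow> (real \<Rightarrow> 'a) set" where
  "ray_class \<alpha> = {\<beta>. geodesic_ray \<beta> \<and> asymptotic \<alpha> \<beta>}"

lemma visual_boundary_eq: "visual_boundary = {ray_class \<alpha> | \<alpha>. geodesic_ray \<alpha>}"
proof -
  have "{(\<alpha>, \<beta>). geodesic_ray \<alpha> \<and> geodesic_ray \<beta> \<and> finite_hausdorff_dist (\<alpha> ` {0..}) (\<beta> ` {0..})} `` {\<alpha>}
      = ray_class \<alpha>" if "geodesic_ray \<alpha>" for \<alpha> :: "real \<Rightarrow> 'a"
    using that finite_hausdorff_dist_iff_asymptotic by (auto simp: ray_class_def)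
  then show ?thesis unfolding visual_boundary_def quotient_def by auto
qed

lemma ray_class_in: "geodesic_ray \<alpha> \<Longrightarrow> \<alpha> \<in> ray_class \<alpha>"
  by (simp add: ray_class_def asymptotic_refl)

lemma ray_class_eq: "asymptotic \<alpha> \<beta> \<Longrightarrow> ray_class \<alpha> = ray_class \<beta>"
  unfolding ray_class_def using asymptotic_sym asymptotic_trans by blast

lemma visual_boundaryD:
  assumes "\<xi> \<in> visual_boundary" "\<alpha> \<in> \<xi>"
  shows "geodesic_ray \<alpha>" and "\<xi> = ray_class \<alpha>"
proof -
  obtain \<beta> where b: "\<xi> = ray_class \<beta>" using assms(1) unfolding visual_boundary_eq by blast
  then show "geodesic_ray \<alpha>" using assms(2) by (simp add: ray_class_def)
  show "\<xi> = ray_class \<alpha>" using ray_class_eq[of \<beta> \<alpha>] assms(2) b by (simp add: ray_class_def)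
qed

text \<open>
  By contraction towards the common origin, points at time \<open>R\<close> are at distance at most \<open>R C / t\<close> for every \<open>t\<close>.
\<close>
lemma asymptotic_rays_agree:
  fixes \<alpha> \<beta> :: "real \<Rightarrow> 'a::cat0_space"
  assumes a: "geodesic_ray \<alpha>" and b: "geodesic_ray \<beta>" and ab: "\<alpha> 0 = \<beta> 0" "asymptotic \<alpha> \<beta>" and R: "0 \<le> R"
  shows "\<alpha> R = \<beta> R"
proof -
  obtain C where C: "\<And>t. 0 \<le> t \<Longrightarrow> dist (\<alpha> t) (\<beta> t) \<le> C" using ab(2) unfolding asymptotic_def by blast
  have le: "dist (\<alpha> R) (\<beta> R) \<le> R / t * C" if t: "0 < t" "R \<le> t" for t
  proof -
    have d: "dist (\<alpha> 0) (\<alpha> t) = t" "dist (\<alpha> 0) (\<beta> t) = t"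
      using ray_dist[OF a, of 0 t] ray_dist[OF b, of 0 t] t ab by auto
    have "dist (geo (\<alpha> 0) (\<alpha> t) R) (geo (\<alpha> 0) (\<beta> t) R)
        \<le> R / t * dist (geo (\<alpha> 0) (\<alpha> t) t) (geo (\<alpha> 0) (\<beta> t) t)"
      by (rule geo_fan) (use d R t in auto)
    then have "dist (\<alpha> R) (\<beta> R) \<le> R / t * dist (\<alpha> t) (\<beta> t)"
      using ray_geo[OF a, of R t] ray_geo[OF b, of R t] ray_geo[OF a, of t t] ray_geo[OF b, of t t] R t
      by (simp add: ab(1))
    also have "\<dots> \<le> R / t * C" using C[of t] R t by (intro mult_left_mono) auto
    finally show ?thesis .
  qed
  have "((\<lambda>t. R / t * C) \<longlongrightarrow> 0 * C) at_top"
    by (intro tendsto_mult tendsto_const tendsto_divide_0[OF tendsto_const] filterlim_at_top_imp_at_infinity filterlim_ident)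
  moreover have "\<forall>\<^sub>F t in at_top. dist (\<alpha> R) (\<beta> R) \<le> R / t * C"
    using eventually_ge_at_top[of "max R 1"] by eventually_elim (use le in auto)
  ultimately have "dist (\<alpha> R) (\<beta> R) \<le> 0" using tendsto_lowerbound[of _ _ at_top] by fastforce
  then show ?thesis by simp
qed

text \<open>
  The segments \<open>[a, \<delta> t]\<close> follow the ray \<open>\<delta>\<close>: compare the triangle with vertices \<open>\<delta> t'\<close>, \<open>\<delta> 0\<close> and \<open>a\<close> with its
  contraction towards \<open>\<delta> t'\<close>.
\<close>
lemma segment_follows_ray:
  fixes \<delta> :: "real \<Rightarrow> 'a::cat0_space"
  assumes d: "geodesic_ray \<delta>" and t: "0 \<le> t" "t \<le> t'" "0 < t'"
  shows "dist (\<delta> t) (geo a (\<delta> t') (t / t' * dist a (\<delta> t'))) \<le> dist a (\<delta> 0)"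
proof -
  define l where "l = (t' - t) / t'"
  have l: "0 \<le> l" "l \<le> 1" using t by (auto simp: l_def)
  have d0: "dist (\<delta> t') (\<delta> 0) = t'" using ray_dist[OF d, of t' 0] t by simp
  have "geo (\<delta> t') (\<delta> 0) (l * dist (\<delta> t') (\<delta> 0)) = geo (\<delta> 0) (\<delta> t') t"
    using geo_reverse[of "t' - t" "\<delta> 0" "\<delta> t'"] t d0 by (simp add: l_def dist_commute)
  also have "\<dots> = \<delta> t" using ray_geo[OF d t(1,2)] .
  finally have 1: "geo (\<delta> t') (\<delta> 0) (l * dist (\<delta> t') (\<delta> 0)) = \<delta> t" .
  define w where "w = t / t' * dist a (\<delta> t')"
  have lw: "l * dist (\<delta> t') a = dist a (\<delta> t') - w"
    using t by (simp add: l_def w_def field_simps dist_commute)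
  have "t / t' * dist a (\<delta> t') \<le> 1 * dist a (\<delta> t')" using t by (intro mult_right_mono) auto
  then have "0 \<le> w" "w \<le> dist a (\<delta> t')" using t by (auto simp: w_def)
  then have 2: "geo (\<delta> t') a (l * dist (\<delta> t') a) = geo a (\<delta> t') w"
    using geo_reverse[of "dist a (\<delta> t') - w" a "\<delta> t'"] unfolding lw by simp
  have "dist (\<delta> t) (geo a (\<delta> t') (t / t' * dist a (\<delta> t'))) \<le> l * dist (\<delta> 0) a"
    using geo_fan_ratio[OF l, of "\<delta> t'" "\<delta> 0" a] unfolding 1 2 w_def .
  also have "\<dots> \<le> dist a (\<delta> 0)" using l by (simp add: dist_commute mult_left_le_one_le)
  finally show ?thesis .
qed

context curtain_model
begin

lemma Cauchy_convergent:
  fixes X :: "nat \<Rightarrow> 'a"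
  assumes "Cauchy X"
  shows "convergent X"
proof -
  obtain e where "range X \<subseteq> cball (X 0) e"
    using cauchy_imp_bounded[OF assms] unfolding bounded_any_center[of _ "X 0"]
    by (auto simp: subset_iff)
  moreover have "complete (cball (X 0) e)" by (rule compact_imp_complete[OF proper])
  ultimately show ?thesis using assms unfolding complete_def convergent_def by blast
qed

lemma geodesics_converge_to_ray:
  fixes x :: "nat \<Rightarrow> 'a"
  assumes far: "\<And>R. \<exists>N. \<forall>n\<ge>N. R \<le> dist a (x n)"
    and cau: "\<And>R e. \<lbrakk>0 \<le> R; 0 < e\<rbrakk> \<Longrightarrow> \<exists>N. \<forall>m\<ge>N. \<forall>n\<ge>N. dist (geo a (x m) R) (geo a (x n) R) < e"
  shows "\<exists>\<alpha>. geodesic_ray \<alpha> \<and> \<alpha> 0 = a \<and> (\<forall>R\<ge>0. (\<lambda>n. geo a (x n) R) \<longlonglongrightarrow> \<alpha> R)"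
proof -
  have "\<exists>l. (\<lambda>n. geo a (x n) R) \<longlonglongrightarrow> l" if "0 \<le> R" for R
    using Cauchy_convergent[of "\<lambda>n. geo a (x n) R"] cau[OF that] unfolding Cauchy_def convergent_def by blast
  then obtain \<alpha> where \<alpha>: "\<And>R. 0 \<le> R \<Longrightarrow> (\<lambda>n. geo a (x n) R) \<longlonglongrightarrow> \<alpha> R" by metis
  have "geodesic_ray \<alpha>"
  proof (rule geodesic_rayI)
    fix s t :: real assume st: "0 \<le> s" "0 \<le> t"
    obtain N where N: "\<forall>n\<ge>N. max s t \<le> dist a (x n)" using far by blast
    have "(\<lambda>n. dist (geo a (x n) s) (geo a (x n) t)) \<longlonglongrightarrow> dist (\<alpha> s) (\<alpha> t)"
      by (intro tendsto_dist \<alpha> st)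
    moreover have "\<forall>\<^sub>F n in sequentially. dist (geo a (x n) s) (geo a (x n) t) = \<bar>s - t\<bar>"
      using eventually_ge_at_top[of N] by eventually_elim (use N st in \<open>auto intro: dist_geo\<close>)
    then have "(\<lambda>n. dist (geo a (x n) s) (geo a (x n) t)) \<longlonglongrightarrow> \<bar>s - t\<bar>"
      by (rule tendsto_eventually)
    ultimately show "dist (\<alpha> s) (\<alpha> t) = \<bar>s - t\<bar>" by (rule LIMSEQ_unique)
  qed
  moreover have "\<alpha> 0 = a" using LIMSEQ_unique[OF \<alpha>[of 0], of a] by simp
  ultimately show ?thesis using \<alpha> by blast
qed

text \<open>
  The convergence of all segments \<open>[a, \<delta> n]\<close> identifies the limits of geodesics whose ends move along \<open>\<delta>\<close>; the
  bound, which depends on \<open>d(a, \<delta> 0)\<close> alone, makes estimates uniform over translates of a ray.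
\<close>
lemma asymptotic_ray_from:
  fixes \<delta> :: "real \<Rightarrow> 'a"
  assumes d: "geodesic_ray \<delta>"
  shows "\<exists>\<alpha>. geodesic_ray \<alpha> \<and> \<alpha> 0 = a \<and> (\<forall>s\<ge>0. dist (\<alpha> s) (\<delta> s) \<le> 2 * dist a (\<delta> 0)) \<and>
    (\<forall>R\<ge>0. (\<lambda>n. geo a (\<delta> (real n)) R) \<longlonglongrightarrow> \<alpha> R)"
proof -
  define C where "C = dist a (\<delta> 0)"
  have C0: "0 \<le> C" by (simp add: C_def)
  have dd: "\<bar>dist a (\<delta> t) - t\<bar> \<le> C" if "0 \<le> t" for t
    using dist_triangle[of a "\<delta> t" "\<delta> 0"] dist_triangle[of "\<delta> 0" "\<delta> t" a] ray_dist[OF d, of 0 t] that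
    by (simp add: C_def dist_commute)
  have near: "dist (geo a (\<delta> t) R) (geo a (\<delta> t') R) \<le> 2 * C * R / (t - 2 * C)"
    if t: "2 * C < t" "t \<le> t'" and R: "0 \<le> R" "R \<le> t - 2 * C" for t t' R
  proof -
    have t0: "0 < t" using t C0 by linarith
    have "dist (geo a (\<delta> t) (dist a (\<delta> t))) (geo a (\<delta> t') (t / t' * dist a (\<delta> t'))) \<le> C"
      using segment_follows_ray[OF d, of t t' a] t t0 by (simp add: C_def)
    moreover have "t / t' * dist a (\<delta> t') \<le> 1 * dist a (\<delta> t')"
      using t t0 by (intro mult_right_mono) auto
    moreover have "0 \<le> t / t' * dist a (\<delta> t')" using t t0 by simp
    ultimately show ?thesis
      by (intro geo_fan_close[where s' = "t / t' * dist a (\<delta> t')" and s = "dist a (\<delta> t)"])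
        (use t R dd[of t] t0 in auto)
  qed
  have "\<exists>\<alpha>. geodesic_ray \<alpha> \<and> \<alpha> 0 = a \<and> (\<forall>R\<ge>0. (\<lambda>n. geo a (\<delta> (real n)) R) \<longlonglongrightarrow> \<alpha> R)"
  proof (rule geodesics_converge_to_ray)
    fix R :: real
    have "R \<le> dist a (\<delta> (real n))" if "n \<ge> nat \<lceil>R + C\<rceil>" for n
    proof -
      have "R + C \<le> real n" using that by linarith
      then show ?thesis using dd[of "real n"] by auto
    qed
    then show "\<exists>N. \<forall>n\<ge>N. R \<le> dist a (\<delta> (real n))" by blast
  next
    fix R e :: real assume R: "0 \<le> R" and e: "0 < e"
    obtain N :: nat where N: "2 * C + 1 + R + (2 * C * R + 1) / e < real N"
      using reals_Archimedean2 by blast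
    have q: "0 \<le> (2 * C * R + 1) / e" using C0 R e by simp
    have lt: "dist (geo a (\<delta> (real m)) R) (geo a (\<delta> (real n)) R) < e" if "N \<le> m" "m \<le> n" for m n
    proof -
      have m: "2 * C + 1 + R + (2 * C * R + 1) / e < real m"
        using N that by (meson of_nat_le_iff order_less_le_trans)
      have "dist (geo a (\<delta> (real m)) R) (geo a (\<delta> (real n)) R) \<le> 2 * C * R / (real m - 2 * C)"
        by (rule near) (use m q R that in linarith)+
      also have "\<dots> < e"
      proof -
        have "(2 * C * R + 1) / e < real m - 2 * C" using m R by linarith
        then have "2 * C * R + 1 < e * (real m - 2 * C)" using e by (simp add: field_simps)
        moreover have "0 < real m - 2 * C" using m q R by linarith
        ultimately show ?thesis by (simp add: field_simps)
      qed
      finally show ?thesis .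
    qed
    have "dist (geo a (\<delta> (real m)) R) (geo a (\<delta> (real n)) R) < e" if "N \<le> m" "N \<le> n" for m n
      using lt[of m n] lt[of n m] that by (cases "m \<le> n") (auto simp: dist_commute)
    then show "\<exists>N. \<forall>m\<ge>N. \<forall>n\<ge>N. dist (geo a (\<delta> (real m)) R) (geo a (\<delta> (real n)) R) < e" by blast
  qed
  then obtain \<alpha> where \<alpha>: "geodesic_ray \<alpha>" "\<alpha> 0 = a" and lim: "\<And>R. 0 \<le> R \<Longrightarrow> (\<lambda>n. geo a (\<delta> (real n)) R) \<longlonglongrightarrow> \<alpha> R"
    by blast
  have "dist (\<alpha> s) (\<delta> s) \<le> 2 * C" if s: "0 \<le> s" for s
  proof (rule tendsto_upperbound)
    show "(\<lambda>n. dist (geo a (\<delta> (real n)) s) (\<delta> s)) \<longlonglongrightarrow> dist (\<alpha> s) (\<delta> s)"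
      by (intro tendsto_dist lim s tendsto_const)
    show "\<forall>\<^sub>F n in sequentially. dist (geo a (\<delta> (real n)) s) (\<delta> s) \<le> 2 * C"
      using eventually_ge_at_top[of "nat \<lceil>s + C\<rceil> + 1"]
    proof eventually_elim
      case (elim n)
      define u where "u = s / real n * dist a (\<delta> (real n))"
      have n: "s + C \<le> real n" "0 < real n" using elim by linarith+
      have sn: "s / real n \<le> 1" "0 \<le> s / real n" using n s C0 by auto
      have "\<bar>u - s\<bar> = s / real n * \<bar>dist a (\<delta> (real n)) - real n\<bar>"
      proof -
        have "u - s = s / real n * (dist a (\<delta> (real n)) - real n)" using n by (simp add: u_def field_simps)
        then show ?thesis using s sn by (simp add: abs_mult)
      qed
      also have "\<dots> \<le> 1 * C" using sn dd[of "real n"] by (intro mult_mono) auto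
      finally have us: "\<bar>u - s\<bar> \<le> C" by simp
      have "s \<le> dist a (\<delta> (real n))" using dd[of "real n"] n by auto
      moreover have "0 \<le> u" unfolding u_def by (rule mult_nonneg_nonneg[OF sn(2)]) simp
      moreover have "u \<le> dist a (\<delta> (real n))" unfolding u_def by (rule mult_left_le_one_le) (use sn in auto)
      ultimately have "dist (geo a (\<delta> (real n)) s) (geo a (\<delta> (real n)) u) \<le> C"
        using us s by (simp add: dist_geo abs_minus_commute)
      moreover have "dist (\<delta> s) (geo a (\<delta> (real n)) u) \<le> C"
        unfolding u_def C_def by (rule segment_follows_ray[OF d]) (use s n C0 in auto)
      ultimately show ?case
        using dist_triangle[of "geo a (\<delta> (real n)) s" "\<delta> s" "geo a (\<delta> (real n)) u"] by (simp add: dist_commute)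
    qed
  qed simp
  then show ?thesis using \<alpha> lim unfolding C_def by blast
qed

lemma visual_boundary_ray_from:
  assumes "\<xi> \<in> visual_boundary"
  shows "\<exists>\<alpha>\<in>\<xi>. \<alpha> 0 = (a :: 'a)"
proof -
  obtain \<delta> where d: "geodesic_ray \<delta>" "\<xi> = ray_class \<delta>" using assms unfolding visual_boundary_eq by blast
  obtain \<alpha> where "geodesic_ray \<alpha>" "\<alpha> 0 = a" "\<forall>s\<ge>0. dist (\<alpha> s) (\<delta> s) \<le> 2 * dist a (\<delta> 0)"
    using asymptotic_ray_from[OF d(1)] by blast
  then show ?thesis using d asymptotic_sym unfolding ray_class_def asymptotic_def by blast
qed


section \<open>The Gromov boundary\<close>

text \<open>The joint divergence of two sequences; it replaces both clauses of the definition of the boundary.\<close>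
definition comparable :: "(nat \<Rightarrow> 'a) \<Rightarrow> (nat \<Rightarrow> 'a) \<Rightarrow> bool" where
  "comparable x y \<longleftrightarrow> (\<forall>M. \<exists>N. \<forall>m\<ge>N. \<forall>n\<ge>N. M \<le> sep b (x m) (y n))"

lemma comparable_sym: "comparable x y \<Longrightarrow> comparable y x"
  unfolding comparable_def by (metis sep_commute)

lemma sep_hyperbolic_ge: "\<lbrakk>M + 3 * Lam \<le> sep a x y; M + 3 * Lam \<le> sep a y z\<rbrakk> \<Longrightarrow> M \<le> sep a x z"
  using sep_hyperbolic[of a x y z] by linarith

lemma comparable_trans:
  assumes "comparable x y" "comparable y z"
  shows "comparable x z"
  unfolding comparable_def
proof
  fix M
  obtain N1 N2 where N: "\<forall>m\<ge>N1. \<forall>n\<ge>N1. M + 3 * Lam \<le> sep b (x m) (y n)"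
    "\<forall>m\<ge>N2. \<forall>n\<ge>N2. M + 3 * Lam \<le> sep b (y m) (z n)"
    using assms unfolding comparable_def by meson
  have "M \<le> sep b (x m) (z n)" if "m \<ge> max N1 N2" "n \<ge> max N1 N2" for m n
    by (rule sep_hyperbolic_ge[of _ _ _ "y (max N1 N2)"]) (use N that in auto)
  then show "\<exists>N. \<forall>m\<ge>N. \<forall>n\<ge>N. M \<le> sep b (x m) (z n)" by blast
qed

lemma comparable_near:
  assumes xy: "comparable x y" and C: "\<And>n. dist (y n) (z n) \<le> C"
  shows "comparable x z"
  unfolding comparable_def
proof
  fix M
  obtain N where N: "\<forall>m\<ge>N. \<forall>n\<ge>N. M + (C + 1) * Lam \<le> sep b (x m) (y n)"
    using xy unfolding comparable_def by meson
  have "M \<le> sep b (x m) (z n)" if "m \<ge> N" "n \<ge> N" for m n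
  proof -
    have "sep b (x m) (y n) \<le> sep b (x m) (z n) + (dist (y n) (z n) + 1) * Lam"
      using sep_perturb[of b "y n" "x m" "z n"] by (simp add: sep_commute)
    also have "(dist (y n) (z n) + 1) * Lam \<le> (C + 1) * Lam"
      using C[of n] Lam_pos by (intro mult_right_mono) auto
    finally show ?thesis using N that by force
  qed
  then show "\<exists>N. \<forall>m\<ge>N. \<forall>n\<ge>N. M \<le> sep b (x m) (z n)" by blast
qed

lemma converges_to_infinity_iff: "converges_to_infinity D b x \<longleftrightarrow> comparable x x"
proof -
  have "converges_to_infinity D b x \<longleftrightarrow>
      (\<forall>M. \<exists>N. \<forall>m\<ge>N. \<forall>n\<ge>N. M \<le> gromov_product D b (x m) (x n))"
    unfolding converges_to_infinity_def filterlim_at_top case_prod_unfold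
    by (simp add: eventually_prod_sequentially) blast
  also have "\<dots> \<longleftrightarrow> comparable x x"
    unfolding comparable_def
  proof (intro iffI allI)
    fix M assume *: "\<forall>M. \<exists>N. \<forall>m\<ge>N. \<forall>n\<ge>N. M \<le> gromov_product D b (x m) (x n)"
    obtain N where N: "\<forall>m\<ge>N. \<forall>n\<ge>N. M + 4 * Lam \<le> gromov_product D b (x m) (x n)"
      using *[rule_format, of "M + 4 * Lam"] by blast
    have "M \<le> sep b (x m) (x n)" if "N \<le> m" "N \<le> n" for m n
      using N[rule_format, OF that] gromov_product_sep[of b "x m" "x n"] by linarith
    then show "\<exists>N. \<forall>m\<ge>N. \<forall>n\<ge>N. M \<le> sep b (x m) (x n)" by blast
  next
    fix M assume *: "\<forall>M. \<exists>N. \<forall>m\<ge>N. \<forall>n\<ge>N. M \<le> sep b (x m) (x n)"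
    obtain N where N: "\<forall>m\<ge>N. \<forall>n\<ge>N. M + 4 * Lam \<le> sep b (x m) (x n)"
      using *[rule_format, of "M + 4 * Lam"] by blast
    have "M \<le> gromov_product D b (x m) (x n)" if "N \<le> m" "N \<le> n" for m n
      using N[rule_format, OF that] gromov_product_sep[of b "x m" "x n"] by linarith
    then show "\<exists>N. \<forall>m\<ge>N. \<forall>n\<ge>N. M \<le> gromov_product D b (x m) (x n)" by blast
  qed
  finally show ?thesis .
qed

lemma gromov_product_diverges_iff:
  assumes x: "comparable x x"
  shows "filterlim (\<lambda>n. gromov_product D b (x n) (y n)) at_top sequentially \<longleftrightarrow> comparable x y"
proof
  assume f: "filterlim (\<lambda>n. gromov_product D b (x n) (y n)) at_top sequentially"
  show "comparable x y"
    unfolding comparable_def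
  proof
    fix M
    obtain N1 where N1: "\<forall>n\<ge>N1. (M + 3 * Lam) + 4 * Lam \<le> gromov_product D b (x n) (y n)"
      using f unfolding filterlim_at_top eventually_sequentially by blast
    obtain N2 where N2: "\<forall>m\<ge>N2. \<forall>n\<ge>N2. M + 3 * Lam \<le> sep b (x m) (x n)"
      using x unfolding comparable_def by blast
    have "M \<le> sep b (x m) (y n)" if "m \<ge> max N1 N2" "n \<ge> max N1 N2" for m n
    proof (rule sep_hyperbolic_ge[of _ _ _ "x n"])
      show "M + 3 * Lam \<le> sep b (x m) (x n)" using N2 that by auto
      have "(M + 3 * Lam) + 4 * Lam \<le> gromov_product D b (x n) (y n)" using N1 that by auto
      then show "M + 3 * Lam \<le> sep b (x n) (y n)" using gromov_product_sep[of b "x n" "y n"] by linarith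
    qed
    then show "\<exists>N. \<forall>m\<ge>N. \<forall>n\<ge>N. M \<le> sep b (x m) (y n)" by blast
  qed
next
  assume c: "comparable x y"
  show "filterlim (\<lambda>n. gromov_product D b (x n) (y n)) at_top sequentially"
    unfolding filterlim_at_top eventually_sequentially
  proof
    fix M
    obtain N where N: "\<forall>m\<ge>N. \<forall>n\<ge>N. M + 4 * Lam \<le> sep b (x m) (y n)"
      using c unfolding comparable_def by blast
    have "M \<le> gromov_product D b (x n) (y n)" if "n \<ge> N" for n
      using N[rule_format, OF that that] gromov_product_sep[of b "x n" "y n"] by linarith
    then show "\<exists>N. \<forall>n\<ge>N. M \<le> gromov_product D b (x n) (y n)" by blast
  qed
qed

lemma comparable_refl: "comparable x y \<Longrightarrow> comparable y y" "comparable x y \<Longrightarrow> comparable x x"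
  using comparable_sym comparable_trans by blast+

lemma gromov_boundary_eq: "gromov_boundary D b = {{y. comparable x y} | x. comparable x x}"
proof -
  have "{(x, y). converges_to_infinity D b x \<and> converges_to_infinity D b y \<and>
        filterlim (\<lambda>n. gromov_product D b (x n) (y n)) at_top sequentially} `` {x} = {y. comparable x y}"
    if "comparable x x" for x
    using that gromov_product_diverges_iff[OF that] comparable_refl
    by (auto simp: converges_to_infinity_iff)
  then show ?thesis unfolding gromov_boundary_def quotient_def converges_to_infinity_iff by auto
qed

lemma gromov_boundaryD:
  assumes "\<eta> \<in> gromov_boundary D b" "x \<in> \<eta>"
  shows "\<eta> = {y. comparable x y}" and "comparable x x"
proof -
  obtain z where z: "\<eta> = {y. comparable z y}" using assms(1) unfolding gromov_boundary_eq by blast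
  then have zx: "comparable z x" using assms(2) by blast
  then show "comparable x x" using comparable_refl by blast
  show "\<eta> = {y. comparable x y}" unfolding z using zx comparable_sym comparable_trans by blast
qed

lemma gromov_boundary_comparable:
  "\<lbrakk>\<eta> \<in> gromov_boundary D b; x \<in> \<eta>; y \<in> \<eta>\<rbrakk> \<Longrightarrow> comparable x y"
  using gromov_boundaryD(1)[of \<eta> x] by blast

lemma gromov_boundary_closed:
  "\<lbrakk>\<eta> \<in> gromov_boundary D b; x \<in> \<eta>; comparable x y\<rbrakk> \<Longrightarrow> y \<in> \<eta>"
  using gromov_boundaryD(1)[of \<eta> x] by blast

lemma gromov_boundary_unique:
  "\<lbrakk>\<eta> \<in> gromov_boundary D b; \<theta> \<in> gromov_boundary D b; x \<in> \<eta>; x \<in> \<theta>\<rbrakk> \<Longrightarrow> \<eta> = \<theta>"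
  using gromov_boundaryD(1)[of \<eta> x] gromov_boundaryD(1)[of \<theta> x] by simp

lemma gromov_boundary_nonempty: "\<eta> \<in> gromov_boundary D b \<Longrightarrow> \<exists>x. x \<in> \<eta>"
  unfolding gromov_boundary_eq by blast

lemma gromov_boundaryI: "comparable x x \<Longrightarrow> {y. comparable x y} \<in> gromov_boundary D b"
  unfolding gromov_boundary_eq by blast

abbreviation on_ray :: "(real \<Rightarrow> 'a) \<Rightarrow> nat \<Rightarrow> 'a" where
  "on_ray \<alpha> \<equiv> \<lambda>n. \<alpha> (real n)"

text \<open>Integer times suffice, since every point of a ray is within distance one of such a point.\<close>
lemma ray_represents_iff:
  "ray_represents D b \<alpha> \<eta> \<longleftrightarrow> geodesic_ray \<alpha> \<and> \<eta> \<in> gromov_boundary D b \<and> on_ray \<alpha> \<in> \<eta>"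
proof
  assume r: "ray_represents D b \<alpha> \<eta>"
  have "(\<forall>n. 0 \<le> real n) \<and> filterlim real at_top sequentially"
    using filterlim_real_sequentially by simp
  then show "geodesic_ray \<alpha> \<and> \<eta> \<in> gromov_boundary D b \<and> on_ray \<alpha> \<in> \<eta>"
    using r unfolding ray_represents_def by blast
next
  assume r: "geodesic_ray \<alpha> \<and> \<eta> \<in> gromov_boundary D b \<and> on_ray \<alpha> \<in> \<eta>"
  have "(\<lambda>n. \<alpha> (t n)) \<in> \<eta>" if t: "\<forall>n. 0 \<le> t n" "filterlim t at_top sequentially" for t :: "nat \<Rightarrow> real"
  proof (rule gromov_boundary_closed)
    have c: "comparable (on_ray \<alpha>) (on_ray \<alpha>)" using r gromov_boundaryD(2) by blast
    have "comparable (on_ray \<alpha>) (\<lambda>n. on_ray \<alpha> (nat \<lfloor>t n\<rfloor>))"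
      unfolding comparable_def
    proof
      fix M
      obtain N where N: "\<forall>m\<ge>N. \<forall>n\<ge>N. M \<le> sep b (on_ray \<alpha> m) (on_ray \<alpha> n)"
        using c unfolding comparable_def by blast
      obtain N' where N': "\<forall>n\<ge>N'. real N \<le> t n"
        using t(2) unfolding filterlim_at_top eventually_sequentially by blast
      have "N \<le> nat \<lfloor>t n\<rfloor>" if "n \<ge> N'" for n using N' that by (simp add: le_nat_floor)
      then show "\<exists>N. \<forall>m\<ge>N. \<forall>n\<ge>N. M \<le> sep b (on_ray \<alpha> m) (on_ray \<alpha> (nat \<lfloor>t n\<rfloor>))"
        using N by (intro exI[of _ "max N N'"]) auto
    qed
    then show "comparable (on_ray \<alpha>) (\<lambda>n. \<alpha> (t n))"
    proof (rule comparable_near)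
      fix n
      have "real (nat \<lfloor>t n\<rfloor>) = of_int \<lfloor>t n\<rfloor>" using t(1) by simp
      then have "dist (\<alpha> (real (nat \<lfloor>t n\<rfloor>))) (\<alpha> (t n)) = \<bar>of_int \<lfloor>t n\<rfloor> - t n\<bar>"
        using ray_dist[of \<alpha> "real (nat \<lfloor>t n\<rfloor>)" "t n"] r t(1) by simp
      also have "\<dots> \<le> 1" by linarith
      finally show "dist (\<alpha> (real (nat \<lfloor>t n\<rfloor>))) (\<alpha> (t n)) \<le> 1" .
    qed
  qed (use r in auto)
  then show "ray_represents D b \<alpha> \<eta>" using r unfolding ray_represents_def by blast
qed

text \<open>
  A point of the visual boundary is itself a set of rays, so the embedding can be written down without
  choices. That the value is a single class of rays is \<open>to_visual_in\<close>.
\<close>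
definition to_visual :: "(nat \<Rightarrow> 'a) set \<Rightarrow> (real \<Rightarrow> 'a) set" where
  "to_visual \<eta> = {\<alpha>. ray_represents D b \<alpha> \<eta>}"

text \<open>
  The weighted separation along the two rays exceeds every \<open>M Lam\<close>, and fellow-travelling gives
  \<open>d(\<alpha> R, \<beta> R) \<le> 8 R / M\<close>.
\<close>
lemma comparable_rays_agree:
  assumes a: "geodesic_ray \<alpha>" "\<alpha> 0 = b" and c: "geodesic_ray \<beta>" "\<beta> 0 = b"
    and ab: "comparable (on_ray \<alpha>) (on_ray \<beta>)" and R: "0 \<le> R"
  shows "\<alpha> R = \<beta> R"
proof -
  have le: "dist (\<alpha> R) (\<beta> R) \<le> 8 * R / M" if M: "8 \<le> M" "2 * R \<le> M" for M
  proof -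
    obtain N where N: "\<forall>m\<ge>N. \<forall>n\<ge>N. M * Lam + 1 \<le> sep b (on_ray \<alpha> m) (on_ray \<beta> n)"
      using ab unfolding comparable_def by blast
    define n where "n = max N (nat \<lceil>R\<rceil>)"
    have n: "N \<le> n" "R \<le> real n" unfolding n_def by linarith+
    have "M * Lam + 1 \<le> sep b (on_ray \<alpha> n) (on_ray \<beta> n)" using N n(1) by blast
    then have "dist (geo b (on_ray \<alpha> n) R) (geo b (on_ray \<beta> n) R) \<le> 8 * R / M"
      by (intro fellow_travel) (use M R in auto)
    then show ?thesis using ray_geo[OF a(1) R n(2)] ray_geo[OF c(1) R n(2)] a(2) c(2) by simp
  qed
  have "((\<lambda>M. 8 * R / M) \<longlongrightarrow> 0) at_top"
    by (intro tendsto_divide_0[OF tendsto_const] filterlim_at_top_imp_at_infinity filterlim_ident)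
  moreover have "\<forall>\<^sub>F M in at_top. dist (\<alpha> R) (\<beta> R) \<le> 8 * R / M"
    using eventually_ge_at_top[of "max 8 (2 * R)"] by eventually_elim (use le in auto)
  ultimately have "dist (\<alpha> R) (\<beta> R) \<le> 0" using tendsto_lowerbound[of _ _ at_top] by fastforce
  then show ?thesis by simp
qed

text \<open>
  The segments \<open>[b, x n]\<close> converge by fellow-travelling. The limit ray reaches every level \<open>M\<close> of
  separation after a time that depends only on one \<open>x N\<close>, because a segment \<open>[b, x k]\<close> below that level is not
  much longer than \<open>d(b, x N)\<close>.
\<close>
lemma limit_ray:
  assumes x: "comparable x x"
  shows "\<exists>\<alpha>. geodesic_ray \<alpha> \<and> \<alpha> 0 = b \<and> comparable x (on_ray \<alpha>) \<and>
    (\<forall>R\<ge>0. (\<lambda>n. geo b (x n) R) \<longlonglongrightarrow> \<alpha> R)"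
proof -
  have far: "\<exists>N. \<forall>n\<ge>N. R \<le> dist b (x n)" for R
  proof -
    obtain N where N: "\<forall>m\<ge>N. \<forall>n\<ge>N. R * Lam \<le> sep b (x m) (x n)"
      using x unfolding comparable_def by blast
    have "R \<le> dist b (x n)" if "n \<ge> N" for n
      using N[rule_format, OF that that] sep_le_dist[of b "x n" "x n"] Lam_pos
      by (meson mult_le_cancel_right_pos order_trans)
    then show ?thesis by blast
  qed
  have "\<exists>\<alpha>. geodesic_ray \<alpha> \<and> \<alpha> 0 = b \<and> (\<forall>R\<ge>0. (\<lambda>n. geo b (x n) R) \<longlonglongrightarrow> \<alpha> R)"
  proof (rule geodesics_converge_to_ray[OF far])
    fix R e :: real assume R: "0 \<le> R" and e: "0 < e"
    define M where "M = max (max 8 (2 * R)) (8 * R / e + 1)"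
    have M: "8 \<le> M" "2 * R \<le> M" "8 * R / e < M" by (auto simp: M_def)
    obtain N where N: "\<forall>m\<ge>N. \<forall>n\<ge>N. M * Lam + 1 \<le> sep b (x m) (x n)"
      using x unfolding comparable_def by blast
    have "dist (geo b (x m) R) (geo b (x n) R) < e" if "m \<ge> N" "n \<ge> N" for m n
    proof -
      have "M * Lam < sep b (x m) (x n)" using N that by force
      then have "dist (geo b (x m) R) (geo b (x n) R) \<le> 8 * R / M"
        by (intro fellow_travel) (use M R in auto)
      also have "\<dots> < e" using M e by (simp add: field_simps)
      finally show ?thesis .
    qed
    then show "\<exists>N. \<forall>m\<ge>N. \<forall>n\<ge>N. dist (geo b (x m) R) (geo b (x n) R) < e" by blast
  qed
  then obtain \<alpha> where \<alpha>: "geodesic_ray \<alpha>" "\<alpha> 0 = b"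
    and lim: "\<And>R. 0 \<le> R \<Longrightarrow> (\<lambda>n. geo b (x n) R) \<longlonglongrightarrow> \<alpha> R" by blast
  have "comparable x (on_ray \<alpha>)"
    unfolding comparable_def
  proof
    fix M
    \<comment> \<open>The losses are \<open>5\<close> for the progress, \<open>5\<close> along \<open>[b, x k]\<close>, \<open>2\<close> from \<open>[b, x k]\<close> to \<open>\<alpha>\<close>, and \<open>3\<close> for hyperbolicity.\<close>
    obtain N where N: "\<forall>m\<ge>N. \<forall>n\<ge>N. M + 15 * Lam \<le> sep b (x m) (x n)"
      using x unfolding comparable_def by blast
    define T where "T = max N (nat \<lceil>2 * dist b (x N)\<rceil> + 1)"
    have "M \<le> sep b (x m) (on_ray \<alpha> n)" if mn: "m \<ge> T" "n \<ge> T" for m n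
    proof -
      define t where "t = real n"
      have t: "2 * dist b (x N) < t" "0 \<le> t" using mn unfolding T_def t_def by linarith+
      obtain N1 where N1: "\<forall>k\<ge>N1. t \<le> dist b (x k)" using far by blast
      obtain N2 where N2: "\<forall>k\<ge>N2. dist (geo b (x k) t) (\<alpha> t) < 1"
        using metric_LIMSEQ_D[OF lim[OF t(2)], of 1] by auto
      define k where "k = max N (max N1 N2)"
      have k: "N \<le> k" "t \<le> dist b (x k)" "dist (geo b (x k) t) (\<alpha> t) \<le> 1"
        using N1 N2 unfolding k_def by (auto intro: less_imp_le)
      let ?p = "geo b (x k) t"
      have "M + 15 * Lam \<le> sep b (x N) (x k)" using N k(1) by blast
      moreover have "sep b (x N) (x k) \<le> sep b ?p ?p + 5 * Lam"
        using progress_along_geodesic[OF t(2) k(2), of "x N"] t(1) by linarith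
      moreover have "sep b ?p ?p \<le> sep b ?p (x k) + 5 * Lam" by (rule sep_on_geodesic[OF t(2) k(2)])
      moreover have "sep b ?p (x k) \<le> sep b (\<alpha> t) (x k) + (dist ?p (\<alpha> t) + 1) * Lam" by (rule sep_perturb)
      moreover have "(dist ?p (\<alpha> t) + 1) * Lam \<le> 2 * Lam"
        using k(3) Lam_pos by (intro mult_right_mono) auto
      ultimately have 1: "M + 3 * Lam \<le> sep b (x k) (\<alpha> t)" by (simp add: sep_commute)
      have "N \<le> m" using mn(1) by (simp add: T_def)
      then have "M + 3 * Lam \<le> sep b (x m) (x k)" using N k(1) Lam_pos by force
      then show ?thesis using 1 unfolding t_def by (rule sep_hyperbolic_ge)
    qed
    then show "\<exists>N. \<forall>m\<ge>N. \<forall>n\<ge>N. M \<le> sep b (x m) (on_ray \<alpha> n)" by blast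
  qed
  then show ?thesis using \<alpha> lim by blast
qed

lemma represents_asymptotic:
  assumes "ray_represents D b \<alpha> \<eta>" "geodesic_ray \<beta>" "asymptotic \<alpha> \<beta>"
  shows "ray_represents D b \<beta> \<eta>"
proof -
  have a: "geodesic_ray \<alpha>" "\<eta> \<in> gromov_boundary D b" "on_ray \<alpha> \<in> \<eta>"
    using assms(1) unfolding ray_represents_iff by auto
  obtain C where C: "\<And>t. 0 \<le> t \<Longrightarrow> dist (\<alpha> t) (\<beta> t) \<le> C" using assms(3) unfolding asymptotic_def by blast
  have "comparable (on_ray \<alpha>) (on_ray \<beta>)"
    by (rule comparable_near[OF gromov_boundaryD(2)[OF a(2,3)], of _ C]) (use C in auto)
  then show ?thesis using gromov_boundary_closed[OF a(2,3)] assms(2) a(2) unfolding ray_represents_iff by blast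
qed

text \<open>
  Every ray that represents \<open>\<eta>\<close> is asymptotic to one from \<open>b\<close>, and there is only one of those. So the rays
  that represent \<open>\<eta>\<close> are exactly one class.
\<close>
lemma ray_to_boundary_point:
  assumes eta: "\<eta> \<in> gromov_boundary D b"
  shows "\<exists>\<alpha>. ray_represents D b \<alpha> \<eta> \<and> \<alpha> 0 = b \<and> to_visual \<eta> = ray_class \<alpha>"
proof -
  obtain x where x: "x \<in> \<eta>" using gromov_boundary_nonempty[OF eta] by blast
  obtain \<alpha> where \<alpha>: "geodesic_ray \<alpha>" "\<alpha> 0 = b" "comparable x (on_ray \<alpha>)"
    using limit_ray[OF gromov_boundaryD(2)[OF eta x]] by blast
  have rep: "ray_represents D b \<alpha> \<eta>"
    using \<alpha> eta gromov_boundary_closed[OF eta x] unfolding ray_represents_iff by blast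
  have "asymptotic \<alpha> \<beta>" if b: "ray_represents D b \<beta> \<eta>" for \<beta>
  proof -
    have bray: "geodesic_ray \<beta>" using b by (simp add: ray_represents_iff)
    obtain \<beta>' where \<beta>': "geodesic_ray \<beta>'" "\<beta>' 0 = b" "\<forall>s\<ge>0. dist (\<beta>' s) (\<beta> s) \<le> 2 * dist b (\<beta> 0)"
      using asymptotic_ray_from[OF bray, of b] by blast
    then have as: "asymptotic \<beta>' \<beta>" unfolding asymptotic_def by blast
    then have "ray_represents D b \<beta>' \<eta>" using represents_asymptotic[OF b \<beta>'(1)] asymptotic_sym by blast
    then have "comparable (on_ray \<alpha>) (on_ray \<beta>')"
      using rep gromov_boundary_comparable[OF eta] unfolding ray_represents_iff by blast
    then have "\<alpha> R = \<beta>' R" if "0 \<le> R" for R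
      using comparable_rays_agree[OF \<alpha>(1,2) \<beta>'(1,2) _ that] by blast
    then have "asymptotic \<alpha> \<beta>'" unfolding asymptotic_def by (intro exI[of _ 0]) simp
    then show ?thesis using as asymptotic_trans by blast
  qed
  then have "to_visual \<eta> = ray_class \<alpha>"
    unfolding to_visual_def ray_class_def using rep represents_asymptotic
    by (auto simp: ray_represents_iff)
  then show ?thesis using rep \<alpha>(2) by blast
qed

lemma to_visual_in: "\<eta> \<in> gromov_boundary D b \<Longrightarrow> to_visual \<eta> \<in> visual_boundary"
  using ray_to_boundary_point unfolding visual_boundary_eq ray_represents_iff by blast

lemma to_visual_eq:
  assumes "\<xi> \<in> visual_boundary" "\<alpha> \<in> \<xi>" "ray_represents D b \<alpha> \<eta>"
  shows "to_visual \<eta> = \<xi>"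
proof -
  have eta: "\<eta> \<in> gromov_boundary D b" using assms(3) by (simp add: ray_represents_iff)
  have "\<alpha> \<in> to_visual \<eta>" using assms(3) by (simp add: to_visual_def)
  then show ?thesis using visual_boundaryD(2)[OF to_visual_in[OF eta]] visual_boundaryD(2)[OF assms(1,2)] by simp
qed

lemma to_visual_inj: "inj_on to_visual (gromov_boundary D b)"
proof (rule inj_onI)
  fix \<eta> \<theta> assume e: "\<eta> \<in> gromov_boundary D b" and t: "\<theta> \<in> gromov_boundary D b" and eq: "to_visual \<eta> = to_visual \<theta>"
  obtain \<alpha> where "ray_represents D b \<alpha> \<eta>" using ray_to_boundary_point[OF e] by blast
  moreover from this have "ray_represents D b \<alpha> \<theta>" using eq by (auto simp: to_visual_def)
  ultimately show "\<eta> = \<theta>"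
    using gromov_boundary_unique[OF e t, of "on_ray \<alpha>"] by (simp add: ray_represents_iff)
qed

lemma to_visual_image: "to_visual ` gromov_boundary D b = represented_boundary D b"
proof
  show "to_visual ` gromov_boundary D b \<subseteq> represented_boundary D b"
  proof
    fix \<xi> assume "\<xi> \<in> to_visual ` gromov_boundary D b"
    then obtain \<eta> where e: "\<eta> \<in> gromov_boundary D b" "\<xi> = to_visual \<eta>" by blast
    obtain \<alpha> where "ray_represents D b \<alpha> \<eta>" using ray_to_boundary_point[OF e(1)] by blast
    then show "\<xi> \<in> represented_boundary D b"
      using to_visual_in[OF e(1)] e(2) unfolding represented_boundary_def to_visual_def by blast
  qed
  show "represented_boundary D b \<subseteq> to_visual ` gromov_boundary D b"
    using to_visual_eq unfolding represented_boundary_def ray_represents_iff by blast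
qed

subsection \<open>Isometries\<close>

lemma comparable_isometry:
  assumes g: "g \<in> isometries" and c: "comparable x y"
  shows "comparable (g \<circ> x) (g \<circ> y)"
  unfolding comparable_def
proof
  fix M
  obtain N where N: "\<forall>m\<ge>N. \<forall>n\<ge>N. M + 8 * Lam + D b (g b) \<le> sep b (x m) (y n)"
    using c unfolding comparable_def by blast
  have "M \<le> sep b ((g \<circ> x) m) ((g \<circ> y) n)" if "m \<ge> N" "n \<ge> N" for m n
  proof -
    let ?x = "x m" and ?y = "y n"
    have "M + 8 * Lam + D b (g b) \<le> sep b ?x ?y" using N that by blast
    moreover have "\<bar>gromov_product D b ?x ?y - sep b ?x ?y\<bar> \<le> 4 * Lam" by (rule gromov_product_sep)
    moreover have "gromov_product D (g b) (g ?x) (g ?y) = gromov_product D b ?x ?y"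
      by (simp add: gromov_product_def D_isometry[OF g])
    moreover have "gromov_product D (g b) (g ?x) (g ?y) \<le> gromov_product D b (g ?x) (g ?y) + D b (g b)"
      using D_triangle[of "g b" "g ?x" b] D_triangle[of "g b" "g ?y" b] D_commute[of "g b" b]
      unfolding gromov_product_def by (simp add: field_simps)
    moreover have "\<bar>gromov_product D b (g ?x) (g ?y) - sep b (g ?x) (g ?y)\<bar> \<le> 4 * Lam" by (rule gromov_product_sep)
    ultimately show ?thesis by simp
  qed
  then show "\<exists>N. \<forall>m\<ge>N. \<forall>n\<ge>N. M \<le> sep b ((g \<circ> x) m) ((g \<circ> y) n)" by blast
qed

lemma represents_isometry:
  assumes g: "g \<in> isometries" and r: "ray_represents D b \<alpha> \<eta>"
  shows "\<exists>\<theta>. ray_represents D b (g \<circ> \<alpha>) \<theta>"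
proof -
  have ray: "geodesic_ray (g \<circ> \<alpha>)"
    using r isometry_geodesic[OF g] unfolding ray_represents_iff geodesic_ray_def by blast
  have "comparable (on_ray \<alpha>) (on_ray \<alpha>)" using r gromov_boundaryD(2) unfolding ray_represents_iff by blast
  from comparable_isometry[OF g this] have c: "comparable (on_ray (g \<circ> \<alpha>)) (on_ray (g \<circ> \<alpha>))"
    by (simp add: comp_def)
  then show ?thesis using ray gromov_boundaryI[OF c] unfolding ray_represents_iff by blast
qed

lemma boundary_action_class:
  fixes g :: "'a \<Rightarrow> 'a"
  assumes g: "g \<in> isometries" and a: "geodesic_ray \<alpha>"
  shows "boundary_action g (ray_class \<alpha>) = ray_class (g \<circ> \<alpha>)" and "geodesic_ray (g \<circ> \<alpha>)"
proof -
  show "geodesic_ray (g \<circ> \<alpha>)" using a isometry_geodesic[OF g] unfolding geodesic_ray_def by blast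
  note bij = isometry_bij[OF g] and d = isometry_dist[OF g] and gi = isometry_inv[OF g]
  show "boundary_action g (ray_class \<alpha>) = ray_class (g \<circ> \<alpha>)"
  proof
    show "boundary_action g (ray_class \<alpha>) \<subseteq> ray_class (g \<circ> \<alpha>)"
      using isometry_geodesic[OF g] d
      by (auto simp: boundary_action_def ray_class_def asymptotic_def geodesic_ray_def) blast
    show "ray_class (g \<circ> \<alpha>) \<subseteq> boundary_action g (ray_class \<alpha>)"
    proof
      fix \<beta> assume b: "\<beta> \<in> ray_class (g \<circ> \<alpha>)"
      have inv: "g (inv g p) = p" "inv g (g p) = p" for p
        using bij by (auto simp: bij_is_surj surj_f_inv_f bij_is_inj)
      have "\<beta> = g \<circ> (inv g \<circ> \<beta>)" by (simp add: fun_eq_iff inv)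
      moreover have "geodesic_ray (inv g \<circ> \<beta>)"
        using b isometry_geodesic[OF gi] unfolding ray_class_def geodesic_ray_def by blast
      moreover have "dist (\<alpha> t) (inv g (\<beta> t)) = dist (g (\<alpha> t)) (\<beta> t)" for t
        using d[of "\<alpha> t" "inv g (\<beta> t)"] by (simp add: inv)
      then have "asymptotic \<alpha> (inv g \<circ> \<beta>)" using b unfolding ray_class_def asymptotic_def by simp
      ultimately show "\<beta> \<in> boundary_action g (ray_class \<alpha>)"
        unfolding boundary_action_def ray_class_def by blast
    qed
  qed
qed

lemma boundary_action_represented:
  assumes g: "g \<in> isometries" and xi: "\<xi> \<in> represented_boundary D b"
  shows "boundary_action g \<xi> \<in> represented_boundary D b"
proof -
  obtain \<alpha> \<eta> where a: "\<xi> \<in> visual_boundary" "\<alpha> \<in> \<xi>" "ray_represents D b \<alpha> \<eta>"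
    using xi unfolding represented_boundary_def by blast
  note c = visual_boundaryD[OF a(1,2)]
  have "boundary_action g \<xi> = ray_class (g \<circ> \<alpha>)" "geodesic_ray (g \<circ> \<alpha>)"
    using boundary_action_class[OF g c(1)] c(2) by auto
  moreover obtain \<theta> where "ray_represents D b (g \<circ> \<alpha>) \<theta>" using represents_isometry[OF g a(3)] by blast
  ultimately show ?thesis
    unfolding represented_boundary_def visual_boundary_eq using ray_class_in by blast
qed

lemma boundary_action_image:
  assumes g: "g \<in> isometries"
  shows "boundary_action g ` represented_boundary D b = represented_boundary D b"
proof
  show "boundary_action g ` represented_boundary D b \<subseteq> represented_boundary D b"
    using boundary_action_represented[OF g] by blast
  show "represented_boundary D b \<subseteq> boundary_action g ` represented_boundary D b"
  proof
    fix \<xi> assume xi: "\<xi> \<in> represented_boundary D b"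
    have "g (inv g p) = p" for p using isometry_bij[OF g] by (simp add: bij_is_surj surj_f_inv_f)
    then have "boundary_action g (boundary_action (inv g) \<xi>) = \<xi>"
      unfolding boundary_action_def image_image by (simp add: comp_def)
    then show "\<xi> \<in> boundary_action g ` represented_boundary D b"
      using boundary_action_represented[OF isometry_inv[OF g] xi] by (metis imageI)
  qed
qed


section \<open>The embedding\<close>

lemma based_rays_agree:
  assumes "\<xi> \<in> visual_boundary" "\<alpha> \<in> \<xi>" "\<beta> \<in> \<xi>" "\<alpha> 0 = b" "\<beta> 0 = b" "0 \<le> R"
  shows "\<alpha> R = \<beta> R"
proof (rule asymptotic_rays_agree)
  show "geodesic_ray \<alpha>" "geodesic_ray \<beta>" using visual_boundaryD(1) assms by blast+
  show "asymptotic \<alpha> \<beta>" using visual_boundaryD(2)[OF assms(1,2)] assms(3) by (simp add: ray_class_def)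
qed (use assms in auto)

lemma cone_nbhd_iff:
  assumes "\<xi> \<in> visual_boundary" "\<alpha> \<in> \<xi>" "\<alpha> 0 = b" "\<zeta> \<in> visual_boundary" "\<beta> \<in> \<zeta>" "\<beta> 0 = b" "0 \<le> R"
  shows "\<zeta> \<in> cone_nbhd b \<xi> R e \<longleftrightarrow> dist (\<alpha> R) (\<beta> R) < e"
proof
  assume "\<zeta> \<in> cone_nbhd b \<xi> R e"
  then obtain \<alpha>' \<beta>' where "\<alpha>' \<in> \<xi>" "\<beta>' \<in> \<zeta>" "\<alpha>' 0 = b" "\<beta>' 0 = b" "dist (\<alpha>' R) (\<beta>' R) < e"
    unfolding cone_nbhd_def by blast
  then show "dist (\<alpha> R) (\<beta> R) < e"
    using based_rays_agree[of \<xi> \<alpha> \<alpha>' R] based_rays_agree[of \<zeta> \<beta> \<beta>' R] assms by simp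
next
  assume "dist (\<alpha> R) (\<beta> R) < e"
  then show "\<zeta> \<in> cone_nbhd b \<xi> R e" unfolding cone_nbhd_def using assms by blast
qed

lemma topspace_cone_topology: "topspace (cone_topology b) = visual_boundary"
proof -
  have "\<xi> \<in> cone_nbhd b \<xi> 1 1" if xi: "\<xi> \<in> visual_boundary" for \<xi>
  proof -
    obtain \<alpha> where "\<alpha> \<in> \<xi>" "\<alpha> 0 = b" using visual_boundary_ray_from[OF xi, of b] by blast
    then show ?thesis using cone_nbhd_iff[OF xi _ _ xi, of \<alpha> \<alpha> 1 1] by simp
  qed
  moreover have "cone_nbhd b \<xi> R e \<subseteq> visual_boundary" for \<xi> :: "(real \<Rightarrow> 'a) set" and R e
    by (auto simp: cone_nbhd_def)
  moreover have "(0::real) < 1" by simp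
  ultimately show ?thesis
    unfolding cone_topology_def topology_generated_by_topspace by blast
qed

lemma based_ray_represents:
  assumes "ray_represents D b \<beta> \<eta>" "\<beta> 0 = b" "x \<in> \<eta>" "0 \<le> R"
  shows "(\<lambda>n. geo b (x n) R) \<longlonglongrightarrow> \<beta> R"
proof -
  have b: "geodesic_ray \<beta>" "\<eta> \<in> gromov_boundary D b" "on_ray \<beta> \<in> \<eta>"
    using assms(1) by (auto simp: ray_represents_iff)
  obtain \<alpha> where \<alpha>: "geodesic_ray \<alpha>" "\<alpha> 0 = b" "comparable x (on_ray \<alpha>)" "(\<lambda>n. geo b (x n) R) \<longlonglongrightarrow> \<alpha> R"
    using limit_ray[OF gromov_boundaryD(2)[OF b(2) assms(3)]] assms(4) by blast
  have "comparable (on_ray \<alpha>) (on_ray \<beta>)"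
    using comparable_trans[OF comparable_sym[OF \<alpha>(3)] gromov_boundary_comparable[OF b(2) assms(3) b(3)]] .
  then have "\<alpha> R = \<beta> R" by (rule comparable_rays_agree[OF \<alpha>(1,2) b(1) assms(2) _ assms(4)])
  then show ?thesis using \<alpha>(4) by simp
qed

text \<open>
  A large Gromov product of \<open>\<eta>\<close> and \<open>\<theta>\<close> makes the rays to them fellow-travel; the number \<open>M\<close> is chosen so that
  their distance at time \<open>R\<close> is less than the margin \<open>d\<close> by which \<open>\<eta>\<close> lies in the given cone neighbourhood.
\<close>
lemma continuous_to_visual: "continuous_map (gromov_topology D b) (cone_topology b) to_visual"
  unfolding cone_topology_def continuous_on_generated_topo_iff topspace_gromov_topology
proof (intro conjI allI impI)
  show "to_visual ` gromov_boundary D b \<subseteq> \<Union>{cone_nbhd b \<xi> R e | \<xi> R e. \<xi> \<in> visual_boundary \<and> 0 < R \<and> 0 < e}"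
    using to_visual_in topspace_cone_topology unfolding cone_topology_def topology_generated_by_topspace by blast
  fix U assume "U \<in> {cone_nbhd b \<xi> R e | \<xi> R e. \<xi> \<in> visual_boundary \<and> 0 < R \<and> 0 < e}"
  then obtain \<xi> R e where U: "U = cone_nbhd b \<xi> R e" and xi: "\<xi> \<in> visual_boundary" and R: "0 < R" and "0 < e" by blast
  obtain \<alpha> where \<alpha>: "\<alpha> \<in> \<xi>" "\<alpha> 0 = b" using visual_boundary_ray_from[OF xi, of b] by blast
  have mem: "to_visual \<eta> \<in> U \<longleftrightarrow> dist (\<alpha> R) (\<beta> R) < e"
    if "ray_represents D b \<beta> \<eta>" "\<beta> 0 = b" "\<eta> \<in> gromov_boundary D b" for \<beta> \<eta>
    unfolding U using cone_nbhd_iff[of \<xi> \<alpha> "to_visual \<eta>" \<beta> R e] xi \<alpha> to_visual_in[OF that(3)] that R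
    by (simp add: to_visual_def)
  show "openin (gromov_topology D b) (to_visual -` U \<inter> gromov_boundary D b)"
    unfolding openin_gromov_topology gromov_open_def
  proof (intro conjI ballI)
    fix \<eta> assume "\<eta> \<in> to_visual -` U \<inter> gromov_boundary D b"
    then have eta: "\<eta> \<in> gromov_boundary D b" "to_visual \<eta> \<in> U" by auto
    obtain \<beta> where \<beta>: "ray_represents D b \<beta> \<eta>" "\<beta> 0 = b" using ray_to_boundary_point[OF eta(1)] by blast
    define d where "d = e - dist (\<alpha> R) (\<beta> R)"
    have d: "0 < d" using mem[OF \<beta> eta(1)] eta(2) by (simp add: d_def)
    define M where "M = max (max 8 (2 * R)) (8 * R / d + 1)"
    have M: "8 \<le> M" "2 * R \<le> M" "8 * R / d < M" by (auto simp: M_def)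
    define r where "r = M * Lam + 4 * Lam + 1"
    have "\<theta> \<in> to_visual -` U \<inter> gromov_boundary D b"
      if th: "\<theta> \<in> gromov_boundary D b" and le: "ereal r \<le> boundary_gromov_product D b \<eta> \<theta>" for \<theta>
    proof -
      obtain \<gamma> where \<gamma>: "ray_represents D b \<gamma> \<theta>" "\<gamma> 0 = b" using ray_to_boundary_point[OF th] by blast
      have "ereal (r - 1) < boundary_gromov_product D b \<eta> \<theta>" using le by (rule less_le_trans[rotated]) simp
      then obtain x y where xy: "x \<in> \<eta>" "y \<in> \<theta>" and
        lim: "ereal (r - 1) < Liminf (sequentially \<times>\<^sub>F sequentially) (\<lambda>(m, n). ereal (gromov_product D b (x m) (y n)))"
        unfolding boundary_gromov_product_def less_SUP_iff by auto
      obtain N where N: "\<forall>m\<ge>N. \<forall>n\<ge>N. r - 1 < gromov_product D b (x m) (y n)"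
        using less_LiminfD[OF lim] by (auto simp: case_prod_unfold eventually_prod_sequentially)
      have "dist (geo b (x n) R) (geo b (y n) R) \<le> 8 * R / M" if "n \<ge> N" for n
      proof (rule fellow_travel)
        have "r - 1 < gromov_product D b (x n) (y n)" using N that by blast
        then show "M * Lam < sep b (x n) (y n)" using gromov_product_sep[of b "x n" "y n"] unfolding r_def by linarith
      qed (use M R in auto)
      then have "\<forall>\<^sub>F n in sequentially. dist (geo b (x n) R) (geo b (y n) R) \<le> 8 * R / M"
        unfolding eventually_sequentially by blast
      moreover have "(\<lambda>n. dist (geo b (x n) R) (geo b (y n) R)) \<longlonglongrightarrow> dist (\<beta> R) (\<gamma> R)"
        by (intro tendsto_dist based_ray_represents[OF \<beta>] based_ray_represents[OF \<gamma>] xy) (use R in auto)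
      ultimately have "dist (\<beta> R) (\<gamma> R) \<le> 8 * R / M" using tendsto_upperbound by fastforce
      also have "\<dots> < d" using M d by (simp add: field_simps)
      finally have "dist (\<alpha> R) (\<gamma> R) < e" using dist_triangle[of "\<alpha> R" "\<gamma> R" "\<beta> R"] unfolding d_def by linarith
      then show ?thesis using mem[OF \<gamma> th] th by simp
    qed
    then show "\<exists>r. \<forall>\<theta>\<in>gromov_boundary D b. ereal r \<le> boundary_gromov_product D b \<eta> \<theta> \<longrightarrow>
        \<theta> \<in> to_visual -` U \<inter> gromov_boundary D b" by blast
  qed auto
qed

text \<open>Once separated from \<open>b\<close>, a ray from \<open>b\<close> stays so.\<close>
lemma sep_along_ray:
  assumes "geodesic_ray \<alpha>" "\<alpha> 0 = b" "0 \<le> s" "s \<le> t"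
  shows "sep b (\<alpha> s) (\<alpha> s) \<le> sep b (\<alpha> s) (\<alpha> t) + 5 * Lam"
proof -
  have "geo b (\<alpha> t) s = \<alpha> s" using ray_geo[of \<alpha> s t] assms by simp
  moreover have "dist b (\<alpha> t) = t" using ray_dist[of \<alpha> 0 t] assms by simp
  ultimately show ?thesis using sep_on_geodesic[of s b "\<alpha> t"] assms by simp
qed

text \<open>
  Choose a point \<open>p\<close> on the ray to \<open>\<eta>\<close> that is well separated from \<open>b\<close>. If the ray to \<open>\<theta>\<close> passes within one of
  \<open>p\<close>, it is as well separated there and stays so, since geodesics are rough geodesics; so the Gromov
  product of \<open>\<eta>\<close> and \<open>\<theta>\<close> is large.
\<close>
lemma open_to_visual:
  assumes U: "gromov_open D b U" and eta: "\<eta> \<in> U"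
  shows "\<exists>V. openin (cone_topology b) V \<and> to_visual \<eta> \<in> V \<and> V \<inter> to_visual ` gromov_boundary D b \<subseteq> to_visual ` U"
proof -
  have etaB: "\<eta> \<in> gromov_boundary D b" using U eta unfolding gromov_open_def by blast
  obtain r where r: "\<And>\<theta>. \<lbrakk>\<theta> \<in> gromov_boundary D b; ereal r \<le> boundary_gromov_product D b \<eta> \<theta>\<rbrakk> \<Longrightarrow> \<theta> \<in> U"
    using U eta unfolding gromov_open_def by blast
  obtain \<alpha> where \<alpha>: "ray_represents D b \<alpha> \<eta>" "\<alpha> 0 = b" using ray_to_boundary_point[OF etaB] by blast
  have aray: "geodesic_ray \<alpha>" "on_ray \<alpha> \<in> \<eta>" using \<alpha>(1) by (auto simp: ray_represents_iff)
  \<comment> \<open>The losses are \<open>2\<close> between the rays, \<open>5\<close> along the second one, twice \<open>3\<close> for hyperbolicity, and \<open>4\<close> for the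
      Gromov product.\<close>
  obtain N where N: "\<forall>m\<ge>N. \<forall>n\<ge>N. r + 17 * Lam \<le> sep b (on_ray \<alpha> m) (on_ray \<alpha> n)"
    using gromov_boundaryD(2)[OF etaB aray(2)] unfolding comparable_def by blast
  define k where "k = max N 1"
  define V where "V = cone_nbhd b (to_visual \<eta>) (real k) 1"
  have "openin (cone_topology b) V"
    unfolding cone_topology_def V_def
    by (rule topology_generated_by_Basis) (use to_visual_in[OF etaB] in \<open>auto simp: k_def intro!: exI\<close>)
  moreover have mem: "to_visual \<theta> \<in> V \<longleftrightarrow> dist (\<alpha> (real k)) (\<beta> (real k)) < 1"
    if "ray_represents D b \<beta> \<theta>" "\<beta> 0 = b" "\<theta> \<in> gromov_boundary D b" for \<beta> \<theta>
    unfolding V_def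
    using cone_nbhd_iff[of "to_visual \<eta>" \<alpha> "to_visual \<theta>" \<beta> "real k" 1] to_visual_in[OF etaB]
      to_visual_in[OF that(3)] \<alpha> that
    by (simp add: to_visual_def)
  moreover have "to_visual \<theta> \<in> to_visual ` U" if th: "\<theta> \<in> gromov_boundary D b" "to_visual \<theta> \<in> V" for \<theta>
  proof -
    obtain \<beta> where \<beta>: "ray_represents D b \<beta> \<theta>" "\<beta> 0 = b" using ray_to_boundary_point[OF th(1)] by blast
    have bray: "geodesic_ray \<beta>" "on_ray \<beta> \<in> \<theta>" using \<beta>(1) by (auto simp: ray_represents_iff)
    have near: "dist (\<alpha> (real k)) (\<beta> (real k)) < 1" using mem[OF \<beta> th(1)] th(2) by blast
    let ?p = "\<alpha> (real k)" and ?q = "\<beta> (real k)"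
    have "N \<le> k" by (simp add: k_def)
    then have pp: "r + 17 * Lam \<le> sep b ?p ?p" using N by blast
    have "(dist ?p ?q + 1) * Lam \<le> 2 * Lam" using near Lam_pos by (intro mult_right_mono) auto
    then have "sep b ?p ?p \<le> sep b ?q ?p + 2 * Lam" using sep_perturb[of b ?p ?p ?q] by linarith
    then have pq: "r + 15 * Lam \<le> sep b ?p ?q" "r + 15 * Lam \<le> sep b ?q ?q"
      using pp sep_le_left[of b ?q ?p] by (simp_all add: sep_commute)
    have "r \<le> gromov_product D b (on_ray \<alpha> m) (on_ray \<beta> n)" if mn: "k \<le> m" "k \<le> n" for m n
    proof -
      have "sep b ?q ?q \<le> sep b ?q (on_ray \<beta> n) + 5 * Lam"
        by (rule sep_along_ray[OF bray(1) \<beta>(2)]) (use mn in auto)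
      then have "(r + 7 * Lam) + 3 * Lam \<le> sep b ?q (on_ray \<beta> n)" using pq(2) Lam_pos by linarith
      moreover have "(r + 7 * Lam) + 3 * Lam \<le> sep b ?p ?q" using pq(1) Lam_pos by linarith
      ultimately have "(r + 4 * Lam) + 3 * Lam \<le> sep b ?p (on_ray \<beta> n)" using sep_hyperbolic_ge by fastforce
      moreover have "r + 17 * Lam \<le> sep b (on_ray \<alpha> m) ?p" using N mn \<open>N \<le> k\<close> by auto
      then have "(r + 4 * Lam) + 3 * Lam \<le> sep b (on_ray \<alpha> m) ?p" using Lam_pos by linarith
      ultimately have "r + 4 * Lam \<le> sep b (on_ray \<alpha> m) (on_ray \<beta> n)" using sep_hyperbolic_ge by blast
      then show ?thesis using gromov_product_sep[of b "on_ray \<alpha> m" "on_ray \<beta> n"] by linarith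
    qed
    then have "\<forall>\<^sub>F z in sequentially \<times>\<^sub>F sequentially.
        ereal r \<le> (case z of (m, n) \<Rightarrow> ereal (gromov_product D b (on_ray \<alpha> m) (on_ray \<beta> n)))"
      by (auto simp: case_prod_unfold eventually_prod_sequentially)
    then have "ereal r \<le> Liminf (sequentially \<times>\<^sub>F sequentially)
        (\<lambda>(m, n). ereal (gromov_product D b (on_ray \<alpha> m) (on_ray \<beta> n)))"
      by (rule Liminf_bounded)
    also have "\<dots> \<le> boundary_gromov_product D b \<eta> \<theta>"
      unfolding boundary_gromov_product_def by (rule SUP_upper2[of "(on_ray \<alpha>, on_ray \<beta>)"]) (use aray bray in auto)
    finally show ?thesis using r[OF th(1)] by blast
  qed
  moreover have "to_visual \<eta> \<in> V" using mem[OF \<alpha> etaB] by simp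
  ultimately show ?thesis by blast
qed

lemma embedding_to_visual: "embedding_map (gromov_topology D b) (cone_topology b) to_visual"
  unfolding embedding_map_def topspace_gromov_topology
proof (rule bijective_open_imp_homeomorphic_map)
  let ?S = "to_visual ` gromov_boundary D b"
  show "continuous_map (gromov_topology D b) (subtopology (cone_topology b) ?S) to_visual"
    using continuous_to_visual by (auto simp: continuous_map_in_subtopology topspace_gromov_topology)
  show "open_map (gromov_topology D b) (subtopology (cone_topology b) ?S) to_visual"
    unfolding open_map_def
  proof (intro allI impI)
    fix U assume "openin (gromov_topology D b) U"
    then have U: "gromov_open D b U" by (simp add: openin_gromov_topology)
    then have sub: "U \<subseteq> gromov_boundary D b" by (simp add: gromov_open_def)
    show "openin (subtopology (cone_topology b) ?S) (to_visual ` U)"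
    proof (subst openin_subopen, intro ballI)
      fix \<xi> assume "\<xi> \<in> to_visual ` U"
      then obtain \<eta> where \<eta>: "\<eta> \<in> U" "\<xi> = to_visual \<eta>" by blast
      obtain V where V: "openin (cone_topology b) V" "to_visual \<eta> \<in> V" "V \<inter> ?S \<subseteq> to_visual ` U"
        using open_to_visual[OF U \<eta>(1)] by blast
      have "openin (subtopology (cone_topology b) ?S) (V \<inter> ?S)" using V(1) by (rule openin_subtopology_Int)
      moreover have "\<xi> \<in> V \<inter> ?S" using V(2) \<eta> sub by blast
      ultimately show "\<exists>T. openin (subtopology (cone_topology b) ?S) T \<and> \<xi> \<in> T \<and> T \<subseteq> to_visual ` U" using V(3) by blast
    qed
  qed
  have "?S \<subseteq> topspace (cone_topology b)" using to_visual_in topspace_cone_topology by blast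
  then show "to_visual ` topspace (gromov_topology D b) = topspace (subtopology (cone_topology b) ?S)"
    by (auto simp: topspace_gromov_topology topspace_subtopology)
  show "inj_on to_visual (topspace (gromov_topology D b))"
    using to_visual_inj by (simp add: topspace_gromov_topology)
qed

section \<open>Visibility\<close>

lemma geo_change_start:
  fixes x x' y :: 'a
  assumes R: "0 \<le> R" "R \<le> dist x y" "R \<le> dist x' y"
  shows "dist (geo x y R) (geo x' y R) \<le> 2 * dist x x'"
proof (cases "dist x y = 0")
  case True
  then show ?thesis using R by simp
next
  case False
  define d d' where "d = dist x y" and "d' = dist x' y"
  have d: "0 < d" using False by (simp add: d_def)
  define l where "l = (d - R) / d"
  have l: "0 \<le> l" "l \<le> 1" using R d by (auto simp: l_def d_def)
  define u where "u = R / d * d'"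
  have Rd: "0 \<le> R / d" "R / d \<le> 1" using R d by (auto simp: d_def)
  have u: "0 \<le> u" "u \<le> d'"
    unfolding u_def using Rd by (auto simp only: d'_def intro!: mult_left_le_one_le mult_nonneg_nonneg zero_le_dist)
  have 1: "geo y x (l * dist y x) = geo x y R"
    using geo_reverse[of "d - R" x y] R d by (simp add: l_def d_def dist_commute)
  have "l * d' = d' - u" using d by (simp add: l_def u_def field_simps)
  then have 2: "geo y x' (l * dist y x') = geo x' y u"
    using geo_reverse[of "d' - u" x' y] u by (simp add: d'_def dist_commute)
  have "dist (geo x y R) (geo x' y u) \<le> l * dist x x'"
    using geo_fan_ratio[OF l, of y x x'] unfolding 1 2 .
  also have "\<dots> \<le> dist x x'" using l by (simp add: mult_left_le_one_le)
  finally have "dist (geo x y R) (geo x' y u) \<le> dist x x'" .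
  moreover have "dist (geo x' y u) (geo x' y R) \<le> dist x x'"
  proof -
    have "u - R = R / d * (d' - d)" using d by (simp add: u_def field_simps)
    then have "\<bar>u - R\<bar> = R / d * \<bar>d' - d\<bar>" using Rd R d by (simp add: abs_mult)
    also have "\<dots> \<le> 1 * \<bar>d' - d\<bar>" using Rd by (intro mult_right_mono) auto
    also have "\<dots> \<le> dist x x'"
      using dist_triangle[of x y x'] dist_triangle[of x' y x] by (simp add: d_def d'_def dist_commute abs_le_iff)
    finally show ?thesis using dist_geo[of u x' y R] u R by (simp add: d'_def)
  qed
  ultimately show ?thesis using dist_triangle[of "geo x y R" "geo x' y R" "geo x' y u"] by linarith
qed

text \<open>
  The points of the geodesics in the ball subconverge to some \<open>q\<close>. From there the two halves converge to the
  rays that are asymptotic to \<open>\<alpha>\<close> and \<open>\<beta>\<close>, and together these form a line.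
\<close>
lemma line_between_rays:
  assumes a: "geodesic_ray \<alpha>" "\<alpha> 0 = b" and be: "geodesic_ray \<beta>" "\<beta> 0 = b"
    and pass: "\<And>n. N \<le> n \<Longrightarrow> \<exists>k\<in>{0..dist (on_ray \<beta> n) (on_ray \<alpha> n)}. dist b (geo (on_ray \<beta> n) (on_ray \<alpha> n) k) \<le> E"
  shows "\<exists>\<gamma>. geodesic_on UNIV \<gamma> \<and> asymptotic \<alpha> \<gamma> \<and> asymptotic \<beta> (\<lambda>t. \<gamma> (- t))"
proof -
  obtain k where k: "\<And>n. N \<le> n \<Longrightarrow> 0 \<le> k n \<and> k n \<le> dist (on_ray \<beta> n) (on_ray \<alpha> n) \<and>
      dist b (geo (on_ray \<beta> n) (on_ray \<alpha> n) (k n)) \<le> E"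
    using pass by (metis atLeastAtMost_iff)
  define p where "p n = geo (on_ray \<beta> (n + N)) (on_ray \<alpha> (n + N)) (k (n + N))" for n
  have "\<forall>n. p n \<in> cball b E"
  proof
    show "p n \<in> cball b E" for n using k[of "n + N"] by (simp add: p_def)
  qed
  then obtain q r where q: "strict_mono (r :: nat \<Rightarrow> nat)" "(p \<circ> r) \<longlonglongrightarrow> q"
    using proper[of b E] unfolding compact_def by blast
  define f where "f n = r n + N" for n
  have f: "filterlim f at_top sequentially" "N \<le> f n" for n
  proof -
    have "filterlim r at_top sequentially" using q(1) by (rule filterlim_subseq)
    then show "filterlim f at_top sequentially"
      unfolding f_def by (rule filterlim_at_top_mono) auto
  qed (simp add: f_def)
  define y z w where "y n = on_ray \<alpha> (f n)" and "z n = on_ray \<beta> (f n)" and "w n = p (r n)" for n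
  have "w = p \<circ> r" by (simp add: fun_eq_iff w_def)
  then have w: "w \<longlonglongrightarrow> q" using q(2) by simp
  have kf: "0 \<le> k (f n)" "k (f n) \<le> dist (z n) (y n)" "w n = geo (z n) (y n) (k (f n))" for n
    using k[OF f(2)[of n]] by (auto simp: y_def z_def w_def p_def f_def)
  obtain \<alpha>1 where a1: "geodesic_ray \<alpha>1" "\<alpha>1 0 = q" "\<forall>s\<ge>0. dist (\<alpha>1 s) (\<alpha> s) \<le> 2 * dist q (\<alpha> 0)"
    "\<And>R. 0 \<le> R \<Longrightarrow> (\<lambda>n. geo q (on_ray \<alpha> n) R) \<longlonglongrightarrow> \<alpha>1 R"
    using asymptotic_ray_from[OF a(1), of q] by blast
  obtain \<beta>1 where b1: "geodesic_ray \<beta>1" "\<beta>1 0 = q" "\<forall>s\<ge>0. dist (\<beta>1 s) (\<beta> s) \<le> 2 * dist q (\<beta> 0)"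
    "\<And>R. 0 \<le> R \<Longrightarrow> (\<lambda>n. geo q (on_ray \<beta> n) R) \<longlonglongrightarrow> \<beta>1 R"
    using asymptotic_ray_from[OF be(1), of q] by blast
  have far: "\<forall>\<^sub>F n in sequentially. s \<le> dist (w n) (on_ray \<delta> (f n)) \<and> s \<le> dist q (on_ray \<delta> (f n))"
    if d: "geodesic_ray \<delta>" "\<delta> 0 = b" for s \<delta>
  proof -
    have "\<forall>\<^sub>F n in sequentially. s + dist q b + 1 \<le> real (f n)"
      using filterlim_compose[OF filterlim_real_sequentially f(1)] unfolding filterlim_at_top by blast
    moreover have "\<forall>\<^sub>F n in sequentially. dist (w n) q < 1" using tendstoD[OF w, of 1] by simp
    ultimately show ?thesis
    proof eventually_elim
      case (elim n)
      have "dist b (on_ray \<delta> (f n)) = real (f n)" using ray_dist[OF d(1), of 0 "real (f n)"] d(2) by simp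
      moreover have "dist b (on_ray \<delta> (f n)) \<le> dist q b + dist q (on_ray \<delta> (f n))"
        "dist q (on_ray \<delta> (f n)) \<le> dist (w n) q + dist (w n) (on_ray \<delta> (f n))"
        by (metis dist_commute dist_triangle)+
      ultimately show ?case using elim by linarith
    qed
  qed
  have half: "(\<lambda>n. geo (w n) (on_ray \<delta> (f n)) R) \<longlonglongrightarrow> \<delta>1 R"
    if d: "geodesic_ray \<delta>" "\<delta> 0 = b" and lim: "(\<lambda>n. geo q (on_ray \<delta> n) R) \<longlonglongrightarrow> \<delta>1 R" and R: "0 \<le> R" for \<delta> \<delta>1 R
  proof (subst tendsto_dist_iff, rule tendsto_sandwich[where f = "\<lambda>_. 0"])
    have lim': "(\<lambda>n. geo q (on_ray \<delta> (f n)) R) \<longlonglongrightarrow> \<delta>1 R" by (rule filterlim_compose[OF lim f(1)])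
    have "(\<lambda>n. 2 * dist q (w n) + dist (geo q (on_ray \<delta> (f n)) R) (\<delta>1 R))
        \<longlonglongrightarrow> 2 * dist q q + dist (\<delta>1 R) (\<delta>1 R)"
      by (intro tendsto_intros w lim')
    then show "(\<lambda>n. 2 * dist q (w n) + dist (geo q (on_ray \<delta> (f n)) R) (\<delta>1 R)) \<longlonglongrightarrow> 0" by simp
    show "\<forall>\<^sub>F n in sequentially. dist (geo (w n) (on_ray \<delta> (f n)) R) (\<delta>1 R)
        \<le> 2 * dist q (w n) + dist (geo q (on_ray \<delta> (f n)) R) (\<delta>1 R)"
      using far[OF d, of R]
    proof eventually_elim
      case (elim n)
      have "dist (geo q (on_ray \<delta> (f n)) R) (geo (w n) (on_ray \<delta> (f n)) R) \<le> 2 * dist q (w n)"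
        by (rule geo_change_start) (use elim R in auto)
      then show ?case
        using dist_triangle3[of "geo (w n) (on_ray \<delta> (f n)) R" "\<delta>1 R" "geo q (on_ray \<delta> (f n)) R"] by linarith
    qed
  qed auto
  have cross: "dist (\<alpha>1 s) (\<beta>1 t) = s + t" if st: "0 \<le> s" "0 \<le> t" for s t
  proof -
    have "(\<lambda>n. dist (geo (w n) (y n) s) (geo (w n) (z n) t)) \<longlonglongrightarrow> dist (\<alpha>1 s) (\<beta>1 t)"
      unfolding y_def z_def
      by (intro tendsto_dist half[OF a a1(4)] half[OF be b1(4)] st)
    moreover have "\<forall>\<^sub>F n in sequentially. dist (geo (w n) (y n) s) (geo (w n) (z n) t) = s + t"
      using far[OF a, of s] far[OF be, of t]
    proof eventually_elim
      case (elim n)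
      define \<kappa> where "\<kappa> = k (f n)"
      have \<kappa>: "0 \<le> \<kappa>" "\<kappa> \<le> dist (z n) (y n)" "w n = geo (z n) (y n) \<kappa>" using kf[of n] by (auto simp: \<kappa>_def)
      have s: "\<kappa> + s \<le> dist (z n) (y n)" using elim \<kappa> dist_geo_right[OF \<kappa>(1,2)] by (simp add: y_def)
      have dzw: "dist (z n) (w n) = \<kappa>" using dist_geo_left[OF \<kappa>(1,2)] \<kappa>(3) by simp
      then have t: "t \<le> \<kappa>" using elim by (simp add: z_def dist_commute)
      have "geo (w n) (y n) s = geo (z n) (y n) (\<kappa> + s)" using geo_tail[OF st(1) \<kappa>(1) s] \<kappa>(3) by simp
      moreover have "geo (w n) (z n) t = geo (z n) (w n) (\<kappa> - t)"
        using geo_reverse[of t "z n" "w n"] st t dzw by simp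
      moreover have "geo (z n) (w n) (\<kappa> - t) = geo (z n) (y n) (\<kappa> - t)"
        unfolding \<kappa>(3) by (rule geo_init) (use st t \<kappa> in auto)
      ultimately show ?case using dist_geo[of "\<kappa> + s" "z n" "y n" "\<kappa> - t"] st s t \<kappa> by simp
    qed
    then have "(\<lambda>n. dist (geo (w n) (y n) s) (geo (w n) (z n) t)) \<longlonglongrightarrow> s + t" by (rule tendsto_eventually)
    ultimately show ?thesis by (rule LIMSEQ_unique)
  qed
  define \<gamma> where "\<gamma> t = (if 0 \<le> t then \<alpha>1 t else \<beta>1 (- t))" for t
  have "dist (\<gamma> s) (\<gamma> t) = \<bar>s - t\<bar>" for s t
    using ray_dist[OF a1(1), of s t] ray_dist[OF b1(1), of "- s" "- t"] cross[of s "- t"] cross[of t "- s"]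
    unfolding \<gamma>_def by (auto simp: dist_commute)
  then have "geodesic_on UNIV \<gamma>" by (simp add: geodesic_on_def)
  moreover have "dist (\<alpha> t) (\<gamma> t) \<le> 2 * dist q (\<alpha> 0)" if "0 \<le> t" for t
    using a1(3) that by (simp add: \<gamma>_def dist_commute)
  then have "asymptotic \<alpha> \<gamma>" unfolding asymptotic_def by blast
  moreover have "dist (\<beta> t) (\<gamma> (- t)) \<le> 2 * dist q (\<beta> 0)" if "0 \<le> t" for t
    using b1(3) that a1(2) b1(2) by (cases "t = 0") (auto simp: \<gamma>_def dist_commute)
  then have "asymptotic \<beta> (\<lambda>t. \<gamma> (- t))" unfolding asymptotic_def by blast
  ultimately show ?thesis by blast
qed

lemma sep_between_distinct_rays:
  assumes a: "geodesic_ray \<alpha>" "\<alpha> 0 = b" and be: "geodesic_ray \<beta>" "\<beta> 0 = b" and ne: "\<not> asymptotic \<alpha> \<beta>"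
  shows "\<exists>M T. \<forall>s\<ge>T. \<forall>t\<ge>T. 0 \<le> T \<and> sep b (\<alpha> s) (\<beta> t) \<le> M"
proof -
  obtain R where R: "0 \<le> R" "\<alpha> R \<noteq> \<beta> R"
    using ne unfolding asymptotic_def by (metis dist_self order_refl)
  define M where "M = max (max 8 (2 * R)) (8 * R / dist (\<alpha> R) (\<beta> R) + 1)"
  have M: "8 \<le> M" "2 * R \<le> M" "8 * R / dist (\<alpha> R) (\<beta> R) < M" by (auto simp: M_def)
  have "sep b (\<alpha> s) (\<beta> t) \<le> M * Lam" if st: "R \<le> s" "R \<le> t" for s t
  proof (rule ccontr)
    assume "\<not> ?thesis"
    then have "dist (geo b (\<alpha> s) R) (geo b (\<beta> t) R) \<le> 8 * R / M"
      by (intro fellow_travel) (use M R in auto)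
    then have "dist (\<alpha> R) (\<beta> R) \<le> 8 * R / M"
      using ray_geo[OF a(1) R(1) st(1)] ray_geo[OF be(1) R(1) st(2)] a(2) be(2) by simp
    then show False using M R by (simp add: field_simps)
  qed
  then show ?thesis using R(1) by blast
qed

lemma diverging_ray:
  assumes "ray_represents D b \<alpha> \<eta>"
  shows "\<exists>n. N \<le> n \<and> M \<le> sep b (on_ray \<alpha> n) (on_ray \<alpha> n)"
proof -
  have "comparable (on_ray \<alpha>) (on_ray \<alpha>)" using assms gromov_boundaryD(2) unfolding ray_represents_iff by blast
  then obtain N' where "\<forall>m\<ge>N'. \<forall>n\<ge>N'. M \<le> sep b (on_ray \<alpha> m) (on_ray \<alpha> n)" unfolding comparable_def by blast
  then show ?thesis by (intro exI[of _ "max N N'"]) auto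
qed

lemma geodesics_to_ray_pass_near:
  assumes a: "geodesic_ray \<alpha>" "\<alpha> 0 = b" and st: "0 \<le> s" "s \<le> t"
    and gap: "sep b (\<alpha> s) c + 10 * Lam < sep b (\<alpha> s) (\<alpha> s)"
  shows "\<exists>m\<in>{0..dist c (\<alpha> t)}. dist b (geo c (\<alpha> t) m) \<le> 2 * s"
proof -
  have "geo b (\<alpha> t) s = \<alpha> s" "dist b (\<alpha> t) = t"
    using ray_geo[OF a(1) st] ray_dist[OF a(1), of 0 t] st a(2) by auto
  then show ?thesis using geodesic_passes_near[of s b "\<alpha> t" c] st gap by simp
qed

text \<open>
  Rays to distinct points have bounded weighted separation from each other, so once the ray to \<open>\<xi>\<close> is more
  separated from \<open>b\<close> than that, all geodesics between the rays pass near \<open>b\<close>.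
\<close>
lemma visibility:
  assumes xi: "\<xi> \<in> represented_boundary D b"
  shows "visibility_point \<xi>"
  unfolding visibility_point_def
proof (intro conjI ballI)
  obtain \<eta> where eta: "\<eta> \<in> gromov_boundary D b" "\<xi> = to_visual \<eta>" using xi to_visual_image by blast
  show xiV: "\<xi> \<in> visual_boundary" using eta to_visual_in by blast
  obtain \<alpha> where \<alpha>: "ray_represents D b \<alpha> \<eta>" "\<alpha> 0 = b" "\<xi> = ray_class \<alpha>"
    using ray_to_boundary_point[OF eta(1)] eta(2) by blast
  have aray: "geodesic_ray \<alpha>" using \<alpha>(1) by (simp add: ray_represents_iff)
  fix \<zeta> assume z: "\<zeta> \<in> visual_boundary - {\<xi>}"
  then obtain \<beta> where \<beta>: "\<beta> \<in> \<zeta>" "\<beta> 0 = b" using visual_boundary_ray_from[of \<zeta> b] by blast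
  have \<beta>': "geodesic_ray \<beta>" "\<zeta> = ray_class \<beta>" using visual_boundaryD[OF _ \<beta>(1)] z by blast+
  have "\<not> asymptotic \<alpha> \<beta>" using ray_class_eq z \<alpha>(3) \<beta>'(2) by blast
  then obtain M T where MT: "\<forall>s\<ge>T. \<forall>t\<ge>T. 0 \<le> T \<and> sep b (\<alpha> s) (\<beta> t) \<le> M"
    using sep_between_distinct_rays[OF aray \<alpha>(2) \<beta>'(1) \<beta>(2)] by blast
  obtain S where S: "nat \<lceil>T\<rceil> \<le> S" "M + 10 * Lam + 1 \<le> sep b (on_ray \<alpha> S) (on_ray \<alpha> S)"
    using diverging_ray[OF \<alpha>(1)] by blast
  have TS: "T \<le> real S" using S(1) by linarith
  have "\<exists>\<gamma>. geodesic_on UNIV \<gamma> \<and> asymptotic \<alpha> \<gamma> \<and> asymptotic \<beta> (\<lambda>t. \<gamma> (- t))"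
  proof (rule line_between_rays[OF aray \<alpha>(2) \<beta>'(1) \<beta>(2)])
    fix n assume n: "S \<le> n"
    have "sep b (\<alpha> (real S)) (\<beta> (real n)) \<le> M" using MT TS n by (meson of_nat_le_iff order_trans)
    then show "\<exists>k\<in>{0..dist (on_ray \<beta> n) (on_ray \<alpha> n)}. dist b (geo (on_ray \<beta> n) (on_ray \<alpha> n) k) \<le> 2 * real S"
      by (intro geodesics_to_ray_pass_near[OF aray \<alpha>(2)]) (use S(2) n in auto)
  qed
  then obtain \<gamma> where g: "geodesic_on UNIV \<gamma>" "asymptotic \<alpha> \<gamma>" "asymptotic \<beta> (\<lambda>t. \<gamma> (- t))" by blast
  have "geodesic_ray \<gamma>" "geodesic_ray (\<lambda>t. \<gamma> (- t))"
    using g(1) by (auto intro!: geodesic_rayI simp: geodesic_on_def)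
  then show "\<exists>\<gamma>. geodesic_on UNIV \<gamma> \<and> \<gamma> \<in> \<xi> \<and> (\<lambda>t. \<gamma> (- t)) \<in> \<zeta>"
    using g \<alpha>(3) \<beta>'(2) unfolding ray_class_def by blast
qed

section \<open>Density\<close>

lemma ray_dist_mono:
  assumes a: "geodesic_ray \<alpha>" "\<alpha> 0 = b" and be: "geodesic_ray \<beta>" "\<beta> 0 = b" and R: "0 < R" "R \<le> t"
  shows "dist (\<alpha> R) (\<beta> R) \<le> dist (\<alpha> t) (\<beta> t)"
proof -
  have d: "dist b (\<alpha> t) = t" "dist b (\<beta> t) = t" using ray_dist[OF a(1), of 0 t] ray_dist[OF be(1), of 0 t] a be R by auto
  have "dist (geo b (\<alpha> t) R) (geo b (\<beta> t) R) \<le> R / t * dist (geo b (\<alpha> t) t) (geo b (\<beta> t) t)"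
    by (rule geo_fan) (use d R in auto)
  then have "dist (\<alpha> R) (\<beta> R) \<le> R / t * dist (\<alpha> t) (\<beta> t)"
    using ray_geo[OF a(1), of R t] ray_geo[OF be(1), of R t] ray_geo[OF a(1), of t t] ray_geo[OF be(1), of t t] a be R by simp
  also have "\<dots> \<le> 1 * dist (\<alpha> t) (\<beta> t)" using R by (intro mult_right_mono) auto
  finally show ?thesis by simp
qed

text \<open>
  The given neighbourhoods with arbitrary centres form a subbase; those centred at \<open>\<xi>\<close> form a base at \<open>\<xi>\<close>, since the
  distance of two rays from \<open>b\<close> grows with time.
\<close>
lemma cone_topology_nbhd_base:
  assumes T: "openin (cone_topology b) T" and xi: "\<xi> \<in> T" "\<xi> \<in> visual_boundary" "\<alpha> \<in> \<xi>" "\<alpha> 0 = b"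
  shows "\<exists>R>0. \<exists>e>0. \<forall>\<zeta>\<in>visual_boundary. \<forall>\<beta>\<in>\<zeta>. \<beta> 0 = b \<and> dist (\<alpha> R) (\<beta> R) < e \<longrightarrow> \<zeta> \<in> T"
proof -
  let ?B = "{cone_nbhd b \<xi> R e | \<xi> R e. \<xi> \<in> visual_boundary \<and> 0 < R \<and> 0 < e}"
  have "generate_topology_on ?B T"
    using T unfolding cone_topology_def openin_topology_generated_by_iff .
  then show ?thesis using xi(1)
  proof (induction rule: generate_topology_on.induct)
    case (Int A B)
    obtain R e where A: "0 < R" "0 < e" "\<forall>\<zeta>\<in>visual_boundary. \<forall>\<beta>\<in>\<zeta>. \<beta> 0 = b \<and> dist (\<alpha> R) (\<beta> R) < e \<longrightarrow> \<zeta> \<in> A"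
      using Int by blast
    obtain R' e' where B: "0 < R'" "0 < e'" "\<forall>\<zeta>\<in>visual_boundary. \<forall>\<beta>\<in>\<zeta>. \<beta> 0 = b \<and> dist (\<alpha> R') (\<beta> R') < e' \<longrightarrow> \<zeta> \<in> B"
      using Int by blast
    have "\<zeta> \<in> A \<inter> B" if z: "\<zeta> \<in> visual_boundary" "\<beta> \<in> \<zeta>" "\<beta> 0 = b" "dist (\<alpha> (max R R')) (\<beta> (max R R')) < min e e'" for \<zeta> \<beta>
    proof -
      have "dist (\<alpha> r) (\<beta> r) \<le> dist (\<alpha> (max R R')) (\<beta> (max R R'))" if "r \<in> {R, R'}" for r
        by (rule ray_dist_mono) (use visual_boundaryD(1) xi z A B that in auto)
      then have "dist (\<alpha> R) (\<beta> R) < e" "dist (\<alpha> R') (\<beta> R') < e'" using z(4) by force+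
      then show ?thesis using A(3) B(3) z by blast
    qed
    then show ?case using A B by (intro exI[of _ "max R R'"] conjI exI[of _ "min e e'"]) auto
  next
    case (UN K)
    then obtain A where A: "A \<in> K" "\<xi> \<in> A" by blast
    then obtain R e where "0 < R" "0 < e"
      "\<forall>\<zeta>\<in>visual_boundary. \<forall>\<beta>\<in>\<zeta>. \<beta> 0 = b \<and> dist (\<alpha> R) (\<beta> R) < e \<longrightarrow> \<zeta> \<in> A"
      using UN.IH[OF A] by blast
    then show ?case using A(1) by (intro exI[of _ R] conjI exI[of _ e]) auto
  next
    case (Basis s)
    then obtain \<xi>0 R e where s: "s = cone_nbhd b \<xi>0 R e" "\<xi>0 \<in> visual_boundary" "0 < R" "0 < e" by blast
    obtain \<alpha>0 where a0: "\<alpha>0 \<in> \<xi>0" "\<alpha>0 0 = b" using visual_boundary_ray_from[OF s(2), of b] by blast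
    have lt: "dist (\<alpha>0 R) (\<alpha> R) < e"
      using Basis cone_nbhd_iff[OF s(2) a0 xi(2,3,4)] s by simp
    have "\<zeta> \<in> s" if z: "\<zeta> \<in> visual_boundary" "\<beta> \<in> \<zeta>" "\<beta> 0 = b" "dist (\<alpha> R) (\<beta> R) < e - dist (\<alpha>0 R) (\<alpha> R)" for \<zeta> \<beta>
      using cone_nbhd_iff[OF s(2) a0 z(1,2,3)] s z(4) dist_triangle[of "\<alpha>0 R" "\<beta> R" "\<alpha> R"] by simp
    then show ?case using s lt by (intro exI[of _ R] conjI exI[of _ "e - dist (\<alpha>0 R) (\<alpha> R)"]) auto
  qed simp
qed

lemma isometry_geo:
  fixes g :: "'a \<Rightarrow> 'a"
  assumes g: "g \<in> isometries" and t: "0 \<le> t" "t \<le> dist x y"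
  shows "geo (g x) (g y) t = g (geo x y t)"
proof -
  have "geodesic_between (g \<circ> geo x y) (g x) (g y)"
    by (rule geodesic_betweenI) (simp_all add: isometry_dist[OF g] dist_geo)
  then show ?thesis using geo_unique[of "g \<circ> geo x y" "g x" "g y" t] t by (simp add: isometry_dist[OF g])
qed

text \<open>
  From every point \<open>c\<close>, the geodesics to one of two distinct boundary points pass near \<open>b\<close>. Applied to
  translates, this produces boundary points whose rays follow a given ray for a long time.
\<close>
lemma dense_if_two_points:
  assumes cob: "\<And>x. \<exists>g\<in>isometries. dist x (g b) \<le> B"
    and eta: "\<eta> \<in> gromov_boundary D b" "\<theta> \<in> gromov_boundary D b" "\<eta> \<noteq> \<theta>"
    and be: "geodesic_ray \<beta>" "\<beta> 0 = b" and Re: "0 < R" "0 < e"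
  shows "\<exists>\<zeta>\<in>represented_boundary D b. \<exists>\<rho>\<in>\<zeta>. \<rho> 0 = b \<and> dist (\<beta> R) (\<rho> R) < e"
proof -
  obtain \<alpha> where \<alpha>: "ray_represents D b \<alpha> \<eta>" "\<alpha> 0 = b" "to_visual \<eta> = ray_class \<alpha>"
    using ray_to_boundary_point[OF eta(1)] by blast
  obtain \<alpha>' where \<alpha>': "ray_represents D b \<alpha>' \<theta>" "\<alpha>' 0 = b" "to_visual \<theta> = ray_class \<alpha>'"
    using ray_to_boundary_point[OF eta(2)] by blast
  have rays: "geodesic_ray \<alpha>" "geodesic_ray \<alpha>'" using \<alpha> \<alpha>' by (auto simp: ray_represents_iff)
  have "\<not> asymptotic \<alpha> \<alpha>'"
    using ray_class_eq[of \<alpha> \<alpha>'] \<alpha>(3) \<alpha>'(3) to_visual_inj eta unfolding inj_on_def by metis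
  then obtain M T where MT: "\<forall>s\<ge>T. \<forall>t\<ge>T. 0 \<le> T \<and> sep b (\<alpha> s) (\<alpha>' t) \<le> M"
    using sep_between_distinct_rays[OF rays(1) \<alpha>(2) rays(2) \<alpha>'(2)] by blast
  obtain S1 where S1: "nat \<lceil>T\<rceil> \<le> S1" "M + 14 * Lam \<le> sep b (on_ray \<alpha> S1) (on_ray \<alpha> S1)"
    using diverging_ray[OF \<alpha>(1)] by blast
  obtain S2 where S2: "nat \<lceil>T\<rceil> \<le> S2" "M + 14 * Lam \<le> sep b (on_ray \<alpha>' S2) (on_ray \<alpha>' S2)"
    using diverging_ray[OF \<alpha>'(1)] by blast
  define S where "S = max S1 S2"
  have pass: "\<exists>\<kappa>. (\<kappa> = \<alpha> \<or> \<kappa> = \<alpha>') \<and> (\<forall>t\<ge>real S. \<exists>m\<in>{0..dist c (\<kappa> t)}. dist b (geo c (\<kappa> t) m) \<le> 2 * real S)" for c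
  proof -
    let ?p = "on_ray \<alpha> S1" and ?q = "on_ray \<alpha>' S2"
    have "T \<le> real S1" "T \<le> real S2" using S1 S2 by linarith+
    then have "sep b ?p ?q \<le> M" using MT by blast
    then have "min (sep b ?p c) (sep b c ?q) \<le> M + 3 * Lam" using sep_hyperbolic[of b ?p c ?q] by linarith
    then consider "sep b ?p c + 10 * Lam < sep b ?p ?p" | "sep b ?q c + 10 * Lam < sep b ?q ?q"
      using S1(2) S2(2) Lam_pos sep_commute[of b c ?q] by (auto simp: min_def split: if_splits)
    then show ?thesis
    proof cases
      case 1
      have "\<exists>m\<in>{0..dist c (\<alpha> t)}. dist b (geo c (\<alpha> t) m) \<le> 2 * real S" if St: "real S \<le> t" for t
      proof -
        have le: "real S1 \<le> real S" by (simp add: S_def)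
        then obtain m where "m \<in> {0..dist c (\<alpha> t)}" "dist b (geo c (\<alpha> t) m) \<le> 2 * real S1"
          using geodesics_to_ray_pass_near[OF rays(1) \<alpha>(2) _ _ 1, of t] St le by auto
        then show ?thesis using le by (intro bexI[of _ m]) auto
      qed
      then show ?thesis by blast
    next
      case 2
      have "\<exists>m\<in>{0..dist c (\<alpha>' t)}. dist b (geo c (\<alpha>' t) m) \<le> 2 * real S" if St: "real S \<le> t" for t
      proof -
        have le: "real S2 \<le> real S" by (simp add: S_def)
        then obtain m where "m \<in> {0..dist c (\<alpha>' t)}" "dist b (geo c (\<alpha>' t) m) \<le> 2 * real S2"
          using geodesics_to_ray_pass_near[OF rays(2) \<alpha>'(2) _ _ 2, of t] St le by auto
        then show ?thesis using le by (intro bexI[of _ m]) auto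
      qed
      then show ?thesis by blast
    qed
  qed
  define E where "E = 2 * real S + B"
  have B0: "0 \<le> B" using cob[of b] zero_le_dist order_trans by blast
  obtain n :: nat where n: "E + R + (2 * E * R + 1) / e < real n" using reals_Archimedean2 by blast
  have E0: "0 \<le> E" using B0 by (simp add: E_def)
  have q0: "0 \<le> (2 * E * R + 1) / e" using E0 Re by simp
  have nE: "E < real n" "R \<le> real n - E" "R \<le> real n" using n q0 Re E0 by linarith+
  obtain g where g: "g \<in> isometries" "dist (\<beta> (real n)) (g b) \<le> B" using cob by blast
  define c where "c = inv g b"
  have gc: "g c = b" using isometry_bij[OF g(1)] by (simp add: c_def bij_is_surj surj_f_inv_f)
  obtain \<kappa> where \<kappa>: "\<kappa> = \<alpha> \<or> \<kappa> = \<alpha>'"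
    "\<forall>t\<ge>real S. \<exists>m\<in>{0..dist c (\<kappa> t)}. dist b (geo c (\<kappa> t) m) \<le> 2 * real S"
    using pass[of c] by blast
  obtain \<tau> where krep: "ray_represents D b \<kappa> \<tau>" using \<kappa>(1) \<alpha>(1) \<alpha>'(1) by blast
  then have kray: "geodesic_ray \<kappa>" by (simp add: ray_represents_iff)
  note gk = boundary_action_class[OF g(1) kray]
  have xk: "ray_class (g \<circ> \<kappa>) \<in> represented_boundary D b"
  proof -
    obtain \<tau>' where "ray_represents D b (g \<circ> \<kappa>) \<tau>'" using represents_isometry[OF g(1) krep] by blast
    then show ?thesis
      unfolding represented_boundary_def visual_boundary_eq using ray_class_in[OF gk(2)] gk(2) by blast
  qed
  obtain \<rho> where \<rho>: "geodesic_ray \<rho>" "\<rho> 0 = b" "\<forall>s\<ge>0. dist (\<rho> s) ((g \<circ> \<kappa>) s) \<le> 2 * dist b ((g \<circ> \<kappa>) 0)"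
    "\<And>R. 0 \<le> R \<Longrightarrow> (\<lambda>j. geo b ((g \<circ> \<kappa>) (real j)) R) \<longlonglongrightarrow> \<rho> R"
    using asymptotic_ray_from[OF gk(2), of b] by blast
  have "asymptotic (g \<circ> \<kappa>) \<rho>"
    using \<rho>(3) asymptotic_sym unfolding asymptotic_def by blast
  then have rho: "\<rho> \<in> ray_class (g \<circ> \<kappa>)" using \<rho>(1) by (simp add: ray_class_def)
  have "dist (\<beta> R) (\<rho> R) \<le> 2 * E * R / (real n - E)"
  proof (rule tendsto_upperbound)
    show "(\<lambda>j. dist (\<beta> R) (geo b ((g \<circ> \<kappa>) (real j)) R)) \<longlonglongrightarrow> dist (\<beta> R) (\<rho> R)"
      by (intro tendsto_dist tendsto_const \<rho>(4)) (use Re in auto)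
    show "\<forall>\<^sub>F j in sequentially. dist (\<beta> R) (geo b ((g \<circ> \<kappa>) (real j)) R) \<le> 2 * E * R / (real n - E)"
      using eventually_ge_at_top[of S]
    proof eventually_elim
      case (elim j)
      obtain m where m: "0 \<le> m" "m \<le> dist c (\<kappa> (real j))" "dist b (geo c (\<kappa> (real j)) m) \<le> 2 * real S"
        using \<kappa>(2) elim by (metis atLeastAtMost_iff of_nat_le_iff)
      let ?y = "(g \<circ> \<kappa>) (real j)"
      have my: "m \<le> dist b ?y" using m(2) isometry_dist[OF g(1), of c "\<kappa> (real j)"] gc by simp
      have "geo b ?y m = g (geo c (\<kappa> (real j)) m)" using isometry_geo[OF g(1) m(1,2)] gc by simp
      then have "dist (g b) (geo b ?y m) \<le> 2 * real S" using m(3) by (simp add: isometry_dist[OF g(1)])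
      then have "dist (\<beta> (real n)) (geo b ?y m) \<le> E"
        using g(2) dist_triangle[of "\<beta> (real n)" "geo b ?y m" "g b"] unfolding E_def by linarith
      moreover have bn: "dist b (\<beta> (real n)) = real n" using ray_dist[OF be(1), of 0 "real n"] be(2) by simp
      moreover have "geo b (\<beta> (real n)) (real n) = \<beta> (real n)" using ray_geo[OF be(1), of "real n" "real n"] be(2) by simp
      ultimately have "dist (geo b (\<beta> (real n)) R) (geo b ?y R) \<le> 2 * E * R / (real n - E)"
        by (intro geo_fan_close[where s = "real n" and s' = m]) (use m(1) my nE Re in auto)
      moreover have "geo b (\<beta> (real n)) R = \<beta> R" using ray_geo[OF be(1), of R "real n"] be(2) nE Re by simp
      ultimately show ?case by simp
    qed
  qed simp
  also have "\<dots> < e"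
  proof -
    have "(2 * E * R + 1) / e < real n - E" using n Re by linarith
    then have "2 * E * R + 1 < e * (real n - E)" using Re by (simp add: field_simps)
    moreover have "0 < real n - E" using n q0 Re by linarith
    ultimately show ?thesis by (simp add: field_simps)
  qed
  finally show ?thesis using xk rho \<rho>(2) by blast
qed

lemma D_le_bound: "dist x y \<le> C \<Longrightarrow> D x y \<le> (C + 1) * Lam"
  by (rule order_trans[OF D_le_dist mult_right_mono]) (use Lam_pos in auto)

lemma represented_if_diverging:
  assumes rho: "geodesic_ray \<rho>" "\<rho> 0 = b" and div: "\<And>M. \<exists>N. \<forall>n\<ge>N. M \<le> D b (on_ray \<rho> n)"
  shows "ray_class \<rho> \<in> represented_boundary D b"
proof -
  have "comparable (on_ray \<rho>) (on_ray \<rho>)"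
    unfolding comparable_def
  proof
    fix M
    obtain N where N: "\<forall>n\<ge>N. M + 6 * Lam \<le> D b (on_ray \<rho> n)" using div by blast
    have *: "M \<le> sep b (on_ray \<rho> m) (on_ray \<rho> n)" if "N \<le> m" "m \<le> n" for m n
    proof -
      have "M + 6 * Lam \<le> D b (on_ray \<rho> m)" using N that by blast
      moreover have "D b (on_ray \<rho> m) \<le> sep b (on_ray \<rho> m) (on_ray \<rho> m) + Lam" by (rule D_sep(2))
      moreover have "sep b (on_ray \<rho> m) (on_ray \<rho> m) \<le> sep b (on_ray \<rho> m) (on_ray \<rho> n) + 5 * Lam"
        by (rule sep_along_ray[OF rho]) (use that in auto)
      ultimately show ?thesis by linarith
    qed
    have "M \<le> sep b (on_ray \<rho> m) (on_ray \<rho> n)" if "N \<le> m" "N \<le> n" for m n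
      using *[of m n] *[of n m] that sep_commute by (cases "m \<le> n") auto
    then show "\<exists>N. \<forall>m\<ge>N. \<forall>n\<ge>N. M \<le> sep b (on_ray \<rho> m) (on_ray \<rho> n)" by blast
  qed
  then have c: "{y. comparable (on_ray \<rho>) y} \<in> gromov_boundary D b" "on_ray \<rho> \<in> {y. comparable (on_ray \<rho>) y}"
    using gromov_boundaryI by blast+
  then have "ray_represents D b \<rho> {y. comparable (on_ray \<rho>) y}" using rho(1) unfolding ray_represents_iff by blast
  then show ?thesis
    unfolding represented_boundary_def visual_boundary_eq using ray_class_in[OF rho(1)] rho(1) by blast
qed

text \<open>
  If there is only one boundary point, all isometries fix it, so the progress of its rays does not depend on
  where they start. Along a line to it from any other point \<open>\<xi>\<close> of the visual boundary the progress up to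
  a fixed point is then unbounded as the start moves towards \<open>\<xi>\<close>, which makes \<open>\<xi>\<close> a boundary point as well.
\<close>
lemma all_represented_if_one_point:
  assumes cob: "\<And>x. \<exists>g\<in>isometries. dist x (g b) \<le> B"
    and eta: "gromov_boundary D b = {\<eta>}" and xi: "\<xi> \<in> visual_boundary"
  shows "\<xi> \<in> represented_boundary D b"
proof (cases "\<xi> = to_visual \<eta>")
  case True
  then show ?thesis using to_visual_image eta by blast
next
  case False
  have etaB: "\<eta> \<in> gromov_boundary D b" using eta by blast
  have rep1: "represented_boundary D b = {to_visual \<eta>}" using to_visual_image eta by auto
  obtain \<alpha> where \<alpha>: "ray_represents D b \<alpha> \<eta>" "\<alpha> 0 = b" "to_visual \<eta> = ray_class \<alpha>"
    using ray_to_boundary_point[OF etaB] by blast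
  have aray: "geodesic_ray \<alpha>" using \<alpha>(1) by (simp add: ray_represents_iff)
  obtain \<gamma> where \<gamma>: "geodesic_on UNIV \<gamma>" "\<gamma> \<in> to_visual \<eta>" "(\<lambda>t. \<gamma> (- t)) \<in> \<xi>"
    using visibility[of "to_visual \<eta>"] rep1 False xi unfolding visibility_point_def by blast
  have gd: "dist (\<gamma> s) (\<gamma> t) = \<bar>s - t\<bar>" for s t using \<gamma>(1) by (simp add: geodesic_on_def)
  have B0: "0 \<le> B" using cob[of b] zero_le_dist order_trans by blast
  have prog: "D b (\<alpha> t) \<le> D (\<gamma> 0) (\<gamma> (- t)) + (3 * B + 2) * Lam" if t: "0 \<le> t" for t
  proof -
    define x where "x = \<gamma> (- t)"
    obtain g where g: "g \<in> isometries" "dist x (g b) \<le> B" using cob by blast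
    note ga = boundary_action_class[OF g(1) aray]
    have "boundary_action g (to_visual \<eta>) = to_visual \<eta>"
      using boundary_action_represented[OF g(1), of "to_visual \<eta>"] rep1 by blast
    then have "ray_class (g \<circ> \<alpha>) = to_visual \<eta>" using ga(1) \<alpha>(3) by simp
    then have as1: "asymptotic (g \<circ> \<alpha>) \<gamma>" using \<gamma>(2) by (auto simp: ray_class_def)
    define \<delta> where "\<delta> s = \<gamma> (s - t)" for s
    have \<delta>: "geodesic_ray \<delta>" "\<delta> 0 = x" by (auto intro!: geodesic_rayI simp: gd \<delta>_def x_def)
    have as2: "asymptotic \<gamma> \<delta>" unfolding asymptotic_def \<delta>_def using gd by (intro exI[of _ "\<bar>t\<bar>"]) simp
    obtain \<sigma> where \<sigma>: "geodesic_ray \<sigma>" "\<sigma> 0 = x" "\<forall>s\<ge>0. dist (\<sigma> s) ((g \<circ> \<alpha>) s) \<le> 2 * dist x ((g \<circ> \<alpha>) 0)"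
      using asymptotic_ray_from[OF ga(2), of x] by blast
    have "asymptotic \<sigma> (g \<circ> \<alpha>)" using \<sigma>(3) unfolding asymptotic_def by blast
    then have "asymptotic \<sigma> \<delta>" using as1 as2 asymptotic_trans by blast
    then have "\<sigma> t = \<delta> t" using asymptotic_rays_agree[OF \<sigma>(1) \<delta>(1) _ _ t] \<sigma>(2) \<delta>(2) by simp
    then have "dist (\<gamma> 0) (g (\<alpha> t)) \<le> 2 * dist x (g b)" using \<sigma>(3) t \<alpha>(2) by (auto simp: \<delta>_def)
    then have d: "dist (\<gamma> 0) (g (\<alpha> t)) \<le> 2 * B" using g(2) by linarith
    have "D b (\<alpha> t) = D (g b) (g (\<alpha> t))" by (simp add: D_isometry[OF g(1)])
    also have "\<dots> \<le> D (g b) x + (D x (\<gamma> 0) + D (\<gamma> 0) (g (\<alpha> t)))"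
      using D_triangle[of "g b" "g (\<alpha> t)" x] D_triangle[of x "g (\<alpha> t)" "\<gamma> 0"] by linarith
    also have "D (g b) x \<le> (B + 1) * Lam" using g(2) by (intro D_le_bound) (simp add: dist_commute)
    also have "D (\<gamma> 0) (g (\<alpha> t)) \<le> (2 * B + 1) * Lam" by (rule D_le_bound[OF d])
    finally show ?thesis using D_commute[of x "\<gamma> 0"] by (simp add: x_def algebra_simps)
  qed
  obtain \<rho> where \<rho>: "\<rho> \<in> \<xi>" "\<rho> 0 = b" using visual_boundary_ray_from[OF xi, of b] by blast
  note rho = visual_boundaryD[OF xi \<rho>(1)]
  have "asymptotic \<rho> (\<lambda>t. \<gamma> (- t))" using \<gamma>(3) rho(2) by (simp add: ray_class_def)
  then obtain C where C: "\<forall>t\<ge>0. dist (\<rho> t) (\<gamma> (- t)) \<le> C" unfolding asymptotic_def by blast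
  have "\<exists>N. \<forall>n\<ge>N. M \<le> D b (on_ray \<rho> n)" for M
  proof -
    define K where "K = (3 * B + 2) * Lam + D b (\<gamma> 0) + (C + 1) * Lam"
    have "comparable (on_ray \<alpha>) (on_ray \<alpha>)" using \<alpha>(1) gromov_boundaryD(2) unfolding ray_represents_iff by blast
    then obtain N where N: "\<forall>m\<ge>N. \<forall>n\<ge>N. M + K \<le> sep b (on_ray \<alpha> m) (on_ray \<alpha> n)"
      unfolding comparable_def by blast
    have "M \<le> D b (on_ray \<rho> n)" if n: "N \<le> n" for n
    proof -
      let ?y = "\<gamma> (- real n)"
      have "M + K \<le> D b (on_ray \<alpha> n)" using N n D_sep(1)[of b "on_ray \<alpha> n"] by force
      moreover have "D b (on_ray \<alpha> n) \<le> D (\<gamma> 0) ?y + (3 * B + 2) * Lam" by (rule prog) simp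
      moreover have "D (\<gamma> 0) ?y \<le> D b (\<gamma> 0) + (D b (on_ray \<rho> n) + D (on_ray \<rho> n) ?y)"
        using D_triangle[of "\<gamma> 0" ?y b] D_triangle[of b ?y "on_ray \<rho> n"] D_commute[of b "\<gamma> 0"] by linarith
      moreover have "D (on_ray \<rho> n) ?y \<le> (C + 1) * Lam"
        using C by (intro D_le_bound) simp
      ultimately show ?thesis unfolding K_def by linarith
    qed
    then show ?thesis by blast
  qed
  then show ?thesis using represented_if_diverging[OF rho(1) \<rho>(2)] rho(2) by simp
qed

lemma density:
  assumes ne: "gromov_boundary D b \<noteq> {}" and cob: "acts_coboundedly (isometries :: ('a \<Rightarrow> 'a) set)"
  shows "cone_topology b closure_of represented_boundary D b = visual_boundary"
proof
  show "cone_topology b closure_of represented_boundary D b \<subseteq> visual_boundary"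
    using closure_of_subset_topspace[of "cone_topology b"] by (simp add: topspace_cone_topology)
  obtain S where S: "bounded S" "(\<Union>g\<in>isometries. g ` S) = (UNIV :: 'a set)"
    using cob unfolding acts_coboundedly_def by blast
  obtain B where B: "\<forall>x\<in>S. dist b x \<le> B" using S(1) bounded_any_center[of S b] by blast
  have near: "\<exists>g\<in>isometries. dist x (g b) \<le> B" for x :: 'a
  proof -
    obtain g y where "g \<in> isometries" "y \<in> S" "x = g y" using S(2) by blast
    then show ?thesis using B isometry_dist[of g y b] by (auto simp: dist_commute intro!: bexI[of _ g])
  qed
  show "visual_boundary \<subseteq> cone_topology b closure_of represented_boundary D b"
  proof
    fix \<xi> :: "(real \<Rightarrow> 'a) set" assume xi: "\<xi> \<in> visual_boundary"
    have sub: "represented_boundary D b \<subseteq> visual_boundary" by (auto simp: represented_boundary_def)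
    show "\<xi> \<in> cone_topology b closure_of represented_boundary D b"
    proof (cases "\<exists>\<eta>. gromov_boundary D b = {\<eta>}")
      case True
      then have "\<xi> \<in> represented_boundary D b" using all_represented_if_one_point[OF near _ xi] by blast
      then show ?thesis using closure_of_subset[of _ "cone_topology b"] sub by (auto simp: topspace_cone_topology)
    next
      case False
      then obtain \<eta> \<theta> where two: "\<eta> \<in> gromov_boundary D b" "\<theta> \<in> gromov_boundary D b" "\<eta> \<noteq> \<theta>" using ne by blast
      obtain \<beta> where \<beta>: "\<beta> \<in> \<xi>" "\<beta> 0 = b" using visual_boundary_ray_from[OF xi, of b] by blast
      show ?thesis
        unfolding in_closure_of topspace_cone_topology
      proof (intro conjI xi allI impI)
        fix T assume T: "\<xi> \<in> T \<and> openin (cone_topology b) T"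
        obtain R e where Re: "0 < R" "0 < e"
          "\<forall>\<zeta>\<in>visual_boundary. \<forall>\<rho>\<in>\<zeta>. \<rho> 0 = b \<and> dist (\<beta> R) (\<rho> R) < e \<longrightarrow> \<zeta> \<in> T"
          using cone_topology_nbhd_base[of T \<xi> \<beta>] T xi \<beta> by blast
        obtain \<zeta> \<rho> where "\<zeta> \<in> represented_boundary D b" "\<rho> \<in> \<zeta>" "\<rho> 0 = b" "dist (\<beta> R) (\<rho> R) < e"
          using dense_if_two_points[OF near two visual_boundaryD(1)[OF xi \<beta>(1)] \<beta>(2) Re(1,2)] by blast
        then show "\<exists>y. y \<in> represented_boundary D b \<and> y \<in> T" using Re(3) sub by blast
      qed
    qed
  qed
qed

end

theorem theorem12:
  fixes b :: "'a::cat0_space" and lam :: "nat \<Rightarrow> real"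
  assumes proper: "\<And>(x::'a) r. compact (cball x r)"
    and weights: "curtain_weights lam"
  shows "\<exists>\<phi>.
     embedding_map (gromov_topology (curtain_dist lam) b) (cone_topology b) \<phi> \<and>
     \<phi> ` gromov_boundary (curtain_dist lam) b = represented_boundary (curtain_dist lam) b \<and>
     (\<forall>\<xi>\<in>visual_boundary. \<forall>\<alpha>\<in>\<xi>. \<forall>\<eta>. ray_represents (curtain_dist lam) b \<alpha> \<eta> \<longrightarrow> \<phi> \<eta> = \<xi>) \<and>
     (\<forall>g\<in>isometries. boundary_action g ` (\<phi> ` gromov_boundary (curtain_dist lam) b)
        = \<phi> ` gromov_boundary (curtain_dist lam) b) \<and>
     (\<forall>\<xi>\<in>\<phi> ` gromov_boundary (curtain_dist lam) b. visibility_point \<xi>) \<and>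
     (gromov_boundary (curtain_dist lam) b \<noteq> {} \<and> acts_coboundedly (isometries :: ('a \<Rightarrow> 'a) set) \<longrightarrow>
        cone_topology b closure_of (\<phi> ` gromov_boundary (curtain_dist lam) b) = visual_boundary)"
proof -
  interpret curtain_model lam b by unfold_locales (use proper weights in auto)
  show ?thesis
  proof (intro exI[of _ to_visual] conjI ballI allI impI)
    show "to_visual \<eta> = \<xi>" if "\<xi> \<in> visual_boundary" "\<alpha> \<in> \<xi>" "ray_represents D b \<alpha> \<eta>" for \<xi> \<alpha> \<eta>
      using to_visual_eq that .
  qed (use embedding_to_visual to_visual_image boundary_action_image visibility density in \<open>simp_all\<close>)
qed

end
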